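(* Suppose $q$ is not a root of unity. Let $n\ge m$ be two non-negative integers, let $\varepsilon,\varepsilon'\in\{\pm1\}$ and $\alpha,\beta,\alpha',\beta'\in\mathbb{K}^\times$. There exists an isomorphism of $U_{g,h}$-modules $$V_{\varepsilon,n,\alpha,\beta}\otimes V_{\varepsilon',m,\alpha',\beta'}\cong V_{\varepsilon\varepsilon',n+m,\alpha\alpha',\beta\beta'}\oplus V_{\varepsilon\varepsilon',n+m-2,\alpha\alpha',\beta\beta'}\oplus\cdots\oplus V_{\varepsilon\varepsilon',n-m,\alpha\alpha',\beta\beta'}.$$
   Context: $\mathbb{K}$ is an algebraically closed field of characteristic zero, and $q\in\mathbb{K}$ is nonzero with $q^2\neq 1$. $U_{g,h}$ is the unital associative $\mathbb{K}$-algebra generated by $E,F,K^{\pm1},g^{\pm1},h^{\pm1}$ with relations: $KK^{-1}=K^{-1}K=gg^{-1}=g^{-1}g=hh^{-1}=h^{-1}h=1$; $g$ and $h$ commute with each other and with $E,F,K$; $KEK^{-1}=q^2E$; $KFK^{-1}=q^{-2}F$; $EF-FE=\frac{K-K^{-1}g^2}{q-q^{-1}}$. It is a Hopf algebra with coproduct $\Delta(E)=h^{-1}\otimes E+E\otimes hK$, $\Delta(F)=K^{-1}hg^2\otimes F+F\otimes h^{-1}$, and $K^{\pm1},g^{\pm1},h^{\pm1}$ group-like; counit $\varepsilon(E)=\varepsilon(F)=0$, $\varepsilon(K)=\varepsilon(g)=\varepsilon(h)=1$; antipode $S(E)=-EK^{-1}$, $S(F)=-KFg^{-2}$, $S(K)=K^{-1}$,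 $S(g)=g^{-1}$, $S(h)=h^{-1}$. The tensor product of two $U_{g,h}$-modules is a $U_{g,h}$-module via $\Delta$. For $\varepsilon=\pm1$, $n\in\mathbb{Z}_{\ge0}$, $\alpha,\beta\in\mathbb{K}^\times$, $V_{\varepsilon,n,\alpha,\beta}$ is the $(n+1)$-dimensional simple left $U_{g,h}$-module generated by a vector $v\neq0$ with $Ev=0$, $Kv=\varepsilon\alpha q^nv$, $gv=\alpha v$, $hv=\beta v$. Explicitly, with $[m]=\frac{q^m-q^{-m}}{q-q^{-1}}$, it has basis $v_0,\dots,v_n$ with $Kv_p=\varepsilon\alpha q^{n-2p}v_p$, $gv_p=\alpha v_p$, $hv_p=\beta v_p$, $Fv_p=[p+1]v_{p+1}$ ($p<n$), $Fv_n=0$, $Ev_p=\varepsilon\alpha[n-p+1]v_{p-1}$ ($p\ge1$), $Ev_0=0$. *)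

theory Defs
  imports "HOL-Algebra.Algebraic_Closure_Type" "HOL-Library.Poly_Mapping"
begin

section \<open>Left modules over a (not necessarily commutative) ring\<close>

text \<open>The axioms of \<^locale>\<open>Module.module\<close> with the scalar ring no longer required to be commutative.
  In the module records below the fields \<open>mult\<close> and \<open>one\<close> carry no meaning.\<close>

locale left_module = R?: ring R + M?: abelian_group M
  for R :: "('r, 'c) ring_scheme" (structure) and M :: "('r, 'a, 'd) module_scheme" (structure) +
  assumes smult_closed:
      "\<lbrakk>a \<in> carrier R; x \<in> carrier M\<rbrakk> \<Longrightarrow> a \<odot>\<^bsub>M\<^esub> x \<in> carrier M"
    and smult_l_distr:
      "\<lbrakk>a \<in> carrier R; b \<in> carrier R; x \<in> carrier M\<rbrakk> \<Longrightarrow>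
        (a \<oplus>\<^bsub>R\<^esub> b) \<odot>\<^bsub>M\<^esub> x = a \<odot>\<^bsub>M\<^esub> x \<oplus>\<^bsub>M\<^esub> b \<odot>\<^bsub>M\<^esub> x"
    and smult_r_distr:
      "\<lbrakk>a \<in> carrier R; x \<in> carrier M; y \<in> carrier M\<rbrakk> \<Longrightarrow>
        a \<odot>\<^bsub>M\<^esub> (x \<oplus>\<^bsub>M\<^esub> y) = a \<odot>\<^bsub>M\<^esub> x \<oplus>\<^bsub>M\<^esub> a \<odot>\<^bsub>M\<^esub> y"
    and smult_assoc1:
      "\<lbrakk>a \<in> carrier R; b \<in> carrier R; x \<in> carrier M\<rbrakk> \<Longrightarrow>
        (a \<otimes>\<^bsub>R\<^esub> b) \<odot>\<^bsub>M\<^esub> x = a \<odot>\<^bsub>M\<^esub> (b \<odot>\<^bsub>M\<^esub> x)"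
    and smult_one:
      "x \<in> carrier M \<Longrightarrow> \<one>\<^bsub>R\<^esub> \<odot>\<^bsub>M\<^esub> x = x"

definition left_module_iso ::
    "('r, 'c) ring_scheme \<Rightarrow> ('r, 'a, 'd) module_scheme \<Rightarrow> ('r, 'b, 'e) module_scheme \<Rightarrow> ('a \<Rightarrow> 'b) set"
  where "left_module_iso R M N =
    {f. bij_betw f (carrier M) (carrier N) \<and>
        (\<forall>x\<in>carrier M. \<forall>y\<in>carrier M. f (x \<oplus>\<^bsub>M\<^esub> y) = f x \<oplus>\<^bsub>N\<^esub> f y) \<and>
        (\<forall>a\<in>carrier R. \<forall>x\<in>carrier M. f (a \<odot>\<^bsub>M\<^esub> x) = a \<odot>\<^bsub>N\<^esub> f x)}"

definition left_modules_isomorphic ::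
    "('r, 'c) ring_scheme \<Rightarrow> ('r, 'a, 'd) module_scheme \<Rightarrow> ('r, 'b, 'e) module_scheme \<Rightarrow> bool"
  where "left_modules_isomorphic R M N \<longleftrightarrow>
    left_module R M \<and> left_module R N \<and> left_module_iso R M N \<noteq> {}"

definition direct_sum_module :: "'i set \<Rightarrow> ('i \<Rightarrow> ('r, 'a, 'c) module_scheme) \<Rightarrow> ('r, 'i \<Rightarrow> 'a) module"
  where "direct_sum_module I M =
    \<lparr>carrier = {f \<in> (\<Pi>\<^sub>E i\<in>I. carrier (M i)). finite {i \<in> I. f i \<noteq> \<zero>\<^bsub>M i\<^esub>}},
     monoid.mult = undefined, one = undefined,
     ring.zero = (\<lambda>i\<in>I. \<zero>\<^bsub>M i\<^esub>),
     add = (\<lambda>f g. \<lambda>i\<in>I. f i \<oplus>\<^bsub>M i\<^esub> g i),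
     module.smult = (\<lambda>a f. \<lambda>i\<in>I. a \<odot>\<^bsub>M i\<^esub> f i)\<rparr>"

definition quotient_module :: "('r, 'a, 'c) module_scheme \<Rightarrow> 'a set \<Rightarrow> ('r, 'a set) module"
  where "quotient_module M N =
    \<lparr>carrier = a_rcosets\<^bsub>M\<^esub> N, monoid.mult = undefined, one = undefined,
     ring.zero = N, add = set_add M,
     module.smult = (\<lambda>a S. \<Union>x\<in>S. N +>\<^bsub>M\<^esub> (a \<odot>\<^bsub>M\<^esub> x))\<rparr>"

definition generated_submodule :: "('r, 'c) ring_scheme \<Rightarrow> ('r, 'a, 'd) module_scheme \<Rightarrow> 'a set \<Rightarrow> 'a set"
  where "generated_submodule R M S = \<Inter>{N. submodule N R M \<and> S \<subseteq> N}"


section \<open>Vector spaces and their tensor products\<close>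

abbreviation scalars :: "'k::field ring"
  where "scalars \<equiv> ring_of_type_algebra"

text \<open>The vector space with basis \<open>S\<close>; the basis vector \<open>s\<close> is \<open>Poly_Mapping.single s 1\<close>.\<close>

definition free_space :: "'a set \<Rightarrow> ('k::field, 'a \<Rightarrow>\<^sub>0 'k) module"
  where "free_space S =
    \<lparr>carrier = {p. Poly_Mapping.keys p \<subseteq> S}, monoid.mult = undefined, one = undefined,
     ring.zero = 0, add = (+), module.smult = (\<lambda>c. Poly_Mapping.map ((*) c))\<rparr>"

definition tensor_relators ::
    "('k::field, 'a) module \<Rightarrow> ('k, 'b) module \<Rightarrow> ('a \<times> 'b \<Rightarrow>\<^sub>0 'k) set"
  where "tensor_relators V W =
    {Poly_Mapping.single (v \<oplus>\<^bsub>V\<^esub> v', w) 1 - Poly_Mapping.single (v, w) 1 - Poly_Mapping.single (v', w) 1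
      | v v' w. v \<in> carrier V \<and> v' \<in> carrier V \<and> w \<in> carrier W} \<union>
    {Poly_Mapping.single (v, w \<oplus>\<^bsub>W\<^esub> w') 1 - Poly_Mapping.single (v, w) 1 - Poly_Mapping.single (v, w') 1
      | v w w'. v \<in> carrier V \<and> w \<in> carrier W \<and> w' \<in> carrier W} \<union>
    {Poly_Mapping.single (c \<odot>\<^bsub>V\<^esub> v, w) 1 - Poly_Mapping.single (v, w) c
      | c v w. v \<in> carrier V \<and> w \<in> carrier W} \<union>
    {Poly_Mapping.single (v, c \<odot>\<^bsub>W\<^esub> w) 1 - Poly_Mapping.single (v, w) c
      | c v w. v \<in> carrier V \<and> w \<in> carrier W}"

definition tensor_null ::
    "('k::field, 'a) module \<Rightarrow> ('k, 'b) module \<Rightarrow> ('a \<times> 'b \<Rightarrow>\<^sub>0 'k) set"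
  where "tensor_null V W =
    generated_submodule scalars (free_space (carrier V \<times> carrier W)) (tensor_relators V W)"

definition tensor_space ::
    "('k::field, 'a) module \<Rightarrow> ('k, 'b) module \<Rightarrow> ('k, ('a \<times> 'b \<Rightarrow>\<^sub>0 'k) set) module"
  where "tensor_space V W =
    quotient_module (free_space (carrier V \<times> carrier W)) (tensor_null V W)"

definition tensor_class ::
    "('k::field, 'a) module \<Rightarrow> ('k, 'b) module \<Rightarrow> ('a \<times> 'b \<Rightarrow>\<^sub>0 'k) \<Rightarrow> ('a \<times> 'b \<Rightarrow>\<^sub>0 'k) set"
  where "tensor_class V W p = tensor_null V W +>\<^bsub>free_space (carrier V \<times> carrier W)\<^esub> p"

definition pure_tensor ::
    "('k::field, 'a) module \<Rightarrow> ('k, 'b) module \<Rightarrow> 'a \<Rightarrow> 'b \<Rightarrow> ('a \<times> 'b \<Rightarrow>\<^sub>0 'k) set"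
  where "pure_tensor V W v w = tensor_class V W (Poly_Mapping.single (v, w) 1)"


section \<open>The algebra\<close>

text \<open>\<open>gKi\<close>, \<open>ggi\<close>, \<open>ghi\<close> stand for the inverses of \<open>K\<close>, \<open>g\<close>, \<open>h\<close>.\<close>

datatype gen = gE | gF | gK | gKi | gg | ggi | gh | ghi

datatype word = Word (letters: "gen list")

instantiation word :: monoid_add
begin

definition zero_word :: word where "zero_word = Word []"

definition plus_word :: "word \<Rightarrow> word \<Rightarrow> word"
  where "plus_word u w = Word (letters u @ letters w)"

instance
  by standard (auto simp: zero_word_def plus_word_def)

end

text \<open>The free algebra on the generators is the monoid algebra of \<open>word\<close>: since \<open>+\<close> on words is
  concatenation, the product that \<open>Poly_Mapping\<close> puts on \<open>word \<Rightarrow>\<^sub>0 'k\<close> is the noncommutative one.\<close>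

type_synonym 'k free_alg = "word \<Rightarrow>\<^sub>0 'k"

abbreviation free_alg_ring :: "'k::field free_alg ring"
  where "free_alg_ring \<equiv> ring_of_type_algebra"

definition const :: "'k::field \<Rightarrow> 'k free_alg"
  where "const c = Poly_Mapping.single 0 c"

definition mon :: "gen list \<Rightarrow> 'k::field free_alg"
  where "mon xs = Poly_Mapping.single (Word xs) 1"

definition relators :: "'k::field \<Rightarrow> 'k free_alg set"
  where "relators q =
    {mon [gK, gKi] - 1, mon [gKi, gK] - 1,
     mon [gg, ggi] - 1, mon [ggi, gg] - 1,
     mon [gh, ghi] - 1, mon [ghi, gh] - 1,
     mon [gg, gh] - mon [gh, gg],
     mon [gg, gE] - mon [gE, gg], mon [gg, gF] - mon [gF, gg], mon [gg, gK] - mon [gK, gg],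
     mon [gh, gE] - mon [gE, gh], mon [gh, gF] - mon [gF, gh], mon [gh, gK] - mon [gK, gh],
     mon [gK, gE, gKi] - const (q ^ 2) * mon [gE],
     mon [gK, gF, gKi] - const (inverse (q ^ 2)) * mon [gF],
     mon [gE, gF] - mon [gF, gE] - const (inverse (q - inverse q)) * (mon [gK] - mon [gKi, gg, gg])}"

definition U_ideal :: "'k::field \<Rightarrow> 'k free_alg set"
  where "U_ideal q = genideal free_alg_ring (relators q)"

definition U :: "'k::field \<Rightarrow> 'k free_alg set ring"
  where "U q = free_alg_ring Quot (U_ideal q)"

definition U_class :: "'k::field \<Rightarrow> 'k free_alg \<Rightarrow> 'k free_alg set"
  where "U_class q a = U_ideal q +>\<^bsub>free_alg_ring\<^esub> a"

abbreviation U_mon :: "'k::field \<Rightarrow> gen list \<Rightarrow> 'k free_alg set"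
  where "U_mon q xs \<equiv> U_class q (mon xs)"

text \<open>Given operators on a vector space \<open>B\<close>, one for each generator, a word acts by composition (its
  rightmost letter first) and the free algebra acts by linear extension. If this action respects the
  relations, all representatives of an element of \<open>U q\<close> act in the same way; \<^const>\<open>the_elem\<close> picks
  out the common value.\<close>

definition free_alg_act ::
    "('k::field, 'b) module \<Rightarrow> (gen \<Rightarrow> 'b \<Rightarrow> 'b) \<Rightarrow> 'k free_alg \<Rightarrow> 'b \<Rightarrow> 'b"
  where "free_alg_act B op a b =
    (\<Oplus>\<^bsub>B\<^esub>w\<in>Poly_Mapping.keys a. Poly_Mapping.lookup a w \<odot>\<^bsub>B\<^esub> foldr op (letters w) b)"

definition U_act ::
    "('k::field, 'b) module \<Rightarrow> (gen \<Rightarrow> 'b \<Rightarrow> 'b) \<Rightarrow> 'k free_alg set \<Rightarrow> 'b \<Rightarrow> 'b"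
  where "U_act B op u b = the_elem ((\<lambda>a. free_alg_act B op a b) ` u)"

type_synonym ('k, 'a) U_module = "('k free_alg set, 'a) module"

definition module_of_space ::
    "('k::field, 'a) module \<Rightarrow> ('k free_alg set \<Rightarrow> 'a \<Rightarrow> 'a) \<Rightarrow> ('k, 'a) U_module"
  where "module_of_space B act =
    \<lparr>carrier = carrier B, monoid.mult = undefined, one = undefined,
     ring.zero = ring.zero B, add = add B, module.smult = act\<rparr>"

definition space_of_module :: "'k::field \<Rightarrow> ('k, 'a) U_module \<Rightarrow> ('k, 'a) module"
  where "space_of_module q M =
    \<lparr>carrier = carrier M, monoid.mult = undefined, one = undefined,
     ring.zero = ring.zero M, add = add M, module.smult = (\<lambda>c. module.smult M (U_class q (const c)))\<rparr>"

definition U_regular :: "'k::field \<Rightarrow> ('k, 'k free_alg set) U_module"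
  where "U_regular q =
    \<lparr>carrier = carrier (U q), monoid.mult = undefined, one = undefined,
     ring.zero = ring.zero (U q), add = add (U q), module.smult = monoid.mult (U q)\<rparr>"


section \<open>The coproduct and tensor products of modules\<close>

text \<open>The action of \<open>U \<otimes> U\<close> on \<open>M \<otimes> N\<close> over the ground field, \<open>(a \<otimes> b)(x \<otimes> y) = ax \<otimes> by\<close>,
  computed on representatives.\<close>

definition tensor_act ::
    "'k::field \<Rightarrow> ('k, 'a) U_module \<Rightarrow> ('k, 'b) U_module \<Rightarrow>
      ('k free_alg set \<times> 'k free_alg set \<Rightarrow>\<^sub>0 'k) set \<Rightarrow> ('a \<times> 'b \<Rightarrow>\<^sub>0 'k) set \<Rightarrow> ('a \<times> 'b \<Rightarrow>\<^sub>0 'k) set"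
  where "tensor_act q M N S T =
    (\<Union>s\<in>S. \<Union>t\<in>T. tensor_class (space_of_module q M) (space_of_module q N)
      (\<Sum>(a, b)\<in>Poly_Mapping.keys s. \<Sum>(x, y)\<in>Poly_Mapping.keys t.
        Poly_Mapping.single (a \<odot>\<^bsub>M\<^esub> x, b \<odot>\<^bsub>N\<^esub> y)
          (Poly_Mapping.lookup s (a, b) * Poly_Mapping.lookup t (x, y))))"

abbreviation UU :: "'k::field \<Rightarrow> ('k, ('k free_alg set \<times> 'k free_alg set \<Rightarrow>\<^sub>0 'k) set) module"
  where "UU q \<equiv> tensor_space (space_of_module q (U_regular q)) (space_of_module q (U_regular q))"

abbreviation UU_pure ::
    "'k::field \<Rightarrow> 'k free_alg set \<Rightarrow> 'k free_alg set \<Rightarrow> ('k free_alg set \<times> 'k free_alg set \<Rightarrow>\<^sub>0 'k) set"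
  where "UU_pure q \<equiv> pure_tensor (space_of_module q (U_regular q)) (space_of_module q (U_regular q))"

text \<open>The product \<open>(a \<otimes> b)(c \<otimes> d) = ac \<otimes> bd\<close> of the algebra \<open>U \<otimes> U\<close>.\<close>

abbreviation UU_mult ::
    "'k::field \<Rightarrow> ('k free_alg set \<times> 'k free_alg set \<Rightarrow>\<^sub>0 'k) set \<Rightarrow>
      ('k free_alg set \<times> 'k free_alg set \<Rightarrow>\<^sub>0 'k) set \<Rightarrow> ('k free_alg set \<times> 'k free_alg set \<Rightarrow>\<^sub>0 'k) set"
  where "UU_mult q \<equiv> tensor_act q (U_regular q) (U_regular q)"

primrec coproduct_gen ::
    "'k::field \<Rightarrow> gen \<Rightarrow> ('k free_alg set \<times> 'k free_alg set \<Rightarrow>\<^sub>0 'k) set"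
where
  "coproduct_gen q gE =
    UU_pure q (U_mon q [ghi]) (U_mon q [gE]) \<oplus>\<^bsub>UU q\<^esub> UU_pure q (U_mon q [gE]) (U_mon q [gh, gK])"
| "coproduct_gen q gF =
    UU_pure q (U_mon q [gKi, gh, gg, gg]) (U_mon q [gF]) \<oplus>\<^bsub>UU q\<^esub> UU_pure q (U_mon q [gF]) (U_mon q [ghi])"
| "coproduct_gen q gK = UU_pure q (U_mon q [gK]) (U_mon q [gK])"
| "coproduct_gen q gKi = UU_pure q (U_mon q [gKi]) (U_mon q [gKi])"
| "coproduct_gen q gg = UU_pure q (U_mon q [gg]) (U_mon q [gg])"
| "coproduct_gen q ggi = UU_pure q (U_mon q [ggi]) (U_mon q [ggi])"
| "coproduct_gen q gh = UU_pure q (U_mon q [gh]) (U_mon q [gh])"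
| "coproduct_gen q ghi = UU_pure q (U_mon q [ghi]) (U_mon q [ghi])"

text \<open>The algebra homomorphism \<open>U \<rightarrow> U \<otimes> U\<close> extending \<^const>\<open>coproduct_gen\<close>: the value on a word is the
  product of the values on its letters, i.e. the result of multiplying \<open>1 \<otimes> 1\<close> from the left by them.\<close>

definition coproduct ::
    "'k::field \<Rightarrow> 'k free_alg set \<Rightarrow> ('k free_alg set \<times> 'k free_alg set \<Rightarrow>\<^sub>0 'k) set"
  where "coproduct q u =
    U_act (UU q) (\<lambda>x. UU_mult q (coproduct_gen q x)) u (UU_pure q \<one>\<^bsub>U q\<^esub> \<one>\<^bsub>U q\<^esub>)"

definition tensor_module ::
    "'k::field \<Rightarrow> ('k, 'a) U_module \<Rightarrow> ('k, 'b) U_module \<Rightarrow> ('k, ('a \<times> 'b \<Rightarrow>\<^sub>0 'k) set) U_module"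
  where "tensor_module q M N =
    module_of_space (tensor_space (space_of_module q M) (space_of_module q N))
      (\<lambda>u. tensor_act q M N (coproduct q u))"


section \<open>The simple modules\<close>

definition qint :: "'k::field \<Rightarrow> nat \<Rightarrow> 'k"
  where "qint q m = (q ^ m - inverse q ^ m) / (q - inverse q)"

text \<open>The image of the basis vector \<open>v\<^sub>p\<close> under a generator.\<close>

primrec V_gen ::
    "'k::field \<Rightarrow> 'k \<Rightarrow> nat \<Rightarrow> 'k \<Rightarrow> 'k \<Rightarrow> gen \<Rightarrow> nat \<Rightarrow> (nat \<Rightarrow>\<^sub>0 'k)"
where
  "V_gen q \<epsilon> n \<alpha> \<beta> gE p = (if p = 0 then 0 else Poly_Mapping.single (p - 1) (\<epsilon> * \<alpha> * qint q (n - p + 1)))"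
| "V_gen q \<epsilon> n \<alpha> \<beta> gF p = (if p < n then Poly_Mapping.single (p + 1) (qint q (p + 1)) else 0)"
| "V_gen q \<epsilon> n \<alpha> \<beta> gK p = Poly_Mapping.single p (\<epsilon> * \<alpha> * q powi (int n - 2 * int p))"
| "V_gen q \<epsilon> n \<alpha> \<beta> gKi p = Poly_Mapping.single p (inverse (\<epsilon> * \<alpha> * q powi (int n - 2 * int p)))"
| "V_gen q \<epsilon> n \<alpha> \<beta> gg p = Poly_Mapping.single p \<alpha>"
| "V_gen q \<epsilon> n \<alpha> \<beta> ggi p = Poly_Mapping.single p (inverse \<alpha>)"
| "V_gen q \<epsilon> n \<alpha> \<beta> gh p = Poly_Mapping.single p \<beta>"
| "V_gen q \<epsilon> n \<alpha> \<beta> ghi p = Poly_Mapping.single p (inverse \<beta>)"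

definition V_op ::
    "'k::field \<Rightarrow> 'k \<Rightarrow> nat \<Rightarrow> 'k \<Rightarrow> 'k \<Rightarrow> gen \<Rightarrow> (nat \<Rightarrow>\<^sub>0 'k) \<Rightarrow> (nat \<Rightarrow>\<^sub>0 'k)"
  where "V_op q \<epsilon> n \<alpha> \<beta> x f =
    (\<Sum>p\<in>Poly_Mapping.keys f. Poly_Mapping.map ((*) (Poly_Mapping.lookup f p)) (V_gen q \<epsilon> n \<alpha> \<beta> x p))"

definition V :: "'k::field \<Rightarrow> 'k \<Rightarrow> nat \<Rightarrow> 'k \<Rightarrow> 'k \<Rightarrow> ('k, nat \<Rightarrow>\<^sub>0 'k) U_module"
  where "V q \<epsilon> n \<alpha> \<beta> =
    module_of_space (free_space {..n}) (U_act (free_space {..n}) (V_op q \<epsilon> n \<alpha> \<beta>))"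

end

theory Submission
  imports Defs
begin

text \<open>
The decomposition is the Clebsch-Gordan rule, proved by exhibiting the highest weight vectors.

Write \<open>T\<close> for the tensor product and \<open>v\<^sub>i \<otimes> v\<^sub>l\<close> (\<open>i \<le> n\<close>, \<open>l \<le> m\<close>) for its obvious
spanning vectors. The operator \<open>E\<close> lowers \<open>i + l\<close> by one and \<open>F\<close> raises it by one. For each
\<open>j \<le> m\<close> there is a vector \<open>w\<^sub>j = \<Sum>\<^sub>k c\<^sub>k (v\<^sub>k \<otimes> v\<^sub>j\<^sub>-\<^sub>k)\<close> with \<open>c\<^sub>0 = 1\<close> that \<open>E\<close> kills: the
equation \<open>E w\<^sub>j = 0\<close> is a two-term recursion for the coefficients, and it can be solved because
\<open>j \<le> m \<le> n\<close> and the quantum integers do not vanish (\<open>E_hwv_upto\<close>). The vector \<open>w\<^sub>j\<close> has the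
weight of the generator of the summand with highest weight \<open>N = n + m - 2j\<close>, so sending the
basis vector \<open>v\<^sub>p\<close> of that summand to the divided power \<open>F\<^sup>p w\<^sub>j / [p]!\<close> respects all generators
as soon as \<open>F\<^sup>N\<^sup>+\<^sup>1 w\<^sub>j = 0\<close>. Now \<open>E\<close> kills \<open>F\<^sup>N\<^sup>+\<^sup>1 w\<^sub>j\<close> as well, and the weight of this vector
is such that \<open>E F\<^sup>p\<^sup>+\<^sup>1\<close> maps it to a nonzero multiple of its image under \<open>F\<^sup>p\<close>, for every \<open>p\<close>;
as \<open>F\<close> is nilpotent on \<open>T\<close>, the vector vanishes (\<open>w_eq_zero\<close>, \<open>Fpow_Suc_n\<close>).

Together these maps form a homomorphism from the direct sum to \<open>T\<close>. It is injective: its kernel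
is stable under \<open>E\<close>, which acts nilpotently, so a nonzero kernel would contain a nonzero vector
killed by \<open>E\<close>, that is, a linear relation between the \<open>w\<^sub>j\<close>; but \<open>w\<^sub>j\<close> is the only one in which
\<open>v\<^sub>0 \<otimes> v\<^sub>j\<close> occurs (\<open>\<phi>_kernel\<close>). It is surjective because the direct sum has dimension
\<open>(n + 1)(m + 1)\<close> and \<open>T\<close> is spanned by that many vectors (\<open>\<phi>_surj\<close>).

The rest concerns the algebra \<open>U\<close>, which is given by generators and relations. A left
\<open>U\<close>-module is the same thing as a vector space with eight operators that satisfy the defining
relations (\<open>module_of_space_left_module\<close>, \<open>U_rep_gen_act\<close>), and linear maps that commute with
the operators are homomorphisms (\<open>U_act_intertwines\<close>). The one substantial verification is that
the formulas for the coproduct define operators on a tensor product of modules that satisfy the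
relations again (\<open>U_rep_tensor\<close>). Applied to the regular module twice it shows that the
coproduct is well defined; applied to two arbitrary modules it yields a second action on their
tensor product, and the two agree because acting on a fixed tensor intertwines them
(\<open>tact_coproduct\<close>).
\<close>

section \<open>Linear algebra on finitely supported functions\<close>

abbreviation scl :: "'k::field \<Rightarrow> ('a \<Rightarrow>\<^sub>0 'k) \<Rightarrow> 'a \<Rightarrow>\<^sub>0 'k"
  where "scl c \<equiv> Poly_Mapping.map ((*) c)"

lemma lookup_scl [simp]: "Poly_Mapping.lookup (scl c p) x = c * Poly_Mapping.lookup p x"
  by (simp add: Poly_Mapping.map.rep_eq when_def)

lemma scl_simps [simp]:
  "scl c 0 = 0" "scl 0 p = 0" "scl 1 p = p" "scl c (scl d p) = scl (c * d) p"
  "scl c (- p) = - scl c p" "scl (- c) p = - scl c p"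
  by (auto intro!: poly_mapping_eqI simp: algebra_simps)

lemma scl_add_right: "scl c (p + p') = scl c p + scl c p'"
  and scl_diff_right: "scl c (p - p') = scl c p - scl c p'"
  and scl_add_left: "scl (c + d) p = scl c p + scl d p"
  by (auto intro!: poly_mapping_eqI simp: algebra_simps lookup_add lookup_minus)

lemma scl_sum_right: "scl c (sum f A) = (\<Sum>a\<in>A. scl c (f a))"
  by (induction A rule: infinite_finite_induct) (auto simp: scl_add_right)

lemma scl_single [simp]: "scl c (Poly_Mapping.single a d) = Poly_Mapping.single a (c * d)"
  by (intro poly_mapping_eqI) (auto simp: lookup_single when_def)

lemma keys_scl: "Poly_Mapping.keys (scl c p) \<subseteq> Poly_Mapping.keys p"
  by (auto simp: in_keys_iff)

interpretation pm: vector_space "scl :: 'k::field \<Rightarrow> ('a \<Rightarrow>\<^sub>0 'k) \<Rightarrow> _"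
  by unfold_locales (auto simp: scl_add_right scl_add_left)

lemma poly_mapping_expand:
  fixes p :: "'a \<Rightarrow>\<^sub>0 'k::field"
  assumes "finite A" "Poly_Mapping.keys p \<subseteq> A"
  shows "p = (\<Sum>a\<in>A. Poly_Mapping.single a (Poly_Mapping.lookup p a))"
proof (rule poly_mapping_eqI)
  fix x
  show "Poly_Mapping.lookup p x =
      Poly_Mapping.lookup (\<Sum>a\<in>A. Poly_Mapping.single a (Poly_Mapping.lookup p a)) x"
    using assms by (auto simp: lookup_sum lookup_single when_def in_keys_iff)
qed

text \<open>Linear identities between finitely supported functions are checked on multiples of basis vectors.\<close>

lemma poly_mapping_lin_induct [consumes 1, case_names zero add single]:
  fixes p :: "'a \<Rightarrow>\<^sub>0 'k::field"
  assumes "Poly_Mapping.keys p \<subseteq> S"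
    and "P 0"
    and "\<And>p p'. Poly_Mapping.keys p \<subseteq> S \<Longrightarrow> Poly_Mapping.keys p' \<subseteq> S \<Longrightarrow> P p \<Longrightarrow> P p' \<Longrightarrow> P (p + p')"
    and "\<And>a c. a \<in> S \<Longrightarrow> P (Poly_Mapping.single a c)"
  shows "P p"
proof -
  have "Poly_Mapping.keys (\<Sum>a\<in>A. Poly_Mapping.single a (Poly_Mapping.lookup p a)) \<subseteq> S \<and>
      P (\<Sum>a\<in>A. Poly_Mapping.single a (Poly_Mapping.lookup p a))"
    if "finite A" "A \<subseteq> S" for A
    using that
  proof (induction A rule: finite_induct)
    case (insert x A)
    then have "P (Poly_Mapping.single x (Poly_Mapping.lookup p x) +
        (\<Sum>a\<in>A. Poly_Mapping.single a (Poly_Mapping.lookup p a)))"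
      by (intro assms(3,4)) (auto split: if_splits)
    with insert show ?case
      using keys_add[of "Poly_Mapping.single x (Poly_Mapping.lookup p x)"
          "\<Sum>a\<in>A. Poly_Mapping.single a (Poly_Mapping.lookup p a)"]
      by (auto split: if_splits)
  qed (use assms(2) in auto)
  from this[of "Poly_Mapping.keys p"] show ?thesis
    using assms(1) poly_mapping_expand[of "Poly_Mapping.keys p" p] by simp
qed

text \<open>The linear extension of \<open>f\<close>. The operators \<^const>\<open>V_op\<close> and the action of tensors on tensors have this
form.\<close>

definition lext :: "('a \<Rightarrow> 'b \<Rightarrow>\<^sub>0 'k::field) \<Rightarrow> ('a \<Rightarrow>\<^sub>0 'k) \<Rightarrow> 'b \<Rightarrow>\<^sub>0 'k"
  where "lext f p = (\<Sum>a\<in>Poly_Mapping.keys p. scl (Poly_Mapping.lookup p a) (f a))"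

lemma lext_superset:
  assumes "finite A" "Poly_Mapping.keys p \<subseteq> A"
  shows "lext f p = (\<Sum>a\<in>A. scl (Poly_Mapping.lookup p a) (f a))"
  unfolding lext_def using assms
  by (intro sum.mono_neutral_left) (auto simp: in_keys_iff)

lemma lext_zero [simp]: "lext f 0 = 0"
  by (simp add: lext_def)

lemma lext_single [simp]: "lext f (Poly_Mapping.single a c) = scl c (f a)"
  by (simp add: lext_def)

lemma lext_add: "lext f (p + p') = lext f p + lext f p'"
proof -
  let ?A = "Poly_Mapping.keys p \<union> Poly_Mapping.keys p'"
  show ?thesis
    using keys_add[of p p']
    by (simp add: lext_superset[of ?A] lookup_add scl_add_left sum.distrib)
qed

lemma lext_scl: "lext f (scl c p) = scl c (lext f p)"
  using lext_superset[of "Poly_Mapping.keys p" "scl c p" f] keys_scl[of c p]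
  by (simp add: lext_def scl_sum_right)

lemma lext_uminus: "lext f (- p) = - lext f p"
  using lext_scl[of f "-1" p] by simp

lemma lext_diff: "lext f (p - p') = lext f p - lext f p'"
  using lext_add[of f p "- p'"] by (simp add: lext_uminus)

lemma lext_cong: "(\<And>a. a \<in> Poly_Mapping.keys p \<Longrightarrow> f a = g a) \<Longrightarrow> lext f p = lext g p"
  by (simp add: lext_def)

lemma keys_sum_subset:
  assumes "\<And>a. a \<in> A \<Longrightarrow> Poly_Mapping.keys (f a) \<subseteq> S"
  shows "Poly_Mapping.keys (sum f A) \<subseteq> S"
  using assms Poly_Mapping.keys_sum[of f A] by fast

lemma keys_lext:
  assumes "\<And>a. a \<in> Poly_Mapping.keys p \<Longrightarrow> Poly_Mapping.keys (f a) \<subseteq> S"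
  shows "Poly_Mapping.keys (lext f p) \<subseteq> S"
  unfolding lext_def using assms keys_scl by (intro keys_sum_subset) fast

lemma keys_add_subset: "Poly_Mapping.keys p \<subseteq> S \<Longrightarrow> Poly_Mapping.keys p' \<subseteq> S \<Longrightarrow> Poly_Mapping.keys (p + p') \<subseteq> S"
  and keys_diff_subset: "Poly_Mapping.keys r \<subseteq> S \<Longrightarrow> Poly_Mapping.keys r' \<subseteq> S \<Longrightarrow> Poly_Mapping.keys (r - r') \<subseteq> S"
  and keys_single_subset: "a \<in> S \<Longrightarrow> Poly_Mapping.keys (Poly_Mapping.single a c) \<subseteq> S"
  and keys_scl_subset: "Poly_Mapping.keys s \<subseteq> S \<Longrightarrow> Poly_Mapping.keys (scl d s) \<subseteq> S"
  using keys_add[of p p'] keys_diff[of r r'] keys_scl[of d s] by auto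

text \<open>Subspaces of the space with basis \<open>S\<close>, phrased on the type of all finitely supported functions,
where addition and scaling are total.\<close>

definition subspace_on :: "'a set \<Rightarrow> ('a \<Rightarrow>\<^sub>0 'k::field) set \<Rightarrow> bool"
  where "subspace_on S N \<longleftrightarrow> (\<forall>p\<in>N. Poly_Mapping.keys p \<subseteq> S) \<and> 0 \<in> N \<and>
    (\<forall>p\<in>N. \<forall>p'\<in>N. p + p' \<in> N) \<and> (\<forall>c. \<forall>p\<in>N. scl c p \<in> N)"

lemma lext_fun_diff: "lext (\<lambda>x. f x - g x) p = lext f p - lext g p"
  by (simp add: lext_def scl_diff_right sum_subtractf)

lemma lext_fun_scl: "lext (\<lambda>x. scl c (f x)) p = scl c (lext f p)"
  by (simp add: lext_def scl_sum_right mult.commute)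

lemma lext_in_subspace:
  assumes N: "subspace_on S N" and f: "\<And>a. a \<in> Poly_Mapping.keys p \<Longrightarrow> f a \<in> N"
  shows "lext f p \<in> N"
proof -
  have "(\<Sum>a\<in>A. scl (Poly_Mapping.lookup p a) (f a)) \<in> N"
    if "finite A" "A \<subseteq> Poly_Mapping.keys p" for A
    using that N f by (induction A rule: finite_induct) (auto simp: subspace_on_def)
  from this[of "Poly_Mapping.keys p"] show ?thesis by (simp add: lext_def)
qed

text \<open>A dimension count in the form in which it yields surjectivity: a linearly independent family
with as many members as the ambient basis cannot be enlarged, so it spans.\<close>

lemma independent_family_spans:
  fixes b :: "'a \<Rightarrow> 'b \<Rightarrow>\<^sub>0 'k::field"
  assumes "finite A" "finite B" "card A = card B"
    and b: "\<And>a. a \<in> A \<Longrightarrow> Poly_Mapping.keys (b a) \<subseteq> B"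
    and indep: "\<And>c. (\<Sum>a\<in>A. scl (c a) (b a)) = 0 \<Longrightarrow> \<forall>a\<in>A. c a = 0"
    and y: "Poly_Mapping.keys y \<subseteq> B"
  shows "\<exists>c. y = (\<Sum>a\<in>A. scl (c a) (b a))"
proof -
  let ?e = "\<lambda>x::'b. Poly_Mapping.single x (1::'k)"
  have inj: "inj_on b A"
  proof (rule inj_onI, rule ccontr)
    fix x y assume xy: "x \<in> A" "y \<in> A" "b x = b y" "x \<noteq> y"
    \<comment> \<open>Two equal members of the family would give a nontrivial relation.\<close>
    let ?c = "\<lambda>a. if a = x then 1 else if a = y then -1 else (0::'k)"
    have "(\<Sum>a\<in>A. scl (?c a) (b a)) = (\<Sum>a\<in>{x, y}. scl (?c a) (b a))"
      using xy \<open>finite A\<close> by (intro sum.mono_neutral_right) auto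
    also have "\<dots> = 0" using xy by simp
    finally show False using indep[of ?c] xy by auto
  qed
  have "pm.independent (b ` A)"
  proof (subst pm.independent_explicit_module, intro allI impI)
    fix t u v assume t: "finite t" "t \<subseteq> b ` A" "(\<Sum>v\<in>t. scl (u v) v) = 0" "v \<in> t"
    let ?c = "\<lambda>a. if b a \<in> t then u (b a) else 0"
    have "(\<Sum>a\<in>A. scl (?c a) (b a)) = (\<Sum>v\<in>b ` A. scl (if v \<in> t then u v else 0) v)"
      using inj by (simp add: sum.reindex)
    also have "\<dots> = (\<Sum>v\<in>t. scl (u v) v)"
      using t \<open>finite A\<close> by (intro sum.mono_neutral_cong_right) auto
    finally have "\<forall>a\<in>A. ?c a = 0" using t(3) indep[of ?c] by simp
    then show "u v = 0" using t(2,4) by force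
  qed
  have span_B: "p \<in> pm.span (?e ` B)" if "Poly_Mapping.keys p \<subseteq> B" for p :: "'b \<Rightarrow>\<^sub>0 'k"
    using that
  proof (induction rule: poly_mapping_lin_induct)
    case (single a c)
    then show ?case using pm.span_scale[OF pm.span_base[of "?e a" "?e ` B"], of c] by simp
  qed (auto intro: pm.span_zero pm.span_add)
  have card_e: "card (?e ` B) = card B"
    by (intro card_image inj_onI) (metis keys_single singleton_inject zero_neq_one)
  have "y \<in> pm.span (b ` A)"
  proof (rule ccontr)
    assume "y \<notin> pm.span (b ` A)"
    then have "pm.independent (insert y (b ` A))" "y \<notin> b ` A"
      using pm.independent_insertI[OF _ \<open>pm.independent (b ` A)\<close>] pm.span_base[of y "b ` A"] by blast+
    moreover have "insert y (b ` A) \<subseteq> pm.span (?e ` B)"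
      using b y span_B by blast
    ultimately have "card (insert y (b ` A)) \<le> card B"
      using pm.independent_span_bound[of "?e ` B" "insert y (b ` A)"] \<open>finite B\<close> card_e by auto
    with \<open>y \<notin> b ` A\<close> show False
      using assms(1,3) inj by (simp add: card_image)
  qed
  then obtain u where "y = (\<Sum>v\<in>b ` A. scl (u v) v)"
    using pm.span_finite[of "b ` A"] \<open>finite A\<close> by auto
  then have "y = (\<Sum>a\<in>A. scl (u (b a)) (b a))"
    using inj by (simp add: sum.reindex)
  then show ?thesis by (rule exI[of _ "\<lambda>a. u (b a)"])
qed

section \<open>Vector spaces as modules over the scalars\<close>

lemma ring_of_type_algebra_simps [simp]:
  "carrier ring_of_type_algebra = UNIV"
  "monoid.mult ring_of_type_algebra = (*)"
  "one ring_of_type_algebra = 1"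
  "ring.zero ring_of_type_algebra = 0"
  "add ring_of_type_algebra = (+)"
  by (auto simp: ring_of_type_algebra_def)

lemma ring_of_type_algebra_ring: "ring (ring_of_type_algebra :: 'a::ring_1 ring)"
proof (rule ringI)
  show "abelian_group (ring_of_type_algebra :: 'a ring)"
    by (rule abelian_groupI) (auto simp: algebra_simps intro: exI[of _ "- x" for x :: 'a])
  show "Group.monoid (ring_of_type_algebra :: 'a ring)"
    by (rule Group.monoidI) (auto simp: mult.assoc)
qed (auto simp: algebra_simps)

lemma left_module_cong:
  assumes "left_module R M"
    and "carrier M' = carrier M" "ring.zero M' = ring.zero M" "add M' = add M"
    and "\<And>a x. a \<in> carrier R \<Longrightarrow> x \<in> carrier M \<Longrightarrow> a \<odot>\<^bsub>M'\<^esub> x = a \<odot>\<^bsub>M\<^esub> x"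
  shows "left_module R M'"
proof -
  interpret left_module R M by fact
  have "abelian_group M'"
    by (rule abelian_groupI) (auto simp: assms M.a_ac dest: M.add.l_inv_ex)
  then show ?thesis
    unfolding left_module_def left_module_axioms_def
    using R.ring_axioms smult_closed smult_l_distr smult_r_distr smult_assoc1 smult_one by (simp add: assms)
qed

locale kspace = left_module "ring_of_type_algebra :: 'k::field ring" B
  for B :: "('k::field, 'b) module" (structure)
begin

lemma sm_closed [simp]: "x \<in> carrier B \<Longrightarrow> c \<odot> x \<in> carrier B"
  and sm_add_left: "x \<in> carrier B \<Longrightarrow> (c + d) \<odot> x = c \<odot> x \<oplus> d \<odot> x"
  and sm_add_right: "x \<in> carrier B \<Longrightarrow> y \<in> carrier B \<Longrightarrow> c \<odot> (x \<oplus> y) = c \<odot> x \<oplus> c \<odot> y"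
  and sm_sm [simp]: "x \<in> carrier B \<Longrightarrow> c \<odot> (d \<odot> x) = (c * d) \<odot> x"
  and sm_one [simp]: "x \<in> carrier B \<Longrightarrow> 1 \<odot> x = x"
  using smult_closed[of c x] smult_l_distr[of c d x] smult_r_distr[of c x y] smult_assoc1[of c d x]
    smult_one[of x] by auto

lemma add_closed [simp]: "x \<in> carrier B \<Longrightarrow> y \<in> carrier B \<Longrightarrow> x \<oplus> y \<in> carrier B"
  and add_zero_left [simp]: "x \<in> carrier B \<Longrightarrow> \<zero> \<oplus> x = x"
  and add_zero_right [simp]: "x \<in> carrier B \<Longrightarrow> x \<oplus> \<zero> = x"
  and zero_in [simp]: "\<zero> \<in> carrier B"
  by auto

lemma sm_zero_left [simp]: assumes "x \<in> carrier B" shows "0 \<odot> x = \<zero>"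
proof -
  have "0 \<odot> x \<oplus> 0 \<odot> x = 0 \<odot> x \<oplus> \<zero>"
    using sm_add_left[OF assms, of 0 0] assms by simp
  then show ?thesis using assms by (metis M.add.l_cancel sm_closed zero_in)
qed

lemma sm_zero_right [simp]: "c \<odot> \<zero> = \<zero>"
  using sm_sm[of \<zero> c 0] sm_zero_left[OF zero_in] by simp

text \<open>Subtraction is written as adding \<open>(- 1) \<odot> y\<close>, so that linear maps need to preserve only addition
and scaling.\<close>

lemma add_sm_neg:
  assumes "x \<in> carrier B" "y \<in> carrier B"
  shows "x \<oplus> (- 1) \<odot> y = \<zero> \<longleftrightarrow> x = y"
proof -
  have *: "z \<oplus> (- 1) \<odot> z = \<zero>" if "z \<in> carrier B" for z
    using sm_add_left[OF that, of 1 "-1"] that by simp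
  show ?thesis using *[OF assms(2)] * assms
    by (metis M.add.right_cancel sm_closed)
qed

end

lemma kspaceI:
  fixes B :: "('k::field, 'b) module" (structure)
  assumes "\<And>x y. x \<in> carrier B \<Longrightarrow> y \<in> carrier B \<Longrightarrow> x \<oplus> y \<in> carrier B"
    and "\<zero> \<in> carrier B"
    and "\<And>x y z. x \<in> carrier B \<Longrightarrow> y \<in> carrier B \<Longrightarrow> z \<in> carrier B \<Longrightarrow> (x \<oplus> y) \<oplus> z = x \<oplus> (y \<oplus> z)"
    and "\<And>x y. x \<in> carrier B \<Longrightarrow> y \<in> carrier B \<Longrightarrow> x \<oplus> y = y \<oplus> x"
    and "\<And>x. x \<in> carrier B \<Longrightarrow> \<zero> \<oplus> x = x"
    and "\<And>x. x \<in> carrier B \<Longrightarrow> \<exists>y\<in>carrier B. y \<oplus> x = \<zero>"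
    and "\<And>c x. x \<in> carrier B \<Longrightarrow> c \<odot> x \<in> carrier B"
    and "\<And>c d x. x \<in> carrier B \<Longrightarrow> (c + d) \<odot> x = c \<odot> x \<oplus> d \<odot> x"
    and "\<And>c x y. x \<in> carrier B \<Longrightarrow> y \<in> carrier B \<Longrightarrow> c \<odot> (x \<oplus> y) = c \<odot> x \<oplus> c \<odot> y"
    and "\<And>c d x. x \<in> carrier B \<Longrightarrow> (c * d) \<odot> x = c \<odot> (d \<odot> x)"
    and "\<And>x. x \<in> carrier B \<Longrightarrow> 1 \<odot> x = x"
  shows "kspace B"
proof -
  interpret abelian_group B using assms by (intro abelian_groupI) auto
  interpret S: ring "ring_of_type_algebra :: 'k ring" by (rule ring_of_type_algebra_ring)
  show ?thesis
    by unfold_locales (use assms in auto)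
qed

definition kmap :: "('k::field, 'a) module \<Rightarrow> ('k, 'b) module \<Rightarrow> ('a \<Rightarrow> 'b) \<Rightarrow> bool"
  where "kmap B C f \<longleftrightarrow>
    (\<forall>x\<in>carrier B. f x \<in> carrier C) \<and>
    (\<forall>x\<in>carrier B. \<forall>y\<in>carrier B. f (x \<oplus>\<^bsub>B\<^esub> y) = f x \<oplus>\<^bsub>C\<^esub> f y) \<and>
    (\<forall>c. \<forall>x\<in>carrier B. f (c \<odot>\<^bsub>B\<^esub> x) = c \<odot>\<^bsub>C\<^esub> f x)"

lemma kmapD:
  assumes "kmap B C f"
  shows "x \<in> carrier B \<Longrightarrow> f x \<in> carrier C"
    and "x \<in> carrier B \<Longrightarrow> y \<in> carrier B \<Longrightarrow> f (x \<oplus>\<^bsub>B\<^esub> y) = f x \<oplus>\<^bsub>C\<^esub> f y"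
    and "x \<in> carrier B \<Longrightarrow> f (c \<odot>\<^bsub>B\<^esub> x) = c \<odot>\<^bsub>C\<^esub> f x"
  using assms by (auto simp: kmap_def)

lemma kmap_zero:
  assumes "kspace B" "kspace C" "kmap B C f"
  shows "f \<zero>\<^bsub>B\<^esub> = \<zero>\<^bsub>C\<^esub>"
proof -
  interpret B: kspace B by fact
  interpret C: kspace C by fact
  have "f (0 \<odot>\<^bsub>B\<^esub> \<zero>\<^bsub>B\<^esub>) = 0 \<odot>\<^bsub>C\<^esub> f \<zero>\<^bsub>B\<^esub>"
    using kmapD(3)[OF assms(3)] B.zero_in by blast
  then show ?thesis using kmapD(1)[OF assms(3)] B.zero_in by simp
qed

definition lincomb :: "('k::field, 'b) module \<Rightarrow> ('a \<Rightarrow> 'b) \<Rightarrow> ('a \<Rightarrow>\<^sub>0 'k) \<Rightarrow> 'b"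
  where "lincomb B g p = (\<Oplus>\<^bsub>B\<^esub>a\<in>Poly_Mapping.keys p. Poly_Mapping.lookup p a \<odot>\<^bsub>B\<^esub> g a)"

context kspace
begin

lemma lincomb_superset:
  assumes "finite A" "Poly_Mapping.keys p \<subseteq> A" "\<And>a. a \<in> A \<Longrightarrow> g a \<in> carrier B"
  shows "lincomb B g p = (\<Oplus>a\<in>A. Poly_Mapping.lookup p a \<odot> g a)"
  unfolding lincomb_def using assms
  by (intro M.add.finprod_mono_neutral_cong_left) (auto simp: in_keys_iff Pi_def)

lemma lincomb_closed [simp]:
  assumes "\<And>a. a \<in> Poly_Mapping.keys p \<Longrightarrow> g a \<in> carrier B"
  shows "lincomb B g p \<in> carrier B"
  unfolding lincomb_def using assms by (intro M.finsum_closed) auto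

lemma lincomb_zero [simp]: "lincomb B g 0 = \<zero>"
  by (simp add: lincomb_def)

lemma lincomb_single [simp]:
  assumes "g a \<in> carrier B"
  shows "lincomb B g (Poly_Mapping.single a c) = c \<odot> g a"
  using assms lincomb_superset[of "{a}" "Poly_Mapping.single a c" g] by simp

lemma lincomb_add:
  assumes "\<And>a. a \<in> Poly_Mapping.keys p \<union> Poly_Mapping.keys p' \<Longrightarrow> g a \<in> carrier B"
  shows "lincomb B g (p + p') = lincomb B g p \<oplus> lincomb B g p'"
proof -
  let ?A = "Poly_Mapping.keys p \<union> Poly_Mapping.keys p'"
  have "lincomb B g (p + p') = (\<Oplus>a\<in>?A. Poly_Mapping.lookup (p + p') a \<odot> g a)"
    using assms keys_add[of p p'] by (intro lincomb_superset) auto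
  also have "\<dots> = (\<Oplus>a\<in>?A. Poly_Mapping.lookup p a \<odot> g a \<oplus> Poly_Mapping.lookup p' a \<odot> g a)"
    using assms by (intro M.finsum_cong') (auto simp: lookup_add sm_add_left)
  also have "\<dots> = lincomb B g p \<oplus> lincomb B g p'"
    using assms lincomb_superset[of ?A p g] lincomb_superset[of ?A p' g]
    by (subst M.finsum_addf) auto
  finally show ?thesis .
qed

lemma sm_finsum:
  assumes "finite A" "f \<in> A \<rightarrow> carrier B"
  shows "c \<odot> (\<Oplus>a\<in>A. f a) = (\<Oplus>a\<in>A. c \<odot> f a)"
  using assms by (induction A rule: finite_induct) (auto simp: sm_add_right Pi_def)

lemma lincomb_scl:
  assumes "\<And>a. a \<in> Poly_Mapping.keys p \<Longrightarrow> g a \<in> carrier B"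
  shows "lincomb B g (scl c p) = c \<odot> lincomb B g p"
  using assms lincomb_superset[of "Poly_Mapping.keys p" "scl c p" g] keys_scl[of c p]
  by (auto simp: lincomb_def sm_finsum Pi_def intro!: M.finsum_cong')

end

text \<open>Both sides are linear in \<open>p\<close>.\<close>

lemma kmap_lincomb:
  assumes "kspace B" "kspace C" "kmap B C f"
    and "\<And>a. a \<in> Poly_Mapping.keys p \<Longrightarrow> g a \<in> carrier B"
  shows "f (lincomb B g p) = lincomb C (\<lambda>a. f (g a)) p"
proof -
  interpret B: kspace B by fact
  interpret C: kspace C by fact
  note f = kmapD[OF assms(3)]
  let ?S = "{a. g a \<in> carrier B}"
  have "Poly_Mapping.keys p \<subseteq> ?S" using assms(4) by auto
  then show ?thesis
  proof (induction rule: poly_mapping_lin_induct)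
    case zero
    then show ?case using kmap_zero[OF assms(1-3)] by simp
  next
    case (add p p')
    have "f (lincomb B g (p + p')) = f (lincomb B g p \<oplus>\<^bsub>B\<^esub> lincomb B g p')"
      using add.hyps by (subst B.lincomb_add) auto
    also have "\<dots> = f (lincomb B g p) \<oplus>\<^bsub>C\<^esub> f (lincomb B g p')"
      using add.hyps by (intro f B.lincomb_closed) auto
    also have "\<dots> = lincomb C (\<lambda>a. f (g a)) (p + p')"
      unfolding add.IH using add.hyps f(1) by (subst C.lincomb_add) auto
    finally show ?case .
  next
    case (single a c)
    then show ?case by (simp add: f)
  qed
qed

lemma kmap_finsum:
  assumes "kspace B" "kspace C" "kmap B C f" "finite J" "\<And>j. j \<in> J \<Longrightarrow> x j \<in> carrier B"
  shows "f (finsum B x J) = finsum C (\<lambda>j. f (x j)) J"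
proof -
  interpret B: kspace B by fact
  interpret C: kspace C by fact
  show ?thesis
    using assms(4,5)
  proof (induction J rule: finite_induct)
    case empty
    show ?case using kmap_zero[OF assms(1-3)] by simp
  next
    case (insert j J)
    have "f (finsum B x (insert j J)) = f (x j \<oplus>\<^bsub>B\<^esub> finsum B x J)"
      using insert by (subst B.M.finsum_insert) auto
    also have "\<dots> = f (x j) \<oplus>\<^bsub>C\<^esub> f (finsum B x J)"
      using insert.prems by (intro kmapD(2)[OF assms(3)] B.M.finsum_closed) auto
    also have "\<dots> = finsum C (\<lambda>j. f (x j)) (insert j J)"
      using insert kmapD(1)[OF assms(3)] by (subst C.M.finsum_insert) auto
    finally show ?case .
  qed
qed

lemma free_space_simps [simp]:
  "carrier (free_space S) = {p. Poly_Mapping.keys p \<subseteq> S}"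
  "ring.zero (free_space S) = 0"
  "add (free_space S) = (+)"
  "module.smult (free_space S) = scl"
  by (simp_all add: free_space_def)

lemma kspace_free_space: "kspace (free_space S :: ('k::field, 'a \<Rightarrow>\<^sub>0 'k) module)"
proof (rule kspaceI)
  fix x :: "'a \<Rightarrow>\<^sub>0 'k"
  assume "x \<in> carrier (free_space S)"
  then show "\<exists>y\<in>carrier (free_space S). y \<oplus>\<^bsub>free_space S\<^esub> x = \<zero>\<^bsub>free_space S\<^esub>"
    by (intro bexI[of _ "- x"]) auto
qed (auto simp: add_ac scl_add_left scl_add_right keys_add_subset keys_scl_subset)

lemma finsum_free_space:
  assumes "finite J" "\<And>j. j \<in> J \<Longrightarrow> Poly_Mapping.keys (x j :: 'a \<Rightarrow>\<^sub>0 'k::field) \<subseteq> S"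
  shows "finsum (free_space S) x J = sum x J"
proof -
  interpret kspace "free_space S :: ('k, 'a \<Rightarrow>\<^sub>0 'k) module" by (rule kspace_free_space)
  show ?thesis
    using assms
  proof (induction J rule: finite_induct)
    case (insert j J)
    then show ?case by (subst M.finsum_insert) auto
  qed simp
qed

section \<open>Representations of the algebra\<close>

lemma const_mult: "const c * p = scl c p"
  by (simp add: const_def mult_map_scale_conv_mult zero_word_def)

lemma const_simps [simp]: "const 0 = 0" "const 1 = 1"
  by (simp_all add: const_def)

text \<open>Scalars are central in the free algebra; this is why every element of the algebra acts linearly.\<close>

lemma const_commute: "p * const c = const c * p"
proof -
  have "Poly_Mapping.keys p \<subseteq> UNIV" by simp
  then show ?thesis
  proof (induction rule: poly_mapping_lin_induct)
    case (single a d)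
    then show ?case by (simp add: const_def mult_single mult.commute)
  qed (auto simp: distrib_left distrib_right)
qed

lemma U_ideal_ideal: "ideal (U_ideal q) (free_alg_ring :: 'k::field free_alg ring)"
  unfolding U_ideal_def
  by (rule ring.genideal_ideal[OF ring_of_type_algebra_ring]) simp

lemma U_ring: "ring (U q)"
  unfolding U_def by (rule ideal.quotient_is_ring[OF U_ideal_ideal])

lemma U_class_conv: "U_class q a = (\<lambda>h. h + a) ` U_ideal q"
  by (auto simp: U_class_def a_r_coset_def r_coset_def)

lemma carrier_U: "carrier (U q) = range (U_class q)"
  by (auto simp: U_def FactRing_def A_RCOSETS_def RCOSETS_def U_class_def a_r_coset_def)

lemma U_carrierE:
  assumes "u \<in> carrier (U q)"
  obtains a where "u = U_class q a"
  using assms by (auto simp: carrier_U)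

lemma U_class_in [simp]: "U_class q a \<in> carrier (U q)"
  by (simp add: carrier_U)

lemma U_add [simp]: "U_class q a \<oplus>\<^bsub>U q\<^esub> U_class q b = U_class q (a + b)"
proof -
  interpret ideal "U_ideal q" free_alg_ring by (rule U_ideal_ideal)
  show ?thesis using a_rcos_sum[of a b] by (simp add: U_def FactRing_def U_class_def)
qed

lemma U_mult [simp]: "U_class q a \<otimes>\<^bsub>U q\<^esub> U_class q b = U_class q (a * b)"
proof -
  interpret ideal "U_ideal q" free_alg_ring by (rule U_ideal_ideal)
  show ?thesis using rcoset_mult_add[of a b] by (simp add: U_def FactRing_def U_class_def)
qed

lemma U_one: "\<one>\<^bsub>U q\<^esub> = U_class q 1"
  by (simp add: U_def FactRing_def U_class_def)

lemma U_class_eqI: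
  assumes "a - b \<in> U_ideal q"
  shows "U_class q a = U_class q b"
proof -
  interpret ideal "U_ideal q" free_alg_ring by (rule U_ideal_ideal)
  have "a \<in> U_ideal q +>\<^bsub>free_alg_ring\<^esub> b"
    using assms by (auto simp: a_r_coset_def r_coset_def intro: bexI[of _ "a - b"])
  then show ?thesis using a_repr_independence'[of a b] by (simp add: U_class_def)
qed

lemma relator_class:
  assumes "a - b \<in> relators q"
  shows "U_class q a = U_class q b"
  using ring.genideal_self[OF ring_of_type_algebra_ring, of "relators q"] assms
  by (intro U_class_eqI) (auto simp: U_ideal_def)

text \<open>Arbitrary linear operators indexed by the generators, that is, a module over the free algebra.\<close>

locale kops = kspace B
  for B :: "('k::field, 'b) module" (structure) +
  fixes op :: "gen \<Rightarrow> 'b \<Rightarrow> 'b"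
  assumes op_kmap: "kmap B B (op x)"
begin

lemma op_closed [simp]: "v \<in> carrier B \<Longrightarrow> op x v \<in> carrier B"
  and op_add: "v \<in> carrier B \<Longrightarrow> w \<in> carrier B \<Longrightarrow> op x (v \<oplus> w) = op x v \<oplus> op x w"
  and op_sm: "v \<in> carrier B \<Longrightarrow> op x (c \<odot> v) = c \<odot> op x v"
  using kmapD[OF op_kmap] by auto

lemma op_zero [simp]: "op x \<zero> = \<zero>"
  using kmap_zero[OF _ _ op_kmap] kspace_axioms by blast

lemma op_funpow_kmap: "kmap B B (op x ^^ r)"
  by (induction r) (auto simp: kmap_def op_add op_sm)

abbreviation act :: "'k free_alg \<Rightarrow> 'b \<Rightarrow> 'b"
  where "act \<equiv> free_alg_act B op"

lemma act_lincomb: "act a v = lincomb B (\<lambda>w. foldr op (letters w) v) a"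
  by (simp add: free_alg_act_def lincomb_def)

lemma word_closed [simp]: "v \<in> carrier B \<Longrightarrow> foldr op xs v \<in> carrier B"
  by (induction xs) auto

lemma word_kmap: "kmap B B (foldr op xs)"
  by (induction xs) (auto simp: kmap_def op_add op_sm)

lemma act_closed [simp]: "v \<in> carrier B \<Longrightarrow> act a v \<in> carrier B"
  by (simp add: act_lincomb)

lemma act_add_left: "v \<in> carrier B \<Longrightarrow> act (a + b) v = act a v \<oplus> act b v"
  by (simp add: act_lincomb lincomb_add)

lemma act_scl: "v \<in> carrier B \<Longrightarrow> act (scl c a) v = c \<odot> act a v"
  by (simp add: act_lincomb lincomb_scl)

lemma act_zero_left [simp]: "act 0 v = \<zero>"
  by (simp add: act_lincomb)

lemma act_single: "v \<in> carrier B \<Longrightarrow> act (Poly_Mapping.single w c) v = c \<odot> foldr op (letters w) v"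
  by (simp add: act_lincomb)

lemma act_mon [simp]: "v \<in> carrier B \<Longrightarrow> act (mon xs) v = foldr op xs v"
  by (simp add: mon_def act_single)

lemma letters_zero [simp]: "letters 0 = []"
  by (simp add: zero_word_def)

lemma act_one [simp]: "v \<in> carrier B \<Longrightarrow> act 1 v = v"
  using act_single[of v 0 1] by simp

lemma act_const: "v \<in> carrier B \<Longrightarrow> act (const c) v = c \<odot> v"
  using act_single[of v 0 c] by (simp add: const_def)

lemma act_diff_eq_zero:
  "v \<in> carrier B \<Longrightarrow> act (a - b) v = \<zero> \<longleftrightarrow> act a v = act b v"
  using act_add_left[of v a "- b"] act_scl[of v "-1" b] add_sm_neg[of "act a v" "act b v"] by simp

lemma act_diff:
  "v \<in> carrier B \<Longrightarrow> act (a - b) v = act a v \<oplus> (- 1) \<odot> act b v"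
  using act_add_left[of v a "- b"] act_scl[of v "-1" b] by simp

lemma act_kmap: "kmap B B (act a)"
proof -
  have "Poly_Mapping.keys a \<subseteq> UNIV" by simp
  then show ?thesis
  proof (induction rule: poly_mapping_lin_induct)
    case zero
    show ?case by (simp add: kmap_def)
  next
    case (add a b)
    show ?case
      unfolding kmap_def
      by (auto simp: act_add_left kmapD[OF add.IH(1)] kmapD[OF add.IH(2)] sm_add_right M.a_ac)
  next
    case (single w c)
    show ?case
      unfolding kmap_def
      by (auto simp: act_single kmapD[OF word_kmap] sm_add_right mult.commute)
  qed
qed

lemma act_zero_right [simp]: "act a \<zero> = \<zero>"
  using kmap_zero[OF _ _ act_kmap] kspace_axioms by blast

lemma act_mult:
  assumes v: "v \<in> carrier B"
  shows "act (a * b) v = act a (act b v)"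
proof -
  have "Poly_Mapping.keys a \<subseteq> UNIV" "Poly_Mapping.keys b \<subseteq> UNIV" by simp_all
  from this(1) show ?thesis
  proof (induction rule: poly_mapping_lin_induct)
    case (single w c)
    from \<open>Poly_Mapping.keys b \<subseteq> UNIV\<close> show ?case
    proof (induction rule: poly_mapping_lin_induct)
      case (add b b')
      then show ?case using v
        by (simp add: distrib_left act_add_left kmapD[OF act_kmap])
    next
      case (single w' d)
      then show ?case using v
        by (simp add: mult_single act_single plus_word_def kmapD[OF word_kmap])
    qed (simp add: v)
  qed (use v in \<open>auto simp: distrib_right act_add_left\<close>)
qed

end

text \<open>Only the generators need to be compared, because words act by composition.\<close>

lemma free_alg_act_intertwines:
  assumes "kops B op" "kspace C" "kmap B C f"
    and "\<And>x v. v \<in> carrier B \<Longrightarrow> f (op x v) = op' x (f v)"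
    and v: "v \<in> carrier B"
  shows "f (free_alg_act B op a v) = free_alg_act C op' a (f v)"
proof -
  interpret B: kops B op by fact
  have "f (foldr op xs v) = foldr op' xs (f v)" for xs
    by (induction xs) (auto simp: assms(4) v)
  moreover have "f (lincomb B (\<lambda>w. foldr op (letters w) v) a) = lincomb C (\<lambda>w. f (foldr op (letters w) v)) a"
    using v by (intro kmap_lincomb[OF B.kspace_axioms assms(2,3)]) simp
  ultimately show ?thesis
    by (simp add: free_alg_act_def lincomb_def)
qed

text \<open>A representation of \<open>U q\<close> given by operators for the generators. Every module that occurs
below is constructed or analysed in this form.\<close>

locale U_rep = kops B op
  for B :: "('k::field, 'b) module" (structure) and op :: "gen \<Rightarrow> 'b \<Rightarrow> 'b" +
  fixes q :: 'k
  assumes K_Ki: "v \<in> carrier B \<Longrightarrow> op gK (op gKi v) = v"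
    and Ki_K: "v \<in> carrier B \<Longrightarrow> op gKi (op gK v) = v"
    and g_gi: "v \<in> carrier B \<Longrightarrow> op gg (op ggi v) = v"
    and gi_g: "v \<in> carrier B \<Longrightarrow> op ggi (op gg v) = v"
    and h_hi: "v \<in> carrier B \<Longrightarrow> op gh (op ghi v) = v"
    and hi_h: "v \<in> carrier B \<Longrightarrow> op ghi (op gh v) = v"
    and g_h: "v \<in> carrier B \<Longrightarrow> op gg (op gh v) = op gh (op gg v)"
    and g_E: "v \<in> carrier B \<Longrightarrow> op gg (op gE v) = op gE (op gg v)"
    and g_F: "v \<in> carrier B \<Longrightarrow> op gg (op gF v) = op gF (op gg v)"
    and g_K: "v \<in> carrier B \<Longrightarrow> op gg (op gK v) = op gK (op gg v)"
    and h_E: "v \<in> carrier B \<Longrightarrow> op gh (op gE v) = op gE (op gh v)"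
    and h_F: "v \<in> carrier B \<Longrightarrow> op gh (op gF v) = op gF (op gh v)"
    and h_K: "v \<in> carrier B \<Longrightarrow> op gh (op gK v) = op gK (op gh v)"
    and K_E_Ki: "v \<in> carrier B \<Longrightarrow> op gK (op gE (op gKi v)) = q\<^sup>2 \<odot> op gE v"
    and K_F_Ki: "v \<in> carrier B \<Longrightarrow> op gK (op gF (op gKi v)) = inverse (q\<^sup>2) \<odot> op gF v"
    and E_F: "v \<in> carrier B \<Longrightarrow> op gE (op gF v) =
      op gF (op gE v) \<oplus> inverse (q - inverse q) \<odot> (op gK v \<oplus> (- 1) \<odot> op gKi (op gg (op gg v)))"
begin

lemma relators_act:
  assumes "a \<in> relators q" "v \<in> carrier B"
  shows "act a v = \<zero>"
proof -
  \<comment> \<open>The commutator relation is the only relator that is not a difference of two simple terms.\<close>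
  have EF: "act (mon [gE, gF] - mon [gF, gE] - const c * (mon [gK] - mon [gKi, gg, gg])) v = \<zero>"
    if "c = inverse (q - inverse q)" for c
    unfolding diff_diff_eq using assms(2) that
    by (subst act_diff_eq_zero) (simp_all add: act_add_left act_diff const_mult act_scl E_F)
  show ?thesis
    using assms(1) unfolding relators_def
    by (elim insertE emptyE) ((erule ssubst, rule EF[OF refl]) |
        simp add: assms(2) act_diff_eq_zero const_mult act_scl K_Ki Ki_K g_gi gi_g h_hi hi_h
          g_h g_E g_F g_K h_E h_F h_K K_E_Ki K_F_Ki)+
qed

text \<open>The elements that act as zero form an ideal, which contains the relators.\<close>

lemma U_ideal_act:
  assumes "a \<in> U_ideal q" "v \<in> carrier B"
  shows "act a v = \<zero>"
proof -
  let ?I = "{a. \<forall>v\<in>carrier B. act a v = \<zero>}"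
  have "ideal ?I (free_alg_ring :: 'k free_alg ring)"
  proof (rule idealI[OF ring_of_type_algebra_ring])
    interpret F: ring "free_alg_ring :: 'k free_alg ring" by (rule ring_of_type_algebra_ring)
    have inv: "inv\<^bsub>add_monoid free_alg_ring\<^esub> a = - a" for a :: "'k free_alg"
      using F.minus_equality[of "- a" a] by (simp add: a_inv_def)
    show "subgroup ?I (add_monoid (free_alg_ring :: 'k free_alg ring))"
    proof (rule group.subgroupI)
      show "Group.group (add_monoid (free_alg_ring :: 'k free_alg ring))" by (rule F.a_group)
      show "?I \<noteq> {}" by (auto intro: exI[of _ 0])
      fix a b :: "'k free_alg"
      assume "a \<in> ?I"
      then show "inv\<^bsub>add_monoid free_alg_ring\<^esub> a \<in> ?I"
        unfolding inv using act_scl[of _ "-1" a] by simp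
      assume "b \<in> ?I"
      with \<open>a \<in> ?I\<close> show "a \<otimes>\<^bsub>add_monoid free_alg_ring\<^esub> b \<in> ?I"
        by (simp add: act_add_left)
    qed simp
  qed (auto simp: act_mult)
  then have "U_ideal q \<subseteq> ?I"
    unfolding U_ideal_def
    by (rule ring.genideal_minimal[OF ring_of_type_algebra_ring]) (auto simp: relators_act)
  then show ?thesis using assms by auto
qed

text \<open>All representatives of a class act alike, so the value picked by \<^const>\<open>the_elem\<close> is the action
of any of them.\<close>

lemma U_act_class [simp]:
  assumes "v \<in> carrier B"
  shows "U_act B op (U_class q a) v = act a v"
proof -
  interpret ideal "U_ideal q" "free_alg_ring :: 'k free_alg ring" by (rule U_ideal_ideal)
  have "0 \<in> U_ideal q" using R.zero_closed additive_subgroup.zero_closed[OF is_additive_subgroup] by simp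
  then have "(\<lambda>a. act a v) ` U_class q a = {act a v}"
    using assms by (auto simp: U_class_conv act_add_left U_ideal_act image_iff intro!: bexI[of _ 0])
  then show ?thesis by (simp add: U_act_def)
qed

lemma module_of_space_left_module: "left_module (U q) (module_of_space B (U_act B op))"
proof -
  interpret UR: ring "U q" by (rule U_ring)
  have "abelian_group (module_of_space B (U_act B op))"
    by (rule abelian_groupI)
      (auto simp: module_of_space_def M.a_ac dest: M.add.l_inv_ex)
  then interpret M': abelian_group "module_of_space B (U_act B op)" .
  show ?thesis
    by unfold_locales
      (auto elim!: U_carrierE simp: module_of_space_def act_add_left kmapD[OF act_kmap] act_mult U_one)
qed

end

lemma U_act_intertwines:
  assumes "U_rep B op q" "U_rep C op' q" "kmap B C f"
    and "\<And>x v. v \<in> carrier B \<Longrightarrow> f (op x v) = op' x (f v)"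
    and v: "v \<in> carrier B" and u: "u \<in> carrier (U q)"
  shows "f (U_act B op u v) = U_act C op' u (f v)"
proof -
  interpret B: U_rep B op q by fact
  interpret C: U_rep C op' q by fact
  from u obtain a where a: "u = U_class q a" by (rule U_carrierE)
  show ?thesis
    unfolding a B.U_act_class[OF v] C.U_act_class[OF kmapD(1)[OF assms(3) v]]
    using B.kops_axioms C.kspace_axioms assms(3-5) by (rule free_alg_act_intertwines)
qed

lemma mon_mult: "mon xs * mon ys = mon (xs @ ys)"
  by (simp add: mon_def mult_single plus_word_def)

lemma mon_Nil: "mon [] = 1"
  by (simp add: mon_def flip: zero_word_def)

lemma const_add: "const (c + d) = const c + const d"
  and const_times: "const (c * d) = const c * const d"
  and const_uminus: "const (- c) = - const c"
  by (simp_all add: const_def single_add mult_single single_uminus)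

lemma space_of_module_simps [simp]:
  "carrier (space_of_module q M) = carrier M"
  "ring.zero (space_of_module q M) = ring.zero M"
  "add (space_of_module q M) = add M"
  "module.smult (space_of_module q M) c = module.smult M (U_class q (const c))"
  by (simp_all add: space_of_module_def)

abbreviation gen_act :: "'k::field \<Rightarrow> ('k, 'a) U_module \<Rightarrow> gen \<Rightarrow> 'a \<Rightarrow> 'a"
  where "gen_act q M x v \<equiv> U_mon q [x] \<odot>\<^bsub>M\<^esub> v"

text \<open>The converse direction: in a left module the classes of the generators act by operators that
satisfy the relations.\<close>

locale U_left_module = left_module "U q" M
  for q :: "'k::field" and M :: "('k, 'a) U_module" (structure)
begin

lemma sm_class_closed [simp]: "v \<in> carrier M \<Longrightarrow> U_class q a \<odot> v \<in> carrier M"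
  and sm_class_add: "v \<in> carrier M \<Longrightarrow> U_class q (a + b) \<odot> v = U_class q a \<odot> v \<oplus> U_class q b \<odot> v"
  and sm_class_mult: "v \<in> carrier M \<Longrightarrow> U_class q (a * b) \<odot> v = U_class q a \<odot> (U_class q b \<odot> v)"
  and sm_class_right: "v \<in> carrier M \<Longrightarrow> w \<in> carrier M \<Longrightarrow>
    U_class q a \<odot> (v \<oplus> w) = U_class q a \<odot> v \<oplus> U_class q a \<odot> w"
  and sm_class_one [simp]: "v \<in> carrier M \<Longrightarrow> U_class q 1 \<odot> v = v"
  using smult_closed[of "U_class q a" v] smult_l_distr[of "U_class q a" "U_class q b" v]
    smult_assoc1[of "U_class q a" "U_class q b" v] smult_r_distr[of "U_class q a" v w] smult_one[of v]
  by (simp_all add: U_one)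

lemma kspace: "kspace (space_of_module q M)"
  by (rule kspaceI)
    (auto simp: M.a_ac const_add const_times sm_class_add sm_class_right simp flip: sm_class_mult dest: M.add.l_inv_ex)

lemma gen_act_kmap: "kmap (space_of_module q M) (space_of_module q M) (gen_act q M x)"
  by (auto simp: kmap_def sm_class_right const_commute simp flip: sm_class_mult)

lemma rel_act:
  assumes "a - b \<in> relators q" "v \<in> carrier M"
  shows "U_class q a \<odot> v = U_class q b \<odot> v"
  using relator_class[OF assms(1)] by simp

lemma U_rep_gen_act: "U_rep (space_of_module q M) (gen_act q M) q"
proof -
  interpret B: kops "space_of_module q M" "gen_act q M"
    using kspace gen_act_kmap by (simp add: kops_def kops_axioms_def)
  note [simp] = sm_class_mult[symmetric] mon_mult mon_Nil
  have EF: "U_class q (mon [gE, gF]) =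
      U_class q (mon [gF, gE] + const (inverse (q - inverse q)) * (mon [gK] + const (-1) * mon [gKi, gg, gg]))"
    by (rule relator_class) (simp add: relators_def diff_diff_eq const_uminus)
  show ?thesis
  proof unfold_locales
    fix v assume "v \<in> carrier (space_of_module q M)"
    then have v: "v \<in> carrier M" by simp
    note r = rel_act[OF _ v]
    show "gen_act q M gK (gen_act q M gKi v) = v"
      using r[of "mon [gK, gKi]" 1] v by (simp add: relators_def)
    show "gen_act q M gKi (gen_act q M gK v) = v"
      using r[of "mon [gKi, gK]" 1] v by (simp add: relators_def)
    show "gen_act q M gg (gen_act q M ggi v) = v"
      using r[of "mon [gg, ggi]" 1] v by (simp add: relators_def)
    show "gen_act q M ggi (gen_act q M gg v) = v"
      using r[of "mon [ggi, gg]" 1] v by (simp add: relators_def)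
    show "gen_act q M gh (gen_act q M ghi v) = v"
      using r[of "mon [gh, ghi]" 1] v by (simp add: relators_def)
    show "gen_act q M ghi (gen_act q M gh v) = v"
      using r[of "mon [ghi, gh]" 1] v by (simp add: relators_def)
    show "gen_act q M gg (gen_act q M gh v) = gen_act q M gh (gen_act q M gg v)"
      using r[of "mon [gg, gh]" "mon [gh, gg]"] v by (simp add: relators_def)
    show "gen_act q M gg (gen_act q M gE v) = gen_act q M gE (gen_act q M gg v)"
      using r[of "mon [gg, gE]" "mon [gE, gg]"] v by (simp add: relators_def)
    show "gen_act q M gg (gen_act q M gF v) = gen_act q M gF (gen_act q M gg v)"
      using r[of "mon [gg, gF]" "mon [gF, gg]"] v by (simp add: relators_def)
    show "gen_act q M gg (gen_act q M gK v) = gen_act q M gK (gen_act q M gg v)"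
      using r[of "mon [gg, gK]" "mon [gK, gg]"] v by (simp add: relators_def)
    show "gen_act q M gh (gen_act q M gE v) = gen_act q M gE (gen_act q M gh v)"
      using r[of "mon [gh, gE]" "mon [gE, gh]"] v by (simp add: relators_def)
    show "gen_act q M gh (gen_act q M gF v) = gen_act q M gF (gen_act q M gh v)"
      using r[of "mon [gh, gF]" "mon [gF, gh]"] v by (simp add: relators_def)
    show "gen_act q M gh (gen_act q M gK v) = gen_act q M gK (gen_act q M gh v)"
      using r[of "mon [gh, gK]" "mon [gK, gh]"] v by (simp add: relators_def)
    show "gen_act q M gK (gen_act q M gE (gen_act q M gKi v)) = q\<^sup>2 \<odot>\<^bsub>space_of_module q M\<^esub> gen_act q M gE v"
      using r[of "mon [gK, gE, gKi]" "const (q\<^sup>2) * mon [gE]"] v by (simp add: relators_def)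
    show "gen_act q M gK (gen_act q M gF (gen_act q M gKi v)) =
        inverse (q\<^sup>2) \<odot>\<^bsub>space_of_module q M\<^esub> gen_act q M gF v"
      using r[of "mon [gK, gF, gKi]" "const (inverse (q\<^sup>2)) * mon [gF]"] v by (simp add: relators_def)
    show "gen_act q M gE (gen_act q M gF v) =
      gen_act q M gF (gen_act q M gE v) \<oplus>\<^bsub>space_of_module q M\<^esub> inverse (q - inverse q) \<odot>\<^bsub>space_of_module q M\<^esub>
        (gen_act q M gK v \<oplus>\<^bsub>space_of_module q M\<^esub>
          (- 1) \<odot>\<^bsub>space_of_module q M\<^esub> gen_act q M gKi (gen_act q M gg (gen_act q M gg v)))"
      using arg_cong[OF EF, of "\<lambda>u. u \<odot> v"] v by (simp add: sm_class_add[symmetric])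
  qed
qed

lemma U_mon_Cons:
  "v \<in> carrier M \<Longrightarrow> U_mon q (x # y # xs) \<odot> v = gen_act q M x (U_mon q (y # xs) \<odot> v)"
  by (simp add: sm_class_mult[symmetric] mon_mult)

end

section \<open>Tensor products of vector spaces\<close>

text \<open>Negation is scaling by \<open>- 1\<close>, so closure under inverses is automatic.\<close>

lemma submodule_free_space:
  "submodule N (ring_of_type_algebra :: 'k::field ring) (free_space S) \<longleftrightarrow> subspace_on S N"
proof -
  interpret F: kspace "free_space S :: ('k, 'a \<Rightarrow>\<^sub>0 'k) module" by (rule kspace_free_space)
  have inv: "inv\<^bsub>add_monoid (free_space S)\<^esub> p = scl (-1) p" if "Poly_Mapping.keys p \<subseteq> S" for p :: "'a \<Rightarrow>\<^sub>0 'k"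
    using F.M.minus_equality[of "- p" p] that by (simp add: a_inv_def)
  show ?thesis
  proof
    assume "submodule N (ring_of_type_algebra :: 'k::field ring) (free_space S)"
    then interpret submodule N "ring_of_type_algebra :: 'k::field ring" "free_space S" .
    show "subspace_on S N"
      unfolding subspace_on_def
      using subset one_closed m_closed smult_closed by auto
  next
    assume "subspace_on S N"
    then have N: "\<And>p. p \<in> N \<Longrightarrow> Poly_Mapping.keys p \<subseteq> S" "0 \<in> N"
        "\<And>p p'. p \<in> N \<Longrightarrow> p' \<in> N \<Longrightarrow> p + p' \<in> N" "\<And>c p. p \<in> N \<Longrightarrow> scl c p \<in> N"
      by (auto simp: subspace_on_def)
    show "submodule N (ring_of_type_algebra :: 'k::field ring) (free_space S)"
    proof (intro submodule.intro subgroup.intro submodule_axioms.intro)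
      fix p assume "p \<in> N"
      then show "inv\<^bsub>add_monoid (free_space S)\<^esub> p \<in> N"
        by (subst inv) (use N in blast)+
    qed (use N in auto)
  qed
qed

locale tensor_pair = A: kspace A + B: kspace B
  for A :: "('k::field, 'a) module" (structure) and B :: "('k::field, 'b) module" (structure)
begin

abbreviation "S \<equiv> carrier A \<times> carrier B"
abbreviation "N \<equiv> tensor_null A B"
abbreviation "T \<equiv> tensor_space A B"
abbreviation "cls \<equiv> tensor_class A B"
abbreviation "pure \<equiv> pure_tensor A B"

lemma N_eq: "N = \<Inter>{N. subspace_on S N \<and> tensor_relators A B \<subseteq> N}"
  by (simp add: tensor_null_def generated_submodule_def submodule_free_space)

lemma tensor_relators_keys: "p \<in> tensor_relators A B \<Longrightarrow> Poly_Mapping.keys p \<subseteq> S"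
  unfolding tensor_relators_def
  by (elim UnE CollectE exE conjE; simp only:)
    (intro keys_diff_subset keys_single_subset; simp)+

lemma N_subspace: "subspace_on S N"
proof -
  have "subspace_on S {p. Poly_Mapping.keys p \<subseteq> S}"
    by (auto simp: subspace_on_def keys_add_subset keys_scl_subset)
  then have "N \<subseteq> {p. Poly_Mapping.keys p \<subseteq> S}"
    unfolding N_eq using tensor_relators_keys by blast
  moreover have "0 \<in> N" "\<And>p p'. p \<in> N \<Longrightarrow> p' \<in> N \<Longrightarrow> p + p' \<in> N" "\<And>c p. p \<in> N \<Longrightarrow> scl c p \<in> N"
    unfolding N_eq by (auto simp: subspace_on_def)
  ultimately show ?thesis unfolding subspace_on_def by blast
qed

lemma N_keys: "p \<in> N \<Longrightarrow> Poly_Mapping.keys p \<subseteq> S"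
  and N_zero [simp]: "0 \<in> N"
  and N_add: "p \<in> N \<Longrightarrow> p' \<in> N \<Longrightarrow> p + p' \<in> N"
  and N_scl: "p \<in> N \<Longrightarrow> scl c p \<in> N"
  using N_subspace unfolding subspace_on_def by blast+

lemma N_uminus: "p \<in> N \<Longrightarrow> - p \<in> N"
  using N_scl[of p "-1"] by simp

lemma N_diff: "p \<in> N \<Longrightarrow> p' \<in> N \<Longrightarrow> p - p' \<in> N"
  using N_add[of p "- p'"] N_uminus by simp

lemma N_relator: "p \<in> tensor_relators A B \<Longrightarrow> p \<in> N"
  unfolding N_eq by blast

lemma N_induct [consumes 1, case_names zero add scl relator]:
  assumes "p \<in> N" "P 0" "\<And>p p'. P p \<Longrightarrow> P p' \<Longrightarrow> P (p + p')" "\<And>c p. P p \<Longrightarrow> P (scl c p)"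
    and "\<And>p. p \<in> tensor_relators A B \<Longrightarrow> P p"
  shows "P p"
proof -
  have "subspace_on S {p \<in> N. P p}"
    using N_keys N_add N_scl assms(2-4) by (auto simp: subspace_on_def)
  then have "N \<subseteq> {p \<in> N. P p}"
    using assms(5) N_relator by (subst N_eq) blast
  then show ?thesis using assms(1) by blast
qed

lemma cls_conv: "cls p = (\<lambda>h. h + p) ` N"
  by (auto simp: tensor_class_def a_r_coset_def r_coset_def)

lemma self_in_cls: "p \<in> cls p"
  unfolding cls_conv by (rule image_eqI[of _ _ 0]) auto

text \<open>The map \<open>cls\<close> is a linear surjection from the free space with kernel \<open>N\<close>. Identities in the
tensor product can therefore be verified by computing with representatives in a type that is an
abelian group.\<close>

lemma cls_eq_iff: "cls p = cls p' \<longleftrightarrow> p - p' \<in> N"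
proof
  assume "cls p = cls p'"
  then have "p \<in> cls p'" using self_in_cls[of p] by simp
  then show "p - p' \<in> N" by (auto simp: cls_conv)
next
  assume *: "p - p' \<in> N"
  show "cls p = cls p'"
    unfolding cls_conv
  proof (intro equalityI subsetI; elim imageE)
    fix z h assume "z = h + p" "h \<in> N"
    then show "z \<in> (\<lambda>h. h + p') ` N" using N_add[OF _ *, of h] by (intro image_eqI[of _ _ "h + (p - p')"]) auto
  next
    fix z h assume "z = h + p'" "h \<in> N"
    then show "z \<in> (\<lambda>h. h + p) ` N" using N_diff[OF _ *, of h] by (intro image_eqI[of _ _ "h - (p - p')"]) auto
  qed
qed

lemma cls_memD: "p' \<in> cls p \<Longrightarrow> cls p' = cls p"
  by (auto simp: cls_eq_iff) (auto simp: cls_conv)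

lemma T_carrier: "carrier T = cls ` {p. Poly_Mapping.keys p \<subseteq> S}"
  by (auto simp: tensor_space_def quotient_module_def A_RCOSETS_def RCOSETS_def tensor_class_def a_r_coset_def)

lemma T_add [simp]: "cls p \<oplus>\<^bsub>T\<^esub> cls p' = cls (p + p')"
proof -
  have "cls p \<oplus>\<^bsub>T\<^esub> cls p' = (\<Union>a\<in>cls p. \<Union>b\<in>cls p'. {a + b})"
    by (simp add: tensor_space_def quotient_module_def set_add_def set_mult_def)
  also have "\<dots> = cls (p + p')"
  proof (intro equalityI subsetI)
    fix z assume "z \<in> (\<Union>a\<in>cls p. \<Union>b\<in>cls p'. {a + b})"
    then obtain h h' where "h \<in> N" "h' \<in> N" "z = (h + p) + (h' + p')"
      by (auto simp: cls_conv)
    then show "z \<in> cls (p + p')"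
      unfolding cls_conv by (intro image_eqI[of _ _ "h + h'"]) (simp_all add: N_add add_ac)
  next
    fix z assume "z \<in> cls (p + p')"
    then obtain h where h: "h \<in> N" "z = (h + p) + p'" by (auto simp: cls_conv add.assoc)
    from h(1) have "h + p \<in> cls p" unfolding cls_conv by (rule imageI)
    then show "z \<in> (\<Union>a\<in>cls p. \<Union>b\<in>cls p'. {a + b})"
    proof (rule UN_I)
      show "z \<in> (\<Union>b\<in>cls p'. {(h + p) + b})"
        unfolding h(2) by (rule UN_I[OF self_in_cls]) (rule singletonI)
    qed
  qed
  finally show ?thesis .
qed

lemma T_zero: "\<zero>\<^bsub>T\<^esub> = cls 0"
  by (auto simp: tensor_space_def quotient_module_def cls_conv)

lemma T_sm [simp]: "c \<odot>\<^bsub>T\<^esub> cls p = cls (scl c p)"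
proof -
  have "c \<odot>\<^bsub>T\<^esub> cls p = (\<Union>x\<in>cls p. cls (scl c x))"
    by (auto simp: tensor_space_def quotient_module_def tensor_class_def)
  also have "\<dots> = (\<Union>x\<in>cls p. cls (scl c p))"
  proof (rule SUP_cong[OF refl])
    fix x assume "x \<in> cls p"
    then obtain h where "h \<in> N" "x = h + p" by (auto simp: cls_conv)
    then show "cls (scl c x) = cls (scl c p)" by (simp add: cls_eq_iff scl_add_right N_scl)
  qed
  also have "\<dots> = cls (scl c p)" using self_in_cls[of p] by (auto simp del: scl_simps)
  finally show ?thesis .
qed

lemma T_carrierE:
  assumes "t \<in> carrier T"
  obtains p where "t = cls p" "Poly_Mapping.keys p \<subseteq> S"
  using assms by (auto simp: T_carrier)

lemma cls_in_T: "Poly_Mapping.keys p \<subseteq> S \<Longrightarrow> cls p \<in> carrier T"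
  by (auto simp: T_carrier)

lemma kspace_T: "kspace T"
proof (rule kspaceI)
  fix x assume "x \<in> carrier T"
  then obtain p where p: "x = cls p" "Poly_Mapping.keys p \<subseteq> S" by (rule T_carrierE)
  then show "\<exists>y\<in>carrier T. y \<oplus>\<^bsub>T\<^esub> x = \<zero>\<^bsub>T\<^esub>"
    by (intro bexI[of _ "cls (- p)"]) (auto simp: T_zero cls_in_T)
next
  fix x y assume "x \<in> carrier T" "y \<in> carrier T"
  then show "x \<oplus>\<^bsub>T\<^esub> y \<in> carrier T"
    by (elim T_carrierE) (simp add: cls_in_T keys_add_subset)
next
  fix c x assume "x \<in> carrier T"
  then show "c \<odot>\<^bsub>T\<^esub> x \<in> carrier T"
    by (elim T_carrierE) (simp add: cls_in_T keys_scl_subset)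
qed (auto elim!: T_carrierE simp: T_zero add_ac scl_add_left scl_add_right intro!: cls_in_T)

sublocale T: kspace T by (rule kspace_T)

lemma pure_conv: "pure x y = cls (Poly_Mapping.single (x, y) 1)"
  by (simp add: pure_tensor_def)

lemma pure_in_T [simp]: "x \<in> carrier A \<Longrightarrow> y \<in> carrier B \<Longrightarrow> pure x y \<in> carrier T"
  by (auto simp: pure_conv intro!: cls_in_T)

lemma pure_add_left:
  "x \<in> carrier A \<Longrightarrow> x' \<in> carrier A \<Longrightarrow> y \<in> carrier B \<Longrightarrow>
    pure (x \<oplus>\<^bsub>A\<^esub> x') y = pure x y \<oplus>\<^bsub>T\<^esub> pure x' y"
  unfolding pure_conv T_add cls_eq_iff
  by (intro N_relator) (auto simp: tensor_relators_def diff_diff_eq)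

lemma pure_add_right:
  "x \<in> carrier A \<Longrightarrow> y \<in> carrier B \<Longrightarrow> y' \<in> carrier B \<Longrightarrow>
    pure x (y \<oplus>\<^bsub>B\<^esub> y') = pure x y \<oplus>\<^bsub>T\<^esub> pure x y'"
  unfolding pure_conv T_add cls_eq_iff
  by (intro N_relator) (auto simp: tensor_relators_def diff_diff_eq)

lemma pure_sm_left:
  "x \<in> carrier A \<Longrightarrow> y \<in> carrier B \<Longrightarrow> pure (c \<odot>\<^bsub>A\<^esub> x) y = c \<odot>\<^bsub>T\<^esub> pure x y"
  unfolding pure_conv T_sm cls_eq_iff
  by (intro N_relator) (auto simp: tensor_relators_def)

lemma pure_sm_right:
  "x \<in> carrier A \<Longrightarrow> y \<in> carrier B \<Longrightarrow> pure x (c \<odot>\<^bsub>B\<^esub> y) = c \<odot>\<^bsub>T\<^esub> pure x y"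
  unfolding pure_conv T_sm cls_eq_iff
  by (intro N_relator) (auto simp: tensor_relators_def)

lemma T_induct [consumes 1, case_names pure add sm]:
  assumes "t \<in> carrier T"
    and "\<And>x y. x \<in> carrier A \<Longrightarrow> y \<in> carrier B \<Longrightarrow> P (pure x y)"
    and "\<And>t t'. t \<in> carrier T \<Longrightarrow> t' \<in> carrier T \<Longrightarrow> P t \<Longrightarrow> P t' \<Longrightarrow> P (t \<oplus>\<^bsub>T\<^esub> t')"
    and "\<And>c t. t \<in> carrier T \<Longrightarrow> P t \<Longrightarrow> P (c \<odot>\<^bsub>T\<^esub> t)"
  shows "P t"
proof -
  from assms(1) obtain p where p: "t = cls p" "Poly_Mapping.keys p \<subseteq> S" by (rule T_carrierE)
  have single: "P (cls (Poly_Mapping.single z c))" if "z \<in> S" for z c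
    using that assms(4)[OF pure_in_T assms(2), of "fst z" "snd z" c] assms(2)
    by (auto simp: pure_conv)
  have "P (cls p)"
    using p(2)
  proof (induction rule: poly_mapping_lin_induct)
    case zero
    show ?case using single[of "(\<zero>\<^bsub>A\<^esub>, \<zero>\<^bsub>B\<^esub>)" 0] by simp
  next
    case (add p p')
    then show ?case using assms(3)[OF cls_in_T cls_in_T] by simp
  qed (rule single)
  then show ?thesis using p by simp
qed

text \<open>The universal property in relative form: the linear extension of a map that is bilinear modulo
\<open>N'\<close> sends \<open>N\<close> into \<open>N'\<close>. The case \<open>N' = {0}\<close> produces linear maps out of the tensor product,
and the case where \<open>N'\<close> is again such a null space shows that the action of tensors on tensors is
well defined.\<close>

lemma N_lext:
  assumes p: "p \<in> N" and N': "subspace_on S' N'"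
    and "\<And>x x' y. x \<in> carrier A \<Longrightarrow> x' \<in> carrier A \<Longrightarrow> y \<in> carrier B \<Longrightarrow>
      g (x \<oplus>\<^bsub>A\<^esub> x', y) - g (x, y) - g (x', y) \<in> N'"
    and "\<And>x y y'. x \<in> carrier A \<Longrightarrow> y \<in> carrier B \<Longrightarrow> y' \<in> carrier B \<Longrightarrow>
      g (x, y \<oplus>\<^bsub>B\<^esub> y') - g (x, y) - g (x, y') \<in> N'"
    and "\<And>c x y. x \<in> carrier A \<Longrightarrow> y \<in> carrier B \<Longrightarrow> g (c \<odot>\<^bsub>A\<^esub> x, y) - scl c (g (x, y)) \<in> N'"
    and "\<And>c x y. x \<in> carrier A \<Longrightarrow> y \<in> carrier B \<Longrightarrow> g (x, c \<odot>\<^bsub>B\<^esub> y) - scl c (g (x, y)) \<in> N'"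
  shows "lext g p \<in> N'"
  using p
proof (induction rule: N_induct)
  case (relator p)
  then show ?case
    unfolding tensor_relators_def
    by (elim UnE CollectE exE conjE) (simp_all add: lext_diff assms(3-6))
qed (use N' in \<open>auto simp: subspace_on_def lext_add lext_scl\<close>)

lemma
  shows N_add_left: "x \<in> carrier A \<Longrightarrow> x' \<in> carrier A \<Longrightarrow> y \<in> carrier B \<Longrightarrow>
      Poly_Mapping.single (x \<oplus>\<^bsub>A\<^esub> x', y) 1 - Poly_Mapping.single (x, y) 1 - Poly_Mapping.single (x', y) 1 \<in> N"
    and N_add_right: "x \<in> carrier A \<Longrightarrow> y \<in> carrier B \<Longrightarrow> y' \<in> carrier B \<Longrightarrow>
      Poly_Mapping.single (x, y \<oplus>\<^bsub>B\<^esub> y') 1 - Poly_Mapping.single (x, y) 1 - Poly_Mapping.single (x, y') 1 \<in> N"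
    and N_sm_left: "x \<in> carrier A \<Longrightarrow> y \<in> carrier B \<Longrightarrow>
      Poly_Mapping.single (c \<odot>\<^bsub>A\<^esub> x, y) 1 - Poly_Mapping.single (x, y) c \<in> N"
    and N_sm_right: "x \<in> carrier A \<Longrightarrow> y \<in> carrier B \<Longrightarrow>
      Poly_Mapping.single (x, c \<odot>\<^bsub>B\<^esub> y) 1 - Poly_Mapping.single (x, y) c \<in> N"
  by (rule N_relator; force simp: tensor_relators_def)+

text \<open>The linear extension vanishes on \<open>N\<close>, so it does not depend on the representative.\<close>

lemma bilinear_lift:
  fixes \<phi> :: "'a \<times> 'b \<Rightarrow> 'c \<Rightarrow>\<^sub>0 'k"
  assumes add_left: "\<And>x x' y. x \<in> carrier A \<Longrightarrow> x' \<in> carrier A \<Longrightarrow> y \<in> carrier B \<Longrightarrow>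
      \<phi> (x \<oplus>\<^bsub>A\<^esub> x', y) = \<phi> (x, y) + \<phi> (x', y)"
    and add_right: "\<And>x y y'. x \<in> carrier A \<Longrightarrow> y \<in> carrier B \<Longrightarrow> y' \<in> carrier B \<Longrightarrow>
      \<phi> (x, y \<oplus>\<^bsub>B\<^esub> y') = \<phi> (x, y) + \<phi> (x, y')"
    and sm_left: "\<And>c x y. x \<in> carrier A \<Longrightarrow> y \<in> carrier B \<Longrightarrow> \<phi> (c \<odot>\<^bsub>A\<^esub> x, y) = scl c (\<phi> (x, y))"
    and sm_right: "\<And>c x y. x \<in> carrier A \<Longrightarrow> y \<in> carrier B \<Longrightarrow> \<phi> (x, c \<odot>\<^bsub>B\<^esub> y) = scl c (\<phi> (x, y))"
  shows "\<exists>\<xi>. kmap T (free_space UNIV) \<xi> \<and>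
    (\<forall>x\<in>carrier A. \<forall>y\<in>carrier B. \<xi> (pure x y) = \<phi> (x, y))"
proof -
  have zero: "lext \<phi> p = 0" if "p \<in> N" for p
  proof -
    have "subspace_on UNIV {0 :: 'c \<Rightarrow>\<^sub>0 'k}" by (simp add: subspace_on_def)
    from N_lext[OF that this, of \<phi>] show ?thesis
      by (simp add: add_left add_right sm_left sm_right)
  qed
  define \<xi> where "\<xi> t = lext \<phi> (SOME p. t = cls p)" for t
  have \<xi>: "\<xi> (cls p) = lext \<phi> p" for p
  proof -
    have "cls p = cls (SOME p'. cls p = cls p')" by (rule someI[of "\<lambda>p'. cls p = cls p'"]) simp
    then have "lext \<phi> (p - (SOME p'. cls p = cls p')) = 0" by (intro zero) (simp only: cls_eq_iff)
    then show ?thesis by (simp add: \<xi>_def lext_diff)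
  qed
  show ?thesis
    by (intro exI[of _ \<xi>])
      (auto simp: kmap_def \<xi> lext_add lext_scl pure_conv elim!: T_carrierE)
qed

end

section \<open>The coproduct on representations\<close>

context U_rep
begin

text \<open>An operator that commutes with an invertible one commutes with its inverse. Together with
the defining relations, the rules move \<open>g\<close> innermost, then \<open>h\<close>, then \<open>K\<close>, and so compare words through a normal form.\<close>

lemma
  assumes "v \<in> carrier B"
  shows g_hi: "op gg (op ghi v) = op ghi (op gg v)"
    and hi_E: "op ghi (op gE v) = op gE (op ghi v)"
    and hi_F: "op ghi (op gF v) = op gF (op ghi v)"
    and hi_K: "op ghi (op gK v) = op gK (op ghi v)"
    and g_Ki: "op gg (op gKi v) = op gKi (op gg v)"
    and h_Ki: "op gh (op gKi v) = op gKi (op gh v)"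
    and hi_Ki: "op ghi (op gKi v) = op gKi (op ghi v)"
proof -
  have swap: "op y' (op x v) = op x (op y' v)"
    if "\<And>v. v \<in> carrier B \<Longrightarrow> op y (op y' v) = v" "\<And>v. v \<in> carrier B \<Longrightarrow> op y' (op y v) = v"
      "\<And>v. v \<in> carrier B \<Longrightarrow> op y (op x v) = op x (op y v)" "v \<in> carrier B" for x y y' v
  proof -
    have "op y' (op x v) = op y' (op x (op y (op y' v)))" using that(1,4) by simp
    also have "\<dots> = op y' (op y (op x (op y' v)))" using that(3)[of "op y' v"] that(4) by simp
    also have "\<dots> = op x (op y' v)" using that(2,4) by simp
    finally show ?thesis .
  qed
  note sh = swap[of gh ghi, OF h_hi hi_h]
    and sK = swap[of gK gKi, OF K_Ki Ki_K]
  note [simp] = assms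
  show "op gg (op ghi v) = op ghi (op gg v)" by (rule sh[symmetric]) (simp_all add: g_h)
  show "op ghi (op gE v) = op gE (op ghi v)" by (rule sh) (simp_all add: h_E)
  show "op ghi (op gF v) = op gF (op ghi v)" by (rule sh) (simp_all add: h_F)
  have hiK: "op ghi (op gK v) = op gK (op ghi v)" if "v \<in> carrier B" for v using that by (intro sh) (simp_all add: h_K)
  show "op ghi (op gK v) = op gK (op ghi v)" by (simp add: hiK)
  show "op gg (op gKi v) = op gKi (op gg v)" by (rule sK[symmetric]) (simp_all add: g_K)
  show "op gh (op gKi v) = op gKi (op gh v)" by (rule sK[symmetric]) (simp_all add: h_K)
  show "op ghi (op gKi v) = op gKi (op ghi v)" by (rule sK[symmetric]) (simp_all add: hiK)
qed

lemma
  assumes "q \<noteq> 0" "v \<in> carrier B"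
  shows K_E: "op gK (op gE v) = q\<^sup>2 \<odot> op gE (op gK v)"
    and Ki_E: "op gKi (op gE v) = inverse (q\<^sup>2) \<odot> op gE (op gKi v)"
    and K_F: "op gK (op gF v) = inverse (q\<^sup>2) \<odot> op gF (op gK v)"
    and Ki_F: "op gKi (op gF v) = q\<^sup>2 \<odot> op gF (op gKi v)"
proof -
  show KE: "op gK (op gE v) = q\<^sup>2 \<odot> op gE (op gK v)" using K_E_Ki[of "op gK v"] assms by (simp add: Ki_K)
  show KF: "op gK (op gF v) = inverse (q\<^sup>2) \<odot> op gF (op gK v)" using K_F_Ki[of "op gK v"] assms by (simp add: Ki_K)
  have "op gKi (op gK (op gE (op gKi v))) = op gE (op gKi v)" using assms by (simp add: Ki_K)
  then have "op gE (op gKi v) = q\<^sup>2 \<odot> op gKi (op gE v)" using assms by (simp add: K_E_Ki op_sm)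
  then show "op gKi (op gE v) = inverse (q\<^sup>2) \<odot> op gE (op gKi v)" using assms by simp
  have "op gKi (op gK (op gF (op gKi v))) = op gF (op gKi v)" using assms by (simp add: Ki_K)
  then have "op gF (op gKi v) = inverse (q\<^sup>2) \<odot> op gKi (op gF v)" using assms by (simp add: K_F_Ki op_sm)
  then show "op gKi (op gF v) = q\<^sup>2 \<odot> op gF (op gKi v)" using assms by simp
qed

end

locale U_rep_pair = A: U_rep A opA q + B: U_rep B opB q
  for A :: "('k::field, 'a) module" (structure) and B :: "('k::field, 'b) module" (structure)
    and opA opB and q :: 'k +
  assumes q_nz: "q \<noteq> 0"
begin

sublocale tensor_pair A B by unfold_locales

text \<open>It suffices to check the relations on pure tensors, since both sides are linear. There all
relations but the commutator relation become equal after normalisation. In the commutator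
relation the mixed terms of \<open>E F\<close> and \<open>F E\<close> agree because the factor \<open>q\<^sup>2\<close> from moving \<open>K\<inverse>\<close> past
\<open>E\<close> in one tensor factor cancels the factor from moving \<open>K\<close> past \<open>F\<close> in the other. What remains
is \<open>K\<inverse>g\<^sup>2 \<otimes> [E, F] + [E, F] \<otimes> K\<close>, in which the two terms \<open>K\<inverse>g\<^sup>2 \<otimes> K\<close> cancel.\<close>

lemma U_rep_tensor:
  assumes D: "\<And>x. kmap T T (D x)"
    and E: "\<And>a b. a \<in> carrier A \<Longrightarrow> b \<in> carrier B \<Longrightarrow>
      D gE (pure a b) = pure (opA ghi a) (opB gE b) \<oplus>\<^bsub>T\<^esub> pure (opA gE a) (opB gh (opB gK b))"
    and F: "\<And>a b. a \<in> carrier A \<Longrightarrow> b \<in> carrier B \<Longrightarrow>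
      D gF (pure a b) = pure (opA gKi (opA gh (opA gg (opA gg a)))) (opB gF b) \<oplus>\<^bsub>T\<^esub>
        pure (opA gF a) (opB ghi b)"
    and grouplike: "\<And>a b x. a \<in> carrier A \<Longrightarrow> b \<in> carrier B \<Longrightarrow> x \<noteq> gE \<Longrightarrow> x \<noteq> gF \<Longrightarrow>
      D x (pure a b) = pure (opA x a) (opB x b)"
  shows "U_rep T D q"
proof -
  interpret D: kops T D
    using D T.kspace_axioms by (simp add: kops_def kops_axioms_def)
  note rels = A.K_Ki A.Ki_K A.g_gi A.gi_g A.h_hi A.hi_h A.g_h A.g_E A.g_F A.g_K A.h_E A.h_F A.h_K
    A.g_hi A.hi_E A.hi_F A.hi_K A.g_Ki A.h_Ki A.hi_Ki
    A.K_E[OF q_nz] A.Ki_E[OF q_nz] A.K_F[OF q_nz] A.Ki_F[OF q_nz] A.E_F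
    B.K_Ki B.Ki_K B.g_gi B.gi_g B.h_hi B.hi_h B.g_h B.g_E B.g_F B.g_K B.h_E B.h_F B.h_K
    B.g_hi B.hi_E B.hi_F B.hi_K B.g_Ki B.h_Ki B.hi_Ki
    B.K_E[OF q_nz] B.Ki_E[OF q_nz] B.K_F[OF q_nz] B.Ki_F[OF q_nz] B.E_F
  note lin = D.op_add D.op_sm E F grouplike T.sm_add_right pure_sm_left pure_sm_right
  show ?thesis
  proof (unfold_locales, goal_cases)
    \<comment> \<open>The commutator relation, the last of the assumptions of \<^locale>\<open>U_rep\<close>.\<close>
    case (16 t)
    then show ?case
    proof (induction rule: T_induct)
      case (pure a b)
      show ?case
        using pure q_nz
        by (simp add: lin rels A.op_sm B.op_sm A.op_add B.op_add A.sm_add_right B.sm_add_right pure_add_left pure_add_right)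
          (simp add: pure_conv scl_add_right single_uminus algebra_simps)
    qed (simp_all add: lin T.M.a_ac mult.commute)
  qed (erule T_induct; simp add: lin rels q_nz T.M.a_ac mult.commute)+
qed

end

lemma U_regular_simps [simp]:
  "carrier (U_regular q) = carrier (U q)"
  "ring.zero (U_regular q) = ring.zero (U q)"
  "add (U_regular q) = add (U q)"
  "module.smult (U_regular q) = monoid.mult (U q)"
  by (simp_all add: U_regular_def)

lemma U_regular_left_module: "U_left_module q (U_regular q)"
proof -
  interpret ring "U q" by (rule U_ring)
  have "abelian_group (U_regular q)"
    by (rule abelian_groupI) (auto simp: a_ac dest: add.l_inv_ex)
  then show ?thesis
    unfolding U_left_module_def left_module_def left_module_axioms_def
    using ring_axioms by (simp add: l_distr r_distr m_assoc)
qed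

text \<open>The action of tensors on tensors, on the level of representatives.\<close>

definition tlext ::
    "('k::field, 'a) U_module \<Rightarrow> ('k, 'b) U_module \<Rightarrow>
      ('k free_alg set \<times> 'k free_alg set \<Rightarrow>\<^sub>0 'k) \<Rightarrow> ('a \<times> 'b \<Rightarrow>\<^sub>0 'k) \<Rightarrow> ('a \<times> 'b \<Rightarrow>\<^sub>0 'k)"
  where "tlext M M' s t =
    lext (\<lambda>(a, b). lext (\<lambda>(x, y). Poly_Mapping.single (a \<odot>\<^bsub>M\<^esub> x, b \<odot>\<^bsub>M'\<^esub> y) 1) t) s"

lemma tlext_eq:
  "(\<Sum>(a, b)\<in>Poly_Mapping.keys s. \<Sum>(x, y)\<in>Poly_Mapping.keys t.
      Poly_Mapping.single (a \<odot>\<^bsub>M\<^esub> x, b \<odot>\<^bsub>M'\<^esub> y)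
        (Poly_Mapping.lookup s (a, b) * Poly_Mapping.lookup t (x, y))) = tlext M M' s t"
  by (simp add: tlext_def lext_def scl_sum_right case_prod_beta)

lemma
  shows tlext_add_left: "tlext M M' (s + s') t = tlext M M' s t + tlext M M' s' t"
    and tlext_diff_left: "tlext M M' (s - s') t = tlext M M' s t - tlext M M' s' t"
    and tlext_scl_left: "tlext M M' (scl c s) t = scl c (tlext M M' s t)"
  by (simp_all add: tlext_def lext_add lext_diff lext_scl)

lemma tlext_diff_right: "tlext M M' s (t - t') = tlext M M' s t - tlext M M' s t'"
  unfolding tlext_def lext_fun_diff[symmetric] by (intro lext_cong) (auto simp: lext_diff)

lemma tlext_scl_right: "tlext M M' s (scl c t) = scl c (tlext M M' s t)"
  unfolding tlext_def lext_fun_scl[symmetric] by (intro lext_cong) (auto simp: lext_scl)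

lemma tlext_add_right: "tlext M M' s (t + t') = tlext M M' s t + tlext M M' s t'"
  using tlext_diff_right[of M M' s "t + t'" t'] by (simp add: algebra_simps)

locale U_module_pair = M: U_left_module q M + M': U_left_module q M'
  for q :: "'k::field" and M :: "('k, 'a) U_module" (structure) and M' :: "('k, 'b) U_module" (structure)
begin

sublocale U_rep_M: U_rep "space_of_module q M" "gen_act q M" q by (rule M.U_rep_gen_act)
sublocale U_rep_M': U_rep "space_of_module q M'" "gen_act q M'" q by (rule M'.U_rep_gen_act)
sublocale UR: U_left_module q "U_regular q" by (rule U_regular_left_module)

sublocale tensor_pair "space_of_module q M" "space_of_module q M'"
  by unfold_locales

sublocale UU: tensor_pair "space_of_module q (U_regular q)" "space_of_module q (U_regular q)"
  using UR.kspace by (simp add: tensor_pair_def)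

abbreviation "tact \<equiv> tensor_act q M M'"

text \<open>For fixed \<open>a\<close> and \<open>b\<close> the map \<open>x \<otimes> y \<mapsto> ax \<otimes> by\<close> is well defined, as \<open>a\<close> and \<open>b\<close> act linearly.\<close>

lemma lext_pair_N:
  assumes a: "a \<in> carrier (U q)" "b \<in> carrier (U q)" and t: "t \<in> N"
  shows "lext (\<lambda>(x, y). Poly_Mapping.single (a \<odot>\<^bsub>M\<^esub> x, b \<odot>\<^bsub>M'\<^esub> y) (1::'k)) t \<in> N"
proof -
  from a obtain a' b' where ab: "a = U_class q a'" "b = U_class q b'" by (auto elim!: U_carrierE)
  have c: "U_class q a' \<odot>\<^bsub>M\<^esub> (U_class q (const c) \<odot>\<^bsub>M\<^esub> x) = U_class q (const c) \<odot>\<^bsub>M\<^esub> (U_class q a' \<odot>\<^bsub>M\<^esub> x)"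
    if "x \<in> carrier M" for x c
    using that by (simp add: M.sm_class_mult[symmetric] const_commute)
  have c': "U_class q b' \<odot>\<^bsub>M'\<^esub> (U_class q (const c) \<odot>\<^bsub>M'\<^esub> x) = U_class q (const c) \<odot>\<^bsub>M'\<^esub> (U_class q b' \<odot>\<^bsub>M'\<^esub> x)"
    if "x \<in> carrier M'" for x c
    using that by (simp add: M'.sm_class_mult[symmetric] const_commute)
  show ?thesis
    unfolding ab
    using N_add_left N_add_right N_sm_left N_sm_right
    by (intro N_lext[OF t N_subspace]) (simp_all add: c c' M.sm_class_right M'.sm_class_right)
qed

lemma keys_tlext:
  assumes "Poly_Mapping.keys s \<subseteq> UU.S" "Poly_Mapping.keys t \<subseteq> S"
  shows "Poly_Mapping.keys (tlext M M' s t) \<subseteq> S"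
  unfolding tlext_def
proof (rule keys_lext)
  fix z assume "z \<in> Poly_Mapping.keys s"
  then obtain a b where z: "z = (a, b)" "(a, b) \<in> Poly_Mapping.keys s" by (cases z) auto
  then have ab: "a \<in> carrier (U q)" "b \<in> carrier (U q)" using assms(1) z(2) by auto
  show "Poly_Mapping.keys (case z of (a, b) \<Rightarrow>
      lext (\<lambda>(x, y). Poly_Mapping.single (a \<odot>\<^bsub>M\<^esub> x, b \<odot>\<^bsub>M'\<^esub> y) (1::'k)) t) \<subseteq> S"
    unfolding z(1) prod.case
  proof (rule keys_lext)
    fix z assume "z \<in> Poly_Mapping.keys t"
    then obtain x y where "z = (x, y)" "x \<in> carrier M" "y \<in> carrier M'" using assms(2) by auto
    then show "Poly_Mapping.keys (case z of (x, y) \<Rightarrow>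
        Poly_Mapping.single (a \<odot>\<^bsub>M\<^esub> x, b \<odot>\<^bsub>M'\<^esub> y) (1::'k)) \<subseteq> S"
      using ab by (simp add: M.smult_closed M'.smult_closed)
  qed
qed

lemma tlext_N_right:
  assumes "Poly_Mapping.keys s \<subseteq> UU.S" "t \<in> N"
  shows "tlext M M' s t \<in> N"
  unfolding tlext_def
  using assms by (intro lext_in_subspace[OF N_subspace]) (auto intro!: lext_pair_N)

lemma tlext_N_left:
  assumes s: "s \<in> UU.N" and t: "Poly_Mapping.keys t \<subseteq> S"
  shows "tlext M M' s t \<in> N"
  unfolding tlext_def
proof -
  have mem: "a \<in> carrier M" "b \<in> carrier M'" if "(a, b) \<in> Poly_Mapping.keys t" for a b
    using t that by auto
  show "lext (\<lambda>(a, b). lext (\<lambda>(x, y). Poly_Mapping.single (a \<odot>\<^bsub>M\<^esub> x, b \<odot>\<^bsub>M'\<^esub> y) 1) t) s \<in> N"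
  proof (rule UU.N_lext[OF s N_subspace]; (unfold prod.case lext_fun_diff[symmetric] lext_fun_scl[symmetric])?;
    rule lext_in_subspace[OF N_subspace]; clarify)
qed (simp_all add: mem M.smult_l_distr M'.smult_l_distr M.smult_assoc1 M'.smult_assoc1
    N_add_left[simplified] N_add_right[simplified] N_sm_left[simplified] N_sm_right[simplified]
    M.smult_closed M'.smult_closed)
qed

lemma tact_cls:
  assumes s: "Poly_Mapping.keys s \<subseteq> UU.S" and t: "Poly_Mapping.keys t \<subseteq> S"
  shows "tact (UU.cls s) (cls t) = cls (tlext M M' s t)"
proof -
  have eq: "cls (tlext M M' s' t') = cls (tlext M M' s t)" if "s' \<in> UU.cls s" "t' \<in> cls t" for s' t'
  proof -
    from that have "UU.cls s' = UU.cls s" "cls t' = cls t" using UU.cls_memD cls_memD by auto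
    then have N: "s' - s \<in> UU.N" "t' - t \<in> N" by (simp_all add: UU.cls_eq_iff cls_eq_iff)
    have "t' = (t' - t) + t" by simp
    then have t': "Poly_Mapping.keys t' \<subseteq> S"
      using keys_add_subset[OF N_keys[OF N(2)] t] by metis
    have "tlext M M' s' t' - tlext M M' s t = tlext M M' (s' - s) t' + tlext M M' s (t' - t)"
      by (simp add: tlext_diff_left tlext_diff_right)
    also have "\<dots> \<in> N"
      using N_add[OF tlext_N_left[OF N(1) t'] tlext_N_right[OF s N(2)]] .
    finally show ?thesis by (simp add: cls_eq_iff)
  qed
  have "tact (UU.cls s) (cls t) = (\<Union>s'\<in>UU.cls s. \<Union>t'\<in>cls t. cls (tlext M M' s' t'))"
    by (simp add: tensor_act_def tlext_eq)
  also have "\<dots> = (\<Union>s'\<in>UU.cls s. \<Union>t'\<in>cls t. cls (tlext M M' s t))"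
    \<comment> \<open>All choices of representatives lead to the same class, so the union is over equal sets.\<close>
    by (intro SUP_cong refl eq)
  also have "\<dots> = cls (tlext M M' s t)"
    using UU.self_in_cls[of s] self_in_cls[of t] by blast
  finally show ?thesis .
qed

lemma tact_kmap_right:
  assumes "u \<in> carrier UU.T"
  shows "kmap T T (tact u)"
  using assms unfolding kmap_def
  by (auto elim!: UU.T_carrierE T_carrierE
      simp: tact_cls keys_add_subset keys_scl_subset tlext_add_right tlext_scl_right cls_in_T[simplified] keys_tlext[simplified])

lemma tact_kmap_left:
  assumes "t \<in> carrier T"
  shows "kmap UU.T T (\<lambda>u. tact u t)"
  using assms unfolding kmap_def
  by (auto elim!: UU.T_carrierE T_carrierE
      simp: tact_cls keys_add_subset keys_scl_subset tlext_add_left tlext_scl_left cls_in_T[simplified] keys_tlext[simplified])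

lemma tact_pure:
  assumes "a \<in> carrier (U q)" "b \<in> carrier (U q)" "x \<in> carrier M" "y \<in> carrier M'"
  shows "tact (UU.pure a b) (pure x y) = pure (a \<odot>\<^bsub>M\<^esub> x) (b \<odot>\<^bsub>M'\<^esub> y)"
  using assms by (simp add: pure_conv UU.pure_conv tact_cls tlext_def)

text \<open>Both sides are linear in each of the three tensors, so the identity reduces to
\<open>(aa')x \<otimes> (bb')y = a(a'x) \<otimes> b(b'y)\<close>.\<close>

lemma tact_UU_mult:
  assumes "u \<in> carrier UU.T" "u' \<in> carrier UU.T" "t \<in> carrier T"
  shows "tact (UU_mult q u u') t = tact u (tact u' t)"
proof -
  interpret R: U_module_pair q "U_regular q" "U_regular q"
    using U_regular_left_module by (simp add: U_module_pair_def)
  note lin = kmapD[OF tact_kmap_right] kmapD[OF tact_kmap_left] kmapD[OF R.tact_kmap_right] kmapD[OF R.tact_kmap_left]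
  show ?thesis
    using assms(3)
  proof (induction rule: T_induct)
    case (pure x y)
    show ?case
      using assms(2)
    proof (induction rule: UU.T_induct)
      case (pure a' b')
      show ?case
        using assms(1)
      proof (induction rule: UU.T_induct)
        case (pure a b)
        then show ?case
          using \<open>x \<in> _\<close> \<open>y \<in> _\<close> \<open>a' \<in> _\<close> \<open>b' \<in> _\<close>
          by (simp add: R.tact_pure tact_pure M.smult_closed M'.smult_closed M.R.m_closed
              M.smult_assoc1 M'.smult_assoc1)
      qed (use \<open>x \<in> _\<close> \<open>y \<in> _\<close> \<open>a' \<in> _\<close> \<open>b' \<in> _\<close> in \<open>simp_all add: lin\<close>)
    qed (use assms(1) \<open>x \<in> _\<close> \<open>y \<in> _\<close> in \<open>simp_all add: lin\<close>)
  qed (use assms(1,2) in \<open>simp_all add: lin\<close>)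
qed

abbreviation "Delta_op x \<equiv> tact (coproduct_gen q x)"

lemma coproduct_gen_in: "coproduct_gen q x \<in> carrier UU.T"
  by (cases x) simp_all

lemma Delta_op_pure:
  assumes "a \<in> carrier M" "b \<in> carrier M'"
  shows "Delta_op gE (pure a b) =
      pure (gen_act q M ghi a) (gen_act q M' gE b) \<oplus>\<^bsub>T\<^esub> pure (gen_act q M gE a) (gen_act q M' gh (gen_act q M' gK b))"
    and "Delta_op gF (pure a b) =
      pure (gen_act q M gKi (gen_act q M gh (gen_act q M gg (gen_act q M gg a)))) (gen_act q M' gF b) \<oplus>\<^bsub>T\<^esub>
      pure (gen_act q M gF a) (gen_act q M' ghi b)"
    and "x \<noteq> gE \<Longrightarrow> x \<noteq> gF \<Longrightarrow> Delta_op x (pure a b) = pure (gen_act q M x a) (gen_act q M' x b)"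
proof -
  have lin: "tact (u \<oplus>\<^bsub>UU.T\<^esub> u') (pure a b) = tact u (pure a b) \<oplus>\<^bsub>T\<^esub> tact u' (pure a b)"
    if "u \<in> carrier UU.T" "u' \<in> carrier UU.T" for u u'
    using kmapD(2)[OF tact_kmap_left, of "pure a b" u u'] that assms by simp
  note * = assms lin tact_pure M.U_mon_Cons M'.U_mon_Cons
  show "Delta_op gE (pure a b) =
      pure (gen_act q M ghi a) (gen_act q M' gE b) \<oplus>\<^bsub>T\<^esub> pure (gen_act q M gE a) (gen_act q M' gh (gen_act q M' gK b))"
    by (simp add: *)
  show "Delta_op gF (pure a b) =
      pure (gen_act q M gKi (gen_act q M gh (gen_act q M gg (gen_act q M gg a)))) (gen_act q M' gF b) \<oplus>\<^bsub>T\<^esub>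
      pure (gen_act q M gF a) (gen_act q M' ghi b)"
    by (simp add: *)
  show "Delta_op x (pure a b) = pure (gen_act q M x a) (gen_act q M' x b)" if "x \<noteq> gE" "x \<noteq> gF"
    using that by (cases x) (simp_all add: *)
qed

declare coproduct_gen.simps [simp del]

lemma U_rep_Delta:
  assumes "q \<noteq> 0"
  shows "U_rep T Delta_op q"
proof -
  interpret P: U_rep_pair "space_of_module q M" "space_of_module q M'" "gen_act q M" "gen_act q M'" q
    by unfold_locales (rule assms)
  show ?thesis
    by (rule P.U_rep_tensor) (use Delta_op_pure coproduct_gen_in tact_kmap_right in simp_all)
qed

lemma tact_one:
  assumes "t \<in> carrier T"
  shows "tact (UU_pure q \<one>\<^bsub>U q\<^esub> \<one>\<^bsub>U q\<^esub>) t = t"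
  using assms
proof (induction rule: T_induct)
  case (pure x y)
  then show ?case by (simp add: tact_pure M.smult_one M'.smult_one)
qed (simp_all add: kmapD[OF tact_kmap_right])

text \<open>For fixed \<open>t\<close> the map sending a tensor \<open>s\<close> over \<open>U q\<close> to \<open>s t\<close> is linear and intertwines
multiplication by the coproduct of a generator with the operator of that generator. Hence it
intertwines the actions of \<open>U q\<close> defined by these operators, and it sends \<open>1 \<otimes> 1\<close> to \<open>t\<close>.\<close>

lemma tact_coproduct:
  assumes "q \<noteq> 0" "u \<in> carrier (U q)" "t \<in> carrier T"
  shows "tact (coproduct q u) t = U_act T Delta_op u t"
proof -
  interpret R: U_module_pair q "U_regular q" "U_regular q"
    using U_regular_left_module by (simp add: U_module_pair_def)
  have "tact (U_act UU.T R.Delta_op u (UU_pure q \<one>\<^bsub>U q\<^esub> \<one>\<^bsub>U q\<^esub>)) t =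
      U_act T Delta_op u (tact (UU_pure q \<one>\<^bsub>U q\<^esub> \<one>\<^bsub>U q\<^esub>) t)"
    using U_act_intertwines[OF R.U_rep_Delta U_rep_Delta tact_kmap_left[OF assms(3)], OF assms(1) assms(1) _ _ assms(2)]
      tact_UU_mult[OF coproduct_gen_in _ assms(3)] by simp
  then show ?thesis using assms(3) by (simp add: coproduct_def tact_one)
qed

lemma left_module_tensor_module:
  assumes "q \<noteq> 0"
  shows "left_module (U q) (tensor_module q M M')"
    and "carrier (tensor_module q M M') = carrier T"
    and "add (tensor_module q M M') = add T"
    and "u \<in> carrier (U q) \<Longrightarrow> t \<in> carrier T \<Longrightarrow> u \<odot>\<^bsub>tensor_module q M M'\<^esub> t = U_act T Delta_op u t"
proof -
  interpret D: U_rep T Delta_op q using assms by (rule U_rep_Delta)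
  show "left_module (U q) (tensor_module q M M')"
    using D.module_of_space_left_module
    by (rule left_module_cong) (simp_all add: tensor_module_def module_of_space_def tact_coproduct assms)
qed (simp_all add: tensor_module_def module_of_space_def tact_coproduct assms)

end

section \<open>The simple modules\<close>

context
  fixes q :: "'k::field"
  assumes q_nz: "q \<noteq> 0" and q_sq: "q\<^sup>2 \<noteq> 1"
begin

lemma q_diff_nz: "q - inverse q \<noteq> 0"
  using q_nz q_sq by (auto simp: field_simps power2_eq_square)

lemma qint_0 [simp]: "qint q 0 = 0"
  by (simp add: qint_def)

lemma qint_1 [simp]: "qint q (Suc 0) = 1"
  using q_diff_nz by (simp add: qint_def)

lemma qint_nonzero:
  assumes "\<And>r. r > 0 \<Longrightarrow> q ^ r \<noteq> 1" "m > 0"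
  shows "qint q m \<noteq> 0"
proof
  assume "qint q m = 0"
  then have "q ^ m = inverse q ^ m" using q_diff_nz by (simp add: qint_def)
  then have "q ^ m * q ^ m = 1" using q_nz by (metis power_inverse right_inverse power_not_zero)
  then show False using assms(1)[of "m + m"] assms(2) by (simp add: power_add)
qed

text \<open>For \<open>p + r = n\<close> this is the identity \<open>[p + 1][n - p] - [n - p + 1][p] = [n - 2p]\<close> behind the
commutator relation on the basis vector \<open>v\<^sub>p\<close>; division replaces the possibly negative exponent.\<close>

lemma qint_commutator:
  "qint q (Suc p) * qint q r - qint q (Suc r) * qint q p = (q ^ r / q ^ p - q ^ p / q ^ r) / (q - inverse q)"
proof -
  define x y where "x = q ^ p" and "y = q ^ r"
  have nz: "x \<noteq> 0" "y \<noteq> 0" using q_nz by (auto simp: x_def y_def)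
  define d where "d = q - inverse q"
  have d: "d \<noteq> 0" using q_diff_nz by (simp add: d_def)
  have "(q * x - inverse (q * x)) * (y - inverse y) - (q * y - inverse (q * y)) * (x - inverse x)
      = (q - inverse q) * (y / x - x / y)"
    using nz q_nz by (simp add: field_simps)
  moreover have "a / d * (b / d) - a' / d * (b' / d) = (a * b - a' * b') / (d * d)" for a b a' b'
    by (simp add: diff_divide_distrib)
  ultimately have "(q * x - inverse (q * x)) / d * ((y - inverse y) / d) - (q * y - inverse (q * y)) / d * ((x - inverse x) / d)
      = (y / x - x / y) / d"
    using d by (simp add: d_def[symmetric])
  then show ?thesis
    by (simp add: qint_def x_def y_def d_def power_inverse)
qed

lemma U_rep_V:
  assumes "\<epsilon> * \<epsilon> = 1" "\<alpha> \<noteq> 0" "\<beta> \<noteq> 0"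
  shows "U_rep (free_space {..n}) (V_op q \<epsilon> n \<alpha> \<beta>) q"
proof -
  let ?B = "free_space {..n} :: ('k, nat \<Rightarrow>\<^sub>0 'k) module"
  have op: "V_op q \<epsilon> n \<alpha> \<beta> x = lext (V_gen q \<epsilon> n \<alpha> \<beta> x)" for x
    by (simp add: V_op_def lext_def fun_eq_iff)
  have gen_keys: "Poly_Mapping.keys (V_gen q \<epsilon> n \<alpha> \<beta> x p) \<subseteq> {..n}" if "p \<le> n" for x p
    using that by (cases x) (auto split: if_splits)
  interpret B: kspace ?B by (rule kspace_free_space)
  interpret kops ?B "V_op q \<epsilon> n \<alpha> \<beta>"
  proof unfold_locales
    fix x
    have "Poly_Mapping.keys (lext (V_gen q \<epsilon> n \<alpha> \<beta> x) v) \<subseteq> {..n}" if "Poly_Mapping.keys v \<subseteq> {..n}" for v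
      using that by (intro keys_lext gen_keys) auto
    then show "kmap ?B ?B (V_op q \<epsilon> n \<alpha> \<beta> x)"
      by (simp add: kmap_def op lext_add lext_scl)
  qed
  have \<epsilon>: "\<epsilon> \<noteq> 0" using assms(1) by auto
  note nz = \<epsilon> assms(2,3) q_nz
  have KE: "q powi (int n - 2 * int (p - 1)) = q powi (int n - 2 * int p) * q\<^sup>2" if "p > 0" for p
  proof -
    have *: "int n - 2 * int (p - 1) = (int n - 2 * int p) + 2" using that by simp
    show ?thesis unfolding * using q_nz by (subst power_int_add) simp_all
  qed
  have KF: "q powi (int n - 2 * int (p + 1)) = q powi (int n - 2 * int p) * inverse (q\<^sup>2)" for p
  proof -
    have *: "int n - 2 * int (p + 1) = (int n - 2 * int p) - 2" by simp
    show ?thesis unfolding * using q_nz by (subst power_int_diff) (simp_all add: divide_inverse)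
  qed
  have K: "q powi (int n - 2 * int p) = q ^ (n - p) / q ^ p" if "p \<le> n" for p
  proof -
    have *: "int n - 2 * int p = int (n - p) - int p" using that by simp
    show ?thesis unfolding * using q_nz by (subst power_int_diff) simp_all
  qed
  show ?thesis
  proof (unfold_locales, goal_cases)
    \<comment> \<open>Conjugation of \<open>E\<close> by \<open>K\<close>.\<close>
    case (14 v)
    then have "Poly_Mapping.keys v \<subseteq> {..n}" by simp
    then show ?case
    proof (induction rule: poly_mapping_lin_induct)
      case (single p c)
      have "\<epsilon> * \<alpha> * (k * q\<^sup>2) * ((\<epsilon> * \<alpha> * r) * (inverse (\<epsilon> * \<alpha> * k) * c)) = q\<^sup>2 * (\<epsilon> * \<alpha> * r * c)"
        if "k \<noteq> 0" for k r using that nz by (simp add: field_simps)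
      note * = this[of "q powi (int n - 2 * int p)"]
      have "V_op q \<epsilon> n \<alpha> \<beta> gK (V_op q \<epsilon> n \<alpha> \<beta> gE (V_op q \<epsilon> n \<alpha> \<beta> gKi (Poly_Mapping.single p c))) =
        Poly_Mapping.single (p - 1) (\<epsilon> * \<alpha> * q powi (int n - 2 * int (p - 1)) *
          ((\<epsilon> * \<alpha> * qint q (n - p + 1)) * (inverse (\<epsilon> * \<alpha> * q powi (int n - 2 * int p)) * c)))"
        if "p > 0" using that by (simp add: op mult_ac)
      also have "\<dots> = Poly_Mapping.single (p - 1) (q\<^sup>2 * (\<epsilon> * \<alpha> * qint q (n - p + 1) * c))" if "p > 0"
        unfolding KE[OF that] by (subst *) (simp_all add: q_nz)
      finally show ?case by (cases "p = 0") (simp_all add: op mult_ac)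
    qed (simp_all add: op lext_add scl_add_right)
  next
    \<comment> \<open>Conjugation of \<open>F\<close> by \<open>K\<close>.\<close>
    case (15 v)
    then have "Poly_Mapping.keys v \<subseteq> {..n}" by simp
    then show ?case
    proof (induction rule: poly_mapping_lin_induct)
      case (single p c)
      have "\<epsilon> * \<alpha> * (k * inverse (q\<^sup>2)) * (r * (inverse (\<epsilon> * \<alpha> * k) * c)) = inverse (q\<^sup>2) * (r * c)"
        if "k \<noteq> 0" for k r using that nz by (simp add: field_simps)
      note * = this[of "q powi (int n - 2 * int p)"]
      have "V_op q \<epsilon> n \<alpha> \<beta> gK (V_op q \<epsilon> n \<alpha> \<beta> gF (V_op q \<epsilon> n \<alpha> \<beta> gKi (Poly_Mapping.single p c))) =
        Poly_Mapping.single (p + 1) (\<epsilon> * \<alpha> * q powi (int n - 2 * int (p + 1)) *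
          (qint q (p + 1) * (inverse (\<epsilon> * \<alpha> * q powi (int n - 2 * int p)) * c)))"
        if "p < n" using that by (simp add: op mult_ac)
      also have "\<dots> = Poly_Mapping.single (p + 1) (inverse (q\<^sup>2) * (qint q (p + 1) * c))"
        unfolding KF by (subst *) (simp_all add: q_nz)
      finally show ?case by (cases "p < n") (simp_all add: op mult_ac)
    qed (simp_all add: op lext_add scl_add_right)
  next
    \<comment> \<open>The commutator relation. Both products are written uniformly in \<open>p\<close>: at the two ends of
      the chain of basis vectors the missing term is accounted for by \<open>[0] = 0\<close>.\<close>
    case (16 v)
    then have "Poly_Mapping.keys v \<subseteq> {..n}" by simp
    then show ?case
    proof (induction rule: poly_mapping_lin_induct)
      case (single p c)
      then have p: "p \<le> n" by simp
      let ?\<kappa> = "q ^ (n - p) / q ^ p"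
      have FE: "V_op q \<epsilon> n \<alpha> \<beta> gF (V_op q \<epsilon> n \<alpha> \<beta> gE (Poly_Mapping.single p c)) =
          Poly_Mapping.single p (c * (\<epsilon> * \<alpha> * (qint q (Suc (n - p)) * qint q p)))"
        using p by (cases p) (simp_all add: op Suc_diff_Suc algebra_simps)
      have EF: "V_op q \<epsilon> n \<alpha> \<beta> gE (V_op q \<epsilon> n \<alpha> \<beta> gF (Poly_Mapping.single p c)) =
          Poly_Mapping.single p (c * (\<epsilon> * \<alpha> * (qint q (Suc p) * qint q (n - p))))"
        using p by (cases "p = n") (simp_all add: op Suc_diff_Suc algebra_simps)
      have inv_\<epsilon>: "inverse \<epsilon> = \<epsilon>"
        using assms(1) by (simp add: inverse_unique)
      have "qint q (Suc p) * qint q (n - p) = qint q (Suc (n - p)) * qint q p +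
          (?\<kappa> - inverse ?\<kappa>) / (q - inverse q)"
        using qint_commutator[of p "n - p"] by (simp add: algebra_simps)
      moreover have "c * (e * (b + (k - k') / d)) = c * (e * b) + inverse d * (e * k * c - e * k' * c)"
        for e b k k' d :: 'k
        by (simp add: divide_inverse algebra_simps)
      ultimately have "c * (\<epsilon> * \<alpha> * (qint q (Suc p) * qint q (n - p))) =
          c * (\<epsilon> * \<alpha> * (qint q (Suc (n - p)) * qint q p)) +
          inverse (q - inverse q) * (\<epsilon> * \<alpha> * ?\<kappa> * c - \<epsilon> * \<alpha> * inverse ?\<kappa> * c)"
        by presburger
      moreover have "V_op q \<epsilon> n \<alpha> \<beta> gK (Poly_Mapping.single p c) = Poly_Mapping.single p (\<epsilon> * \<alpha> * ?\<kappa> * c)"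
        using p by (simp add: op K) (simp add: mult_ac)
      moreover have "V_op q \<epsilon> n \<alpha> \<beta> gKi (V_op q \<epsilon> n \<alpha> \<beta> gg (V_op q \<epsilon> n \<alpha> \<beta> gg (Poly_Mapping.single p c))) =
          Poly_Mapping.single p (\<epsilon> * \<alpha> * inverse ?\<kappa> * c)"
        using p nz by (simp add: op K) (simp add: divide_inverse inv_\<epsilon> mult_ac)
      ultimately show ?case
        unfolding EF FE by (simp flip: single_add single_diff)
    qed (simp_all add: op lext_add scl_add_right scl_diff_right algebra_simps)
  qed (simp, erule poly_mapping_lin_induct;
      simp add: op lext_add scl_add_right nz KE KF field_simps assms)+
qed

end

lemma V_simps [simp]:
  "carrier (V q \<epsilon> n \<alpha> \<beta>) = {f. Poly_Mapping.keys f \<subseteq> {..n}}"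
  "ring.zero (V q \<epsilon> n \<alpha> \<beta>) = 0"
  "add (V q \<epsilon> n \<alpha> \<beta>) = (+)"
  "module.smult (V q \<epsilon> n \<alpha> \<beta>) = U_act (free_space {..n}) (V_op q \<epsilon> n \<alpha> \<beta>)"
  by (simp_all add: V_def module_of_space_def)

lemma V_left_module:
  assumes "q \<noteq> 0" "q\<^sup>2 \<noteq> 1" "\<epsilon> * \<epsilon> = 1" "\<alpha> \<noteq> 0" "\<beta> \<noteq> 0"
  shows "U_left_module q (V q \<epsilon> n \<alpha> \<beta>)"
  using U_rep.module_of_space_left_module[OF U_rep_V[OF assms]]
  by (simp add: V_def U_left_module_def)

lemma V_act:
  assumes "q \<noteq> 0" "q\<^sup>2 \<noteq> 1" "\<epsilon> * \<epsilon> = 1" "\<alpha> \<noteq> 0" "\<beta> \<noteq> 0" "Poly_Mapping.keys f \<subseteq> {..n}"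
  shows "U_act (free_space {..n}) (V_op q \<epsilon> n \<alpha> \<beta>) (U_mon q [x]) f = lext (V_gen q \<epsilon> n \<alpha> \<beta> x) f"
    and "U_act (free_space {..n}) (V_op q \<epsilon> n \<alpha> \<beta>) (U_class q (const c)) f = scl c f"
proof -
  interpret U_rep "free_space {..n}" "V_op q \<epsilon> n \<alpha> \<beta>" q by (rule U_rep_V[OF assms(1-5)])
  show "U_act (free_space {..n}) (V_op q \<epsilon> n \<alpha> \<beta>) (U_mon q [x]) f = lext (V_gen q \<epsilon> n \<alpha> \<beta> x) f"
    using assms(6) by (simp add: V_op_def lext_def)
  show "U_act (free_space {..n}) (V_op q \<epsilon> n \<alpha> \<beta>) (U_class q (const c)) f = scl c f"
    using assms(6) by (simp add: act_const)
qed

lemma lookup_V_op_E: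
  fixes q :: "'k::field"
  shows "Poly_Mapping.lookup (V_op q \<epsilon> n \<alpha> \<beta> gE f) p =
    \<epsilon> * \<alpha> * qint q (n - Suc p + 1) * Poly_Mapping.lookup f (Suc p)"
proof -
  have op: "V_op q \<epsilon> n \<alpha> \<beta> gE = lext (V_gen q \<epsilon> n \<alpha> \<beta> gE)"
    by (simp add: V_op_def lext_def fun_eq_iff)
  have "Poly_Mapping.keys f \<subseteq> UNIV" by simp
  then show ?thesis
    unfolding op
  proof (induction rule: poly_mapping_lin_induct)
    case (add f f')
    then show ?case by (simp add: lext_add lookup_add distrib_left)
  next
    case (single r c)
    show ?case by (cases r) (auto simp: lookup_single when_def)
  qed simp
qed

section \<open>Highest weight vectors\<close>

locale highest_weight = U_rep B op q
  for B :: "('k::field, 'b) module" (structure) and op :: "gen \<Rightarrow> 'b \<Rightarrow> 'b" and q :: 'k +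
  fixes w :: 'b and \<kappa> \<gamma> \<eta> :: 'k
  assumes q_not_root: "r > 0 \<Longrightarrow> q ^ r \<noteq> 1" and q_nz: "q \<noteq> 0"
    and w_in [simp]: "w \<in> carrier B"
    and E_w: "op gE w = \<zero>"
    and K_w: "op gK w = \<kappa> \<odot> w" and g_w: "op gg w = \<gamma> \<odot> w" and h_w: "op gh w = \<eta> \<odot> w"
    and weight_nz: "\<kappa> \<noteq> 0" "\<gamma> \<noteq> 0" "\<eta> \<noteq> 0"
begin

definition Fpow :: "nat \<Rightarrow> 'b"
  where "Fpow p = (op gF ^^ p) w"

lemma Fpow_0 [simp]: "Fpow 0 = w"
  and Fpow_Suc: "Fpow (Suc p) = op gF (Fpow p)"
  by (simp_all add: Fpow_def)

lemma Fpow_in [simp]: "Fpow p \<in> carrier B"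
  by (induction p) (simp_all add: Fpow_Suc)

lemma q_sq: "q\<^sup>2 \<noteq> 1"
  using q_not_root[of 2] by simp

lemma qint_nz: "m > 0 \<Longrightarrow> qint q m \<noteq> 0"
  by (rule qint_nonzero[OF q_nz q_sq q_not_root])

lemma K_Fpow: "op gK (Fpow p) = (\<kappa> / q ^ (2 * p)) \<odot> Fpow p"
proof (induction p)
  case (Suc p)
  then show ?case
    by (simp add: Fpow_Suc K_F q_nz op_sm power_add power2_eq_square field_simps)
qed (simp add: K_w)

lemma g_Fpow: "op gg (Fpow p) = \<gamma> \<odot> Fpow p"
  by (induction p) (simp_all add: Fpow_Suc g_F op_sm g_w)

lemma h_Fpow: "op gh (Fpow p) = \<eta> \<odot> Fpow p"
  by (induction p) (simp_all add: Fpow_Suc h_F op_sm h_w)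

lemma inverse_eigenvector:
  assumes "op y v = c \<odot> v" "c \<noteq> 0" "v \<in> carrier B" "op y' (op y v) = v"
  shows "op y' v = inverse c \<odot> v"
proof -
  have "inverse c \<odot> op y' (op y v) = op y' v" using assms(1-3) by (simp add: op_sm)
  then show ?thesis using assms(4) by simp
qed

lemma Ki_Fpow: "op gKi (Fpow p) = (q ^ (2 * p) / \<kappa>) \<odot> Fpow p"
  using inverse_eigenvector[OF K_Fpow] weight_nz q_nz by (simp add: Ki_K)

lemma gi_Fpow: "op ggi (Fpow p) = inverse \<gamma> \<odot> Fpow p"
  using inverse_eigenvector[OF g_Fpow] weight_nz by (simp add: gi_g)

lemma hi_Fpow: "op ghi (Fpow p) = inverse \<eta> \<odot> Fpow p"
  using inverse_eigenvector[OF h_Fpow] weight_nz by (simp add: hi_h)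

text \<open>Induction on \<open>p\<close>: moving \<open>E\<close> past one more \<open>F\<close> adds the eigenvalue of
\<open>(K - K\<inverse>g\<^sup>2)/(q - q\<inverse>)\<close> on \<open>F\<^sup>p\<^sup>+\<^sup>1 w\<close> to the coefficient, and
\<open>[p + 1] q\<^sup>-\<^sup>p + q\<^sup>-\<^sup>2\<^sup>p\<^sup>-\<^sup>2 = [p + 2] q\<^sup>-\<^sup>p\<^sup>-\<^sup>1\<close> sums the result.\<close>

lemma E_Fpow:
  "op gE (Fpow (Suc p)) =
    (qint q (Suc p) * (\<kappa> / q ^ p - \<gamma>\<^sup>2 / \<kappa> * q ^ p) / (q - inverse q)) \<odot> Fpow p"
proof (induction p)
  case 0
  show ?case
    using q_diff_nz[OF q_nz q_sq] E_F[OF w_in] E_w K_w g_w Ki_Fpow[of 0] weight_nz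
    by (simp add: Fpow_Suc op_sm qint_1[OF q_nz q_sq] sm_add_left[symmetric] sm_add_right divide_inverse power2_eq_square algebra_simps)
next
  case (Suc p)
  let ?d = "q - inverse q"
  let ?c = "qint q (Suc p) * (\<kappa> / q ^ p - \<gamma>\<^sup>2 / \<kappa> * q ^ p) / ?d"
  let ?x = "Fpow (Suc p)"
  have "op gE (op gF ?x) = ?c \<odot> ?x \<oplus>
      inverse ?d \<odot> ((\<kappa> / q ^ (2 * Suc p)) \<odot> ?x \<oplus> (- 1) \<odot> ((\<gamma> * \<gamma> * (q ^ (2 * Suc p) / \<kappa>)) \<odot> ?x))"
    using E_F[OF Fpow_in, of "Suc p"] Suc.IH
    by (simp add: op_sm K_Fpow g_Fpow Ki_Fpow Fpow_Suc[of p, symmetric])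
  also have "\<dots> = (?c + inverse ?d * (\<kappa> / q ^ (2 * Suc p) - \<gamma> * \<gamma> * (q ^ (2 * Suc p) / \<kappa>))) \<odot> ?x"
    by (simp add: sm_add_left[symmetric] sm_add_right algebra_simps)
  also have "?c + inverse ?d * (\<kappa> / q ^ (2 * Suc p) - \<gamma> * \<gamma> * (q ^ (2 * Suc p) / \<kappa>)) =
      qint q (Suc (Suc p)) * (\<kappa> / q ^ Suc p - \<gamma>\<^sup>2 / \<kappa> * q ^ Suc p) / ?d"
  proof -
    define x where "x = q ^ p"
    have nz: "x \<noteq> 0" "q \<noteq> 0" using q_nz by (auto simp: x_def)
    have 1: "(q * x - inverse (q * x)) * (k / x - l * x) + d * (k / (q * x) ^ 2 - l * (q * x)\<^sup>2) =
        (q * (q * x) - inverse (q * (q * x))) * (k / (q * x) - l * (q * x))"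
      if "d = q - inverse q" for k l d
      unfolding that using nz by (simp add: field_simps power2_eq_square)
    have 2: "A / ?d * C / ?d + inverse ?d * C' = A' / ?d * D / ?d" if "A * C + ?d * C' = A' * D" for A C C' A' D
    proof -
      have "A / e * C / e + inverse e * C' = (A * C + e * C') / (e * e)" if "e \<noteq> 0" for e
        using that by (simp add: field_simps)
      from this[OF q_diff_nz[OF q_nz q_sq]] show ?thesis by (simp add: that)
    qed
    have e: "q ^ (2 * Suc p) = (q * x)\<^sup>2" by (simp add: x_def power2_eq_square power_add mult_ac mult_2_right)
    show ?thesis
      unfolding qint_def e
      using 2[OF 1[OF refl, of \<kappa> "\<gamma>\<^sup>2 / \<kappa>"]] 
      by (simp add: x_def power_inverse power2_eq_square mult_ac)
  qed
  finally show ?case by (simp only: Fpow_Suc)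
qed

text \<open>When no coefficient of \<open>E_Fpow\<close> vanishes, \<open>E\<close> recovers \<open>F\<^sup>r w\<close> from \<open>F\<^sup>r\<^sup>+\<^sup>1 w\<close>, so the string of
\<open>w\<close> under \<open>F\<close> ends only if \<open>w\<close> is zero.\<close>

lemma w_eq_zero:
  assumes "Fpow r = \<zero>" and "\<And>p. \<kappa> / q ^ p \<noteq> \<gamma>\<^sup>2 / \<kappa> * q ^ p"
  shows "w = \<zero>"
  using assms(1)
proof (induction r)
  case (Suc r)
  let ?c = "qint q (Suc r) * (\<kappa> / q ^ r - \<gamma>\<^sup>2 / \<kappa> * q ^ r) / (q - inverse q)"
  have "?c \<noteq> 0" using qint_nz[of "Suc r"] assms(2)[of r] q_diff_nz[OF q_nz q_sq] by simp
  moreover have "?c \<odot> Fpow r = \<zero>" using Suc.prems E_Fpow[of r] by simp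
  ultimately have "Fpow r = \<zero>"
    using sm_sm[of "Fpow r" "inverse ?c" ?c] by simp
  then show ?case by (rule Suc.IH)
qed simp

end

text \<open>A vector with the weight of the generator of the simple module with parameters
\<open>\<epsilon>, n, \<alpha>, \<beta>\<close>, in a module on which \<open>F\<close> is nilpotent.\<close>

locale dominant_weight = highest_weight B op q w "\<epsilon> * \<alpha> * q ^ n" \<alpha> \<beta>
  for B :: "('k::field, 'b) module" (structure) and op :: "gen \<Rightarrow> 'b \<Rightarrow> 'b" and q :: 'k
    and w :: 'b and \<epsilon> \<alpha> \<beta> :: 'k and n :: nat +
  fixes R :: nat
  assumes \<epsilon>: "\<epsilon> * \<epsilon> = 1"
    and F_nilpotent: "v \<in> carrier B \<Longrightarrow> (op gF ^^ R) v = \<zero>"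
begin

lemma \<epsilon>_nz: "\<epsilon> \<noteq> 0"
  using \<epsilon> by auto

lemma E_Fpow': 
  assumes "p < Suc n"
  shows "op gE (Fpow (Suc p)) = (qint q (Suc p) * (\<epsilon> * \<alpha> * qint q (n - p))) \<odot> Fpow p"
proof -
  have 1: "\<epsilon> * \<alpha> * q ^ n / q ^ p = \<epsilon> * \<alpha> * q ^ (n - p)"
    using assms q_nz by (simp add: power_diff)
  have "\<alpha>\<^sup>2 / (\<epsilon> * \<alpha> * q ^ n) = \<epsilon> * \<alpha> / q ^ n"
    using \<epsilon> \<epsilon>_nz weight_nz(2) q_nz by (simp add: field_simps power2_eq_square)
  then have 2: "\<alpha>\<^sup>2 / (\<epsilon> * \<alpha> * q ^ n) * q ^ p = \<epsilon> * \<alpha> * inverse q ^ (n - p)"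
    using assms q_nz by (simp add: power_diff power_inverse)
  show ?thesis
    unfolding E_Fpow 1 2 by (simp add: qint_def right_diff_distrib)
qed

text \<open>The vector \<open>F\<^sup>n\<^sup>+\<^sup>1 w\<close> is again killed by \<open>E\<close>, and its \<open>K\<close>-eigenvalue is \<open>\<epsilon>\<alpha>q\<^sup>-\<^sup>n\<^sup>-\<^sup>2\<close>. For this
negative weight a coefficient of \<open>E_Fpow\<close> could vanish only if \<open>q\<close> were a root of unity.\<close>

lemma Fpow_Suc_n: "Fpow (Suc n) = \<zero>"
proof -
  let ?\<kappa> = "\<epsilon> * \<alpha> * q ^ n / q ^ (2 * Suc n)"
  interpret top: highest_weight B op q "Fpow (Suc n)" ?\<kappa> \<alpha> \<beta>
  proof unfold_locales
    show "op gE (Fpow (Suc n)) = \<zero>" using E_Fpow'[of n] qint_0[of q] by (simp add: qint_def)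
  qed (use q_not_root q_nz weight_nz K_Fpow g_Fpow h_Fpow in auto)
  show ?thesis
  proof (rule top.w_eq_zero)
    show "top.Fpow R = \<zero>" using F_nilpotent by (simp add: top.Fpow_def)
    fix p
    show "?\<kappa> / q ^ p \<noteq> \<alpha>\<^sup>2 / ?\<kappa> * q ^ p"
    proof
      assume *: "?\<kappa> / q ^ p = \<alpha>\<^sup>2 / ?\<kappa> * q ^ p"
      define z where "z = q ^ (n + 2 + p)"
      have z: "z \<noteq> 0" using q_nz by (simp add: z_def)
      have \<kappa>: "?\<kappa> = \<epsilon> * \<alpha> * q ^ p / z" using q_nz by (simp add: z_def power_add field_simps power2_eq_square mult_2_right)
      have "\<epsilon> * \<alpha> / z = \<alpha>\<^sup>2 * z / (\<epsilon> * \<alpha>)" using *[unfolded \<kappa>] q_nz z by simp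
      then have "\<epsilon> * \<epsilon> = z * z" using z weight_nz(2) \<epsilon>_nz by (simp add: field_simps power2_eq_square)
      then show False using \<epsilon> q_not_root[of "(n + 2 + p) + (n + 2 + p)"] by (simp add: z_def power_add mult_ac)
    qed
  qed
qed

definition qfact :: "nat \<Rightarrow> 'k"
  where "qfact p = (\<Prod>i<p. qint q (Suc i))"

lemma qfact_nz: "qfact p \<noteq> 0"
  using qint_nz by (simp add: qfact_def)

lemma qfact_Suc: "qfact (Suc p) = qint q (Suc p) * qfact p"
  by (simp add: qfact_def mult.commute)

definition divided_power :: "nat \<Rightarrow> 'b"
  where "divided_power p = inverse (qfact p) \<odot> Fpow p"

lemma divided_power_in [simp]: "divided_power p \<in> carrier B"
  by (simp add: divided_power_def)

lemma divided_power_0 [simp]: "divided_power 0 = w"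
  by (simp add: divided_power_def qfact_def)

text \<open>The homomorphism that sends the basis vector \<open>v\<^sub>p\<close> to \<open>F\<^sup>p w / [p]!\<close>. The denominators turn
\<open>F v\<^sub>p = [p + 1] v\<^sub>p\<^sub>+\<^sub>1\<close> into an identity.\<close>

definition V_map :: "(nat \<Rightarrow>\<^sub>0 'k) \<Rightarrow> 'b"
  where "V_map = lincomb B divided_power"

lemma V_map_kmap: "kmap (free_space {..n}) B V_map"
  by (auto simp: kmap_def V_map_def lincomb_add lincomb_scl)

lemma V_map_single: "V_map (Poly_Mapping.single p c) = c \<odot> divided_power p"
  by (simp add: V_map_def)

lemma V_map_intertwines:
  assumes "f \<in> carrier (free_space {..n})"
  shows "V_map (V_op q \<epsilon> n \<alpha> \<beta> x f) = op x (V_map f)"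
proof -
  have op: "V_op q \<epsilon> n \<alpha> \<beta> x = lext (V_gen q \<epsilon> n \<alpha> \<beta> x)"
    by (simp add: V_op_def lext_def fun_eq_iff)
  have add: "V_map (f + f') = V_map f \<oplus> V_map f'" and sm: "V_map (scl c f) = c \<odot> V_map f"
    and in_B: "V_map f \<in> carrier B" for f f' c
    by (simp_all add: V_map_def lincomb_add lincomb_scl)
  have gen: "V_map (V_gen q \<epsilon> n \<alpha> \<beta> x p) = op x (divided_power p)" if "p \<le> n" for p
  proof (cases x)
    case gE
    show ?thesis
    proof (cases p)
      case 0
      then show ?thesis by (simp add: gE E_w V_map_def)
    next
      case (Suc p')
      have "n - p + 1 = n - p'" using that Suc by simp
      then show ?thesis
        using that qfact_nz qint_nz[of "Suc p'"]
        by (simp add: gE Suc V_map_single divided_power_def op_sm E_Fpow' qfact_Suc field_simps)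
    qed
  next
    case gF
    show ?thesis
    proof (cases "p < n")
      case True
      then show ?thesis
        using qfact_nz qint_nz[of "Suc p"]
        by (simp add: gF V_map_single divided_power_def op_sm Fpow_Suc[symmetric] qfact_Suc field_simps)
    next
      \<comment> \<open>At the end of the chain, where \<open>F v\<^sub>n = 0\<close>.\<close>
      case False
      then have "op gF (Fpow p) = \<zero>" using that Fpow_Suc_n by (simp add: Fpow_Suc)
      then show ?thesis using False by (simp add: gF divided_power_def op_sm V_map_def)
    qed
  next
    case gK
    have "q powi (int n - 2 * int p) = q ^ n / q ^ (2 * p)"
      using q_nz power_int_diff[of q "int n" "int (2 * p)"]
      by (metis of_nat_mult of_nat_numeral power_int_of_nat)
    then show ?thesis by (simp add: gK V_map_single divided_power_def op_sm K_Fpow mult_ac)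
  next
    case gKi
    have "q powi (int n - 2 * int p) = q ^ n / q ^ (2 * p)"
      using q_nz power_int_diff[of q "int n" "int (2 * p)"]
      by (metis of_nat_mult of_nat_numeral power_int_of_nat)
    then show ?thesis by (simp add: gKi V_map_single divided_power_def op_sm Ki_Fpow field_simps)
  qed (simp_all add: V_map_single divided_power_def op_sm g_Fpow h_Fpow gi_Fpow hi_Fpow mult_ac)
  from assms have "Poly_Mapping.keys f \<subseteq> {..n}" by simp
  then show ?thesis
  proof (induction rule: poly_mapping_lin_induct)
    case zero
    show ?case by (simp add: op V_map_def)
  next
    case (add f f')
    then show ?case by (simp add: op lext_add \<open>\<And>f f'. V_map (f + f') = _\<close> op_add in_B)
  next
    case (single p c)
    then show ?case by (simp add: op sm gen op_sm V_map_single)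
  qed
qed

lemma V_map_exists:
  "\<exists>\<Phi>. kmap (free_space {..n}) B \<Phi> \<and> \<Phi> (Poly_Mapping.single 0 1) = w \<and>
    (\<forall>x. \<forall>f\<in>carrier (free_space {..n}). \<Phi> (V_op q \<epsilon> n \<alpha> \<beta> x f) = op x (\<Phi> f))"
  using V_map_kmap V_map_intertwines V_map_single[of 0 1]
  by (intro exI[of _ V_map]) simp

end

section \<open>Direct sums\<close>

lemma direct_sum_module_simps:
  "carrier (direct_sum_module I M) = {f \<in> (\<Pi>\<^sub>E i\<in>I. carrier (M i)). finite {i \<in> I. f i \<noteq> \<zero>\<^bsub>M i\<^esub>}}"
  "ring.zero (direct_sum_module I M) = (\<lambda>i\<in>I. \<zero>\<^bsub>M i\<^esub>)"
  "add (direct_sum_module I M) = (\<lambda>f g. \<lambda>i\<in>I. f i \<oplus>\<^bsub>M i\<^esub> g i)"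
  "module.smult (direct_sum_module I M) = (\<lambda>a f. \<lambda>i\<in>I. a \<odot>\<^bsub>M i\<^esub> f i)"
  by (simp_all add: direct_sum_module_def)

lemma left_module_direct_sum:
  fixes R :: "('r, 'c) ring_scheme"
  assumes "finite I" "ring R" and M: "\<And>i. i \<in> I \<Longrightarrow> left_module R (M i)"
  shows "left_module R (direct_sum_module I M)"
proof -
  interpret R: ring R by fact
  note ag = left_module.axioms(2)[OF M]
  note am = abelian_groupE[OF ag]
  have abelian: "abelian_group (direct_sum_module I M)"
  proof (rule abelian_groupI, goal_cases)
    case (6 f)
    then have f: "f \<in> (\<Pi>\<^sub>E i\<in>I. carrier (M i))" by (simp add: direct_sum_module_simps)
    have "\<forall>i\<in>I. \<exists>y\<in>carrier (M i). y \<oplus>\<^bsub>M i\<^esub> f i = \<zero>\<^bsub>M i\<^esub>"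
      using am(6) f by (auto dest: PiE_mem)
    then obtain y where "\<forall>i\<in>I. y i \<in> carrier (M i) \<and> y i \<oplus>\<^bsub>M i\<^esub> f i = \<zero>\<^bsub>M i\<^esub>"
      by metis
    then show ?case
      using \<open>finite I\<close> by (intro bexI[of _ "restrict y I"]) (auto simp: direct_sum_module_simps fun_eq_iff)
  qed (use \<open>finite I\<close> am in \<open>auto simp: direct_sum_module_simps fun_eq_iff restrict_def PiE_iff extensional_def\<close>)
  show ?thesis
    unfolding left_module_def left_module_axioms_def
  proof (intro conjI allI impI)
  qed (use R.ring_axioms abelian \<open>finite I\<close> M[THEN left_module.smult_closed] M[THEN left_module.smult_l_distr]
      M[THEN left_module.smult_r_distr] M[THEN left_module.smult_assoc1] M[THEN left_module.smult_one]
      in \<open>auto simp: direct_sum_module_simps fun_eq_iff restrict_def PiE_iff extensional_def\<close>)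
qed

lemma left_module_iso_inverse:
  assumes M: "left_module R M" and N: "left_module R N" and f: "f \<in> left_module_iso R N M"
  shows "left_modules_isomorphic R M N"
proof -
  interpret M: left_module R M by fact
  interpret N: left_module R N by fact
  let ?g = "inv_into (carrier N) f"
  have bij: "bij_betw f (carrier N) (carrier M)" using f by (simp add: left_module_iso_def)
  then have g: "?g x \<in> carrier N" "f (?g x) = x" if "x \<in> carrier M" for x
    using that by (auto simp: bij_betw_def f_inv_into_f inv_into_into)
  have eqI: "?g x = y" if "y \<in> carrier N" "f y = x" for x y
    using that bij by (auto simp: bij_betw_def)
  have "?g \<in> left_module_iso R M N"
    unfolding left_module_iso_def
    using f g bij_betw_inv_into[OF bij] N.smult_closed
    by (auto intro!: eqI simp: left_module_iso_def)
  then show ?thesis using M N by (auto simp: left_modules_isomorphic_def)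
qed

section \<open>Highest weight vectors in the tensor product\<close>

locale clebsch_gordan =
  fixes q \<epsilon> \<epsilon>' \<alpha> \<beta> \<alpha>' \<beta>' :: "'k::field" and n m :: nat
  assumes q_nz: "q \<noteq> 0" and q_not_root: "\<And>r. r > 0 \<Longrightarrow> q ^ r \<noteq> 1"
    and m_le_n: "m \<le> n"
    and \<epsilon>_sq: "\<epsilon> * \<epsilon> = 1" "\<epsilon>' * \<epsilon>' = 1"
    and nz: "\<alpha> \<noteq> 0" "\<beta> \<noteq> 0" "\<alpha>' \<noteq> 0" "\<beta>' \<noteq> 0"
begin

lemma q_sq: "q\<^sup>2 \<noteq> 1"
  using q_not_root[of 2] by simp

lemma \<epsilon>_nz: "\<epsilon> \<noteq> 0" "\<epsilon>' \<noteq> 0"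
  using \<epsilon>_sq by auto

sublocale U_module_pair q "V q \<epsilon> n \<alpha> \<beta>" "V q \<epsilon>' m \<alpha>' \<beta>'"
  unfolding U_module_pair_def
  using V_left_module[OF q_nz q_sq] \<epsilon>_sq nz by simp

sublocale D: U_rep T Delta_op q
  by (rule U_rep_Delta[OF q_nz])

lemmas act1 = V_act[OF q_nz q_sq \<epsilon>_sq(1) nz(1,2)]
  and act2 = V_act[OF q_nz q_sq \<epsilon>_sq(2) nz(3,4)]

text \<open>Basis vectors beyond the last one are zero, so that the formulas for \<open>F\<close> hold at the end of the
chain without a case distinction.\<close>

definition e where "e i = (if i \<le> n then Poly_Mapping.single i (1::'k) else 0)"
definition e' where "e' i = (if i \<le> m then Poly_Mapping.single i (1::'k) else 0)"
definition "e_tensor i l = pure (e i) (e' l)"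

lemma e_in [simp]: "Poly_Mapping.keys (e i) \<subseteq> {..n}" "Poly_Mapping.keys (e' i) \<subseteq> {..m}"
  by (auto simp: e_def e'_def)

lemma e_tensor_in [simp]: "e_tensor i l \<in> carrier T"
  unfolding e_tensor_def by (rule pure_in_T) simp_all

lemma pure_scl:
  "Poly_Mapping.keys f \<subseteq> {..n} \<Longrightarrow> Poly_Mapping.keys f' \<subseteq> {..m} \<Longrightarrow> pure (scl c f) f' = c \<odot>\<^bsub>T\<^esub> pure f f'"
  "Poly_Mapping.keys f \<subseteq> {..n} \<Longrightarrow> Poly_Mapping.keys f' \<subseteq> {..m} \<Longrightarrow> pure f (scl c f') = c \<odot>\<^bsub>T\<^esub> pure f f'"
  using pure_sm_left[of f f' c] pure_sm_right[of f f' c] by (simp_all add: act1 act2)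

lemma pure_plus:
  "Poly_Mapping.keys f \<subseteq> {..n} \<Longrightarrow> Poly_Mapping.keys g \<subseteq> {..n} \<Longrightarrow> Poly_Mapping.keys f' \<subseteq> {..m} \<Longrightarrow>
    pure (f + g) f' = pure f f' \<oplus>\<^bsub>T\<^esub> pure g f'"
  "Poly_Mapping.keys f \<subseteq> {..n} \<Longrightarrow> Poly_Mapping.keys f' \<subseteq> {..m} \<Longrightarrow> Poly_Mapping.keys g' \<subseteq> {..m} \<Longrightarrow>
    pure f (f' + g') = pure f f' \<oplus>\<^bsub>T\<^esub> pure f g'"
  using pure_add_left[of f g f'] pure_add_right[of f f' g'] by simp_all

lemma pure_zero:
  "Poly_Mapping.keys f' \<subseteq> {..m} \<Longrightarrow> pure 0 f' = \<zero>\<^bsub>T\<^esub>"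
  "Poly_Mapping.keys f \<subseteq> {..n} \<Longrightarrow> pure f 0 = \<zero>\<^bsub>T\<^esub>"
  using pure_scl(1)[of 0 f' 0] pure_scl(2)[of f 0 0] by simp_all

lemma e_tensor_zero: "i > n \<or> l > m \<Longrightarrow> e_tensor i l = \<zero>\<^bsub>T\<^esub>"
  by (auto simp: e_tensor_def e_def e'_def pure_zero)

lemma T_span_induct [consumes 1, case_names basis add sm]:
  assumes "t \<in> carrier T"
    and "\<And>i l. i \<le> n \<Longrightarrow> l \<le> m \<Longrightarrow> P (e_tensor i l)"
    and "\<And>t t'. t \<in> carrier T \<Longrightarrow> t' \<in> carrier T \<Longrightarrow> P t \<Longrightarrow> P t' \<Longrightarrow> P (t \<oplus>\<^bsub>T\<^esub> t')"
    and "\<And>c t. t \<in> carrier T \<Longrightarrow> P t \<Longrightarrow> P (c \<odot>\<^bsub>T\<^esub> t)"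
  shows "P t"
  using assms(1)
proof (induction rule: T_induct)
  case (pure f f')
  then have f: "Poly_Mapping.keys f \<subseteq> {..n}" "Poly_Mapping.keys f' \<subseteq> {..m}" by simp_all
  have zero: "P \<zero>\<^bsub>T\<^esub>" using assms(4)[OF e_tensor_in assms(2)[of 0 0], of 0] by simp
  from f(1) show ?case
  proof (induction rule: poly_mapping_lin_induct)
    case (single i c)
    from f(2) show ?case
    proof (induction rule: poly_mapping_lin_induct)
      case (single l d)
      have "pure (Poly_Mapping.single i c) (Poly_Mapping.single l d) = (c * d) \<odot>\<^bsub>T\<^esub> e_tensor i l"
        using \<open>i \<in> _\<close> single pure_scl(1)[of "e i" "Poly_Mapping.single l d" c] pure_scl(2)[of "e i" "e' l" d]
        by (simp add: e_def e'_def e_tensor_def)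
      then show ?case using assms(2,4) \<open>i \<in> _\<close> single by simp
    next
      case (add p p')
      then show ?case using assms(3) \<open>i \<in> _\<close> by (simp add: pure_plus)
    qed (use zero \<open>i \<in> _\<close> in \<open>simp add: pure_zero\<close>)
  next
    case (add p p')
    then show ?case using assms(3) f by (simp add: pure_plus)
  qed (use zero f in \<open>simp add: pure_zero\<close>)
qed (use assms(3,4) in auto)

text \<open>At index \<open>0\<close> the coefficient is zero, so the truncated index \<open>i - 1\<close> in the formulas for \<open>E\<close> does
no harm.\<close>

definition "E_coeff i = (if i = 0 then 0 else \<epsilon> * \<alpha> * qint q (n - i + 1))"
definition "E_coeff' l = (if l = 0 then 0 else \<epsilon>' * \<alpha>' * qint q (m - l + 1))"

lemma gen_e:
  assumes "i \<le> n"
  shows "gen_act q (V q \<epsilon> n \<alpha> \<beta>) gE (e i) = scl (E_coeff i) (e (i - 1))"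
    and "gen_act q (V q \<epsilon> n \<alpha> \<beta>) gF (e i) = scl (qint q (i + 1)) (e (i + 1))"
    and "gen_act q (V q \<epsilon> n \<alpha> \<beta>) gK (e i) = scl (\<epsilon> * \<alpha> * q powi (int n - 2 * int i)) (e i)"
    and "gen_act q (V q \<epsilon> n \<alpha> \<beta>) gKi (e i) = scl (inverse (\<epsilon> * \<alpha> * q powi (int n - 2 * int i))) (e i)"
    and "gen_act q (V q \<epsilon> n \<alpha> \<beta>) gg (e i) = scl \<alpha> (e i)"
    and "gen_act q (V q \<epsilon> n \<alpha> \<beta>) gh (e i) = scl \<beta> (e i)"
    and "gen_act q (V q \<epsilon> n \<alpha> \<beta>) ghi (e i) = scl (inverse \<beta>) (e i)"
  using assms by (simp_all add: act1 keys_scl_subset) (simp_all add: e_def E_coeff_def)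

lemma gen_e':
  assumes "i \<le> m"
  shows "gen_act q (V q \<epsilon>' m \<alpha>' \<beta>') gE (e' i) = scl (E_coeff' i) (e' (i - 1))"
    and "gen_act q (V q \<epsilon>' m \<alpha>' \<beta>') gF (e' i) = scl (qint q (i + 1)) (e' (i + 1))"
    and "gen_act q (V q \<epsilon>' m \<alpha>' \<beta>') gK (e' i) = scl (\<epsilon>' * \<alpha>' * q powi (int m - 2 * int i)) (e' i)"
    and "gen_act q (V q \<epsilon>' m \<alpha>' \<beta>') gg (e' i) = scl \<alpha>' (e' i)"
    and "gen_act q (V q \<epsilon>' m \<alpha>' \<beta>') gh (e' i) = scl \<beta>' (e' i)"
    and "gen_act q (V q \<epsilon>' m \<alpha>' \<beta>') ghi (e' i) = scl (inverse \<beta>') (e' i)"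
  using assms by (simp_all add: act2 keys_scl_subset) (simp_all add: e'_def E_coeff'_def)

lemma act_scl1: "Poly_Mapping.keys f \<subseteq> {..n} \<Longrightarrow>
    gen_act q (V q \<epsilon> n \<alpha> \<beta>) x (scl c f) = scl c (gen_act q (V q \<epsilon> n \<alpha> \<beta>) x f)"
  and act_scl2: "Poly_Mapping.keys f' \<subseteq> {..m} \<Longrightarrow>
    gen_act q (V q \<epsilon>' m \<alpha>' \<beta>') x (scl c f') = scl c (gen_act q (V q \<epsilon>' m \<alpha>' \<beta>') x f')"
  by (simp_all add: act1 act2 keys_scl_subset lext_scl)

lemma Delta_e_tensor:
  assumes "i \<le> n" "l \<le> m"
  shows "Delta_op gE (e_tensor i l) = (inverse \<beta> * E_coeff' l) \<odot>\<^bsub>T\<^esub> e_tensor i (l - 1) \<oplus>\<^bsub>T\<^esub>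
      (E_coeff i * (\<epsilon>' * \<alpha>' * q powi (int m - 2 * int l) * \<beta>')) \<odot>\<^bsub>T\<^esub> e_tensor (i - 1) l"
    and "\<exists>c d. Delta_op gF (e_tensor i l) = c \<odot>\<^bsub>T\<^esub> e_tensor i (l + 1) \<oplus>\<^bsub>T\<^esub> d \<odot>\<^bsub>T\<^esub> e_tensor (i + 1) l"
    and "Delta_op gK (e_tensor i l) =
      (\<epsilon> * \<alpha> * q powi (int n - 2 * int i) * (\<epsilon>' * \<alpha>' * q powi (int m - 2 * int l))) \<odot>\<^bsub>T\<^esub> e_tensor i l"
    and "Delta_op gg (e_tensor i l) = (\<alpha> * \<alpha>') \<odot>\<^bsub>T\<^esub> e_tensor i l"
    and "Delta_op gh (e_tensor i l) = (\<beta> * \<beta>') \<odot>\<^bsub>T\<^esub> e_tensor i l"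
proof -
  note D = Delta_op_pure[of "e i" "e' l", simplified V_simps(1) mem_Collect_eq, OF e_in(1) e_in(2)]
  note s = e_tensor_def gen_e[OF assms(1)] gen_e'[OF assms(2)] act_scl1 act_scl2 pure_scl keys_scl_subset
    mult_ac
  note [simp del] = V_simps(4)
  show "Delta_op gE (e_tensor i l) = (inverse \<beta> * E_coeff' l) \<odot>\<^bsub>T\<^esub> e_tensor i (l - 1) \<oplus>\<^bsub>T\<^esub>
      (E_coeff i * (\<epsilon>' * \<alpha>' * q powi (int m - 2 * int l) * \<beta>')) \<odot>\<^bsub>T\<^esub> e_tensor (i - 1) l"
    using D(1) by (simp add: s)
  show "Delta_op gK (e_tensor i l) =
      (\<epsilon> * \<alpha> * q powi (int n - 2 * int i) * (\<epsilon>' * \<alpha>' * q powi (int m - 2 * int l))) \<odot>\<^bsub>T\<^esub> e_tensor i l"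
    "Delta_op gg (e_tensor i l) = (\<alpha> * \<alpha>') \<odot>\<^bsub>T\<^esub> e_tensor i l"
    "Delta_op gh (e_tensor i l) = (\<beta> * \<beta>') \<odot>\<^bsub>T\<^esub> e_tensor i l"
    using D(3) by (simp_all add: s)
  show "\<exists>c d. Delta_op gF (e_tensor i l) = c \<odot>\<^bsub>T\<^esub> e_tensor i (l + 1) \<oplus>\<^bsub>T\<^esub> d \<odot>\<^bsub>T\<^esub> e_tensor (i + 1) l"
    using D(2) by (simp add: s) blast
qed

text \<open>Each application of \<open>F\<close> raises \<open>i + l\<close> by one, and \<open>v\<^sub>i \<otimes> v\<^sub>l\<close> vanishes once \<open>i + l > n + m\<close>.\<close>

lemma F_nilpotent:
  assumes "t \<in> carrier T"
  shows "(Delta_op gF ^^ Suc (n + m)) t = \<zero>\<^bsub>T\<^esub>"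
proof -
  note pow = kmapD[OF D.op_funpow_kmap[where x = gF]]
  have zero: "(Delta_op gF ^^ r) \<zero>\<^bsub>T\<^esub> = \<zero>\<^bsub>T\<^esub>" for r
    by (rule kmap_zero[OF kspace_T kspace_T D.op_funpow_kmap])
  have "i + l + r > n + m \<Longrightarrow> (Delta_op gF ^^ r) (e_tensor i l) = \<zero>\<^bsub>T\<^esub>" for r i l
  proof (induction r arbitrary: i l)
    case 0
    then show ?case by (auto intro!: e_tensor_zero)
  next
    case (Suc r)
    show ?case
    proof (cases "i \<le> n \<and> l \<le> m")
      case True
      then obtain c d where "Delta_op gF (e_tensor i l) = c \<odot>\<^bsub>T\<^esub> e_tensor i (l + 1) \<oplus>\<^bsub>T\<^esub> d \<odot>\<^bsub>T\<^esub> e_tensor (i + 1) l"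
        using Delta_e_tensor(2) by blast
      then show ?thesis
        using Suc.IH[of i "l + 1"] Suc.IH[of "i + 1" l] Suc.prems
        by (simp add: funpow_Suc_right pow del: funpow.simps)
    next
      case False
      then have "e_tensor i l = \<zero>\<^bsub>T\<^esub>" by (intro e_tensor_zero) auto
      then show ?thesis by (simp only: zero)
    qed
  qed
  then have "(Delta_op gF ^^ Suc (n + m)) (e_tensor i l) = \<zero>\<^bsub>T\<^esub>" for i l by (simp del: funpow.simps)
  with assms show ?thesis
    by (induction rule: T_span_induct) (simp_all add: pow del: funpow.simps)
qed

text \<open>The coefficients of \<open>v\<^sub>k \<otimes> v\<^sub>j\<^sub>-\<^sub>k\<^sub>-\<^sub>1\<close> and \<open>v\<^sub>k\<^sub>-\<^sub>1 \<otimes> v\<^sub>j\<^sub>-\<^sub>k\<close> in \<open>E (v\<^sub>k \<otimes> v\<^sub>j\<^sub>-\<^sub>k)\<close>.\<close>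

definition "stay_coeff j k = inverse \<beta> * E_coeff' (j - k)"
definition "shift_coeff j k = E_coeff k * (\<epsilon>' * \<alpha>' * q powi (int m - 2 * int (j - k)) * \<beta>')"

text \<open>The recursion makes the contributions of \<open>v\<^sub>k \<otimes> v\<^sub>j\<^sub>-\<^sub>k\<close> and \<open>v\<^sub>k\<^sub>+\<^sub>1 \<otimes> v\<^sub>j\<^sub>-\<^sub>k\<^sub>-\<^sub>1\<close> to the coefficient of
\<open>v\<^sub>k \<otimes> v\<^sub>j\<^sub>-\<^sub>k\<^sub>-\<^sub>1\<close> cancel.\<close>

primrec cg_coeff :: "nat \<Rightarrow> nat \<Rightarrow> 'k" where
  "cg_coeff j 0 = 1"
| "cg_coeff j (Suc k) = - (cg_coeff j k * stay_coeff j k / shift_coeff j (Suc k))"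

primrec hwv_upto :: "nat \<Rightarrow> nat \<Rightarrow> _" where
  "hwv_upto j 0 = e_tensor 0 j"
| "hwv_upto j (Suc k) = hwv_upto j k \<oplus>\<^bsub>T\<^esub> cg_coeff j (Suc k) \<odot>\<^bsub>T\<^esub> e_tensor (Suc k) (j - Suc k)"

lemma hwv_upto_in [simp]: "hwv_upto j k \<in> carrier T"
  by (induction k) simp_all

lemma qint_nz: "r > 0 \<Longrightarrow> qint q r \<noteq> 0"
  by (rule qint_nonzero[OF q_nz q_sq q_not_root])

text \<open>The image of a partial sum telescopes to its last contribution. For \<open>k = j\<close> that contribution
is zero, because \<open>E v\<^sub>0 = 0\<close> in the second factor. Solving for the next coefficient needs
\<open>[n - k] \<noteq> 0\<close>, which holds as \<open>k < j \<le> n\<close>.\<close>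

lemma E_hwv_upto:
  assumes "k \<le> j" "j \<le> m"
  shows "Delta_op gE (hwv_upto j k) = (cg_coeff j k * stay_coeff j k) \<odot>\<^bsub>T\<^esub> e_tensor k (j - k - 1)"
  using assms(1)
proof (induction k)
  case 0
  then show ?case
    using Delta_e_tensor(1)[of 0 j] assms by (simp add: stay_coeff_def E_coeff_def)
next
  case (Suc k)
  let ?c = "cg_coeff j k * stay_coeff j k"
  have "shift_coeff j (Suc k) \<noteq> 0"
    using Suc.prems assms m_le_n qint_nz \<epsilon>_nz nz q_nz by (simp add: shift_coeff_def E_coeff_def)
  then have cancel: "?c + cg_coeff j (Suc k) * shift_coeff j (Suc k) = 0" by simp
  have 1: "Delta_op gE (e_tensor (Suc k) (j - Suc k)) =
      stay_coeff j (Suc k) \<odot>\<^bsub>T\<^esub> e_tensor (Suc k) (j - Suc k - 1) \<oplus>\<^bsub>T\<^esub> shift_coeff j (Suc k) \<odot>\<^bsub>T\<^esub> e_tensor k (j - k - 1)"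
    using Delta_e_tensor(1)[of "Suc k" "j - Suc k"] Suc.prems assms m_le_n
    by (simp add: stay_coeff_def shift_coeff_def)
  have 2: "Delta_op gE (hwv_upto j k) = ?c \<odot>\<^bsub>T\<^esub> e_tensor k (j - k - 1)" using Suc by simp
  let ?x = "e_tensor k (j - k - 1)" and ?y = "e_tensor (Suc k) (j - Suc k - 1)" and ?d = "cg_coeff j (Suc k)"
  have "Delta_op gE (hwv_upto j (Suc k)) =
      ?c \<odot>\<^bsub>T\<^esub> ?x \<oplus>\<^bsub>T\<^esub> ?d \<odot>\<^bsub>T\<^esub> (stay_coeff j (Suc k) \<odot>\<^bsub>T\<^esub> ?y \<oplus>\<^bsub>T\<^esub> shift_coeff j (Suc k) \<odot>\<^bsub>T\<^esub> ?x)"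
    unfolding hwv_upto.simps by (simp only: D.op_add D.op_sm hwv_upto_in e_tensor_in T.sm_closed 1 2)
  also have "\<dots> = (?c + ?d * shift_coeff j (Suc k)) \<odot>\<^bsub>T\<^esub> ?x \<oplus>\<^bsub>T\<^esub> (?d * stay_coeff j (Suc k)) \<odot>\<^bsub>T\<^esub> ?y"
    by (simp add: T.sm_add_right T.sm_add_left T.M.a_ac del: cg_coeff.simps)
  also have "\<dots> = (?d * stay_coeff j (Suc k)) \<odot>\<^bsub>T\<^esub> ?y"
    unfolding cancel by simp
  finally show ?case .
qed

lemma hwv_upto_eigen:
  assumes "k \<le> j" "j \<le> m"
  shows "Delta_op gK (hwv_upto j k) = (\<epsilon> * \<epsilon>' * (\<alpha> * \<alpha>') * q ^ (n + m - 2 * j)) \<odot>\<^bsub>T\<^esub> hwv_upto j k"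
    and "Delta_op gg (hwv_upto j k) = (\<alpha> * \<alpha>') \<odot>\<^bsub>T\<^esub> hwv_upto j k"
    and "Delta_op gh (hwv_upto j k) = (\<beta> * \<beta>') \<odot>\<^bsub>T\<^esub> hwv_upto j k"
proof -
  have step: "Delta_op x (hwv_upto j k) = c \<odot>\<^bsub>T\<^esub> hwv_upto j k"
    if "\<And>i. i \<le> j \<Longrightarrow> Delta_op x (e_tensor i (j - i)) = c \<odot>\<^bsub>T\<^esub> e_tensor i (j - i)" for x c
    using assms(1)
  proof (induction k)
    case 0
    then show ?case using that[of 0] by simp
  next
    case (Suc k)
    then show ?case
      using that[of "Suc k"] by (simp add: D.op_add D.op_sm T.sm_add_right mult.commute del: cg_coeff.simps)
  qed
  show "Delta_op gK (hwv_upto j k) = (\<epsilon> * \<epsilon>' * (\<alpha> * \<alpha>') * q ^ (n + m - 2 * j)) \<odot>\<^bsub>T\<^esub> hwv_upto j k"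
  proof (rule step)
    fix i assume i: "i \<le> j"
    have "q ^ (n + m - 2 * j) = q powi ((int n - 2 * int i) + (int m - 2 * int (j - i)))"
    proof -
      have "(int n - 2 * int i) + (int m - 2 * int (j - i)) = int (n + m - 2 * j)"
        using i assms m_le_n by simp
      then show ?thesis by (simp only: power_int_of_nat)
    qed
    also have "\<dots> = q powi (int n - 2 * int i) * q powi (int m - 2 * int (j - i))"
      using q_nz by (subst power_int_add) simp_all
    finally show "Delta_op gK (e_tensor i (j - i)) = (\<epsilon> * \<epsilon>' * (\<alpha> * \<alpha>') * q ^ (n + m - 2 * j)) \<odot>\<^bsub>T\<^esub> e_tensor i (j - i)"
      using Delta_e_tensor(3)[of i "j - i"] i assms m_le_n by (simp only:) (simp add: mult_ac)
  qed
  show "Delta_op gg (hwv_upto j k) = (\<alpha> * \<alpha>') \<odot>\<^bsub>T\<^esub> hwv_upto j k"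
    by (rule step) (use Delta_e_tensor(4) assms m_le_n in auto)
  show "Delta_op gh (hwv_upto j k) = (\<beta> * \<beta>') \<odot>\<^bsub>T\<^esub> hwv_upto j k"
    by (rule step) (use Delta_e_tensor(5) assms m_le_n in auto)
qed

definition "hwv j = hwv_upto j j"

lemma hwv_in [simp]: "hwv j \<in> carrier T"
  by (simp add: hwv_def)

lemma dominant_hwv:
  assumes "j \<le> m"
  shows "dominant_weight T Delta_op q (hwv j) (\<epsilon> * \<epsilon>') (\<alpha> * \<alpha>') (\<beta> * \<beta>') (n + m - 2 * j) (Suc (n + m))"
proof unfold_locales
  show "Delta_op gE (hwv j) = \<zero>\<^bsub>T\<^esub>"
    using E_hwv_upto[of j j] assms by (simp add: hwv_def stay_coeff_def E_coeff'_def)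
  show "\<epsilon> * \<epsilon>' * (\<epsilon> * \<epsilon>') = 1" using \<epsilon>_sq by (simp add: mult_ac mult.left_commute[of \<epsilon>' \<epsilon>] flip: mult.assoc)
qed (use hwv_upto_eigen[of j j] assms q_not_root q_nz \<epsilon>_nz nz F_nilpotent in \<open>auto simp: hwv_def simp del: funpow.simps\<close>)

text \<open>The functional reads off the coefficient of \<open>v\<^sub>0 \<otimes> v\<^sub>j\<close>, and the leading coefficient of each
highest weight vector is \<open>1\<close>.\<close>

lemma coordinate_exists:
  assumes "j \<le> m"
  shows "\<exists>\<xi> :: _ \<Rightarrow> (unit \<Rightarrow>\<^sub>0 'k). kmap T (free_space UNIV) \<xi> \<and>
    (\<forall>l\<le>m. \<xi> (hwv l) = Poly_Mapping.single () (if l = j then 1 else 0))"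
proof -
  let ?\<phi> = "\<lambda>(f, f'). Poly_Mapping.single () (Poly_Mapping.lookup f 0 * Poly_Mapping.lookup f' j)"
  obtain \<xi> :: "_ \<Rightarrow> (unit \<Rightarrow>\<^sub>0 'k)" where \<xi>: "kmap T (free_space UNIV) \<xi>"
      "\<And>f f'. Poly_Mapping.keys f \<subseteq> {..n} \<Longrightarrow> Poly_Mapping.keys f' \<subseteq> {..m} \<Longrightarrow> \<xi> (pure f f') = ?\<phi> (f, f')"
    using bilinear_lift[of ?\<phi>] by (auto simp: act1 act2 lookup_add single_add algebra_simps)
  have e_tensor: "\<xi> (e_tensor i l) = Poly_Mapping.single () (if i = 0 \<and> l = j then 1 else 0)" for i l
    using \<xi>(2)[of "e i" "e' l"] assms by (auto simp: e_tensor_def e_def e'_def lookup_single when_def)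
  have "\<xi> (hwv_upto l k) = Poly_Mapping.single () (if l = j then 1 else 0)" for l k
    by (induction k) (simp_all add: kmapD[OF \<xi>(1)] e_tensor del: cg_coeff.simps)
  with \<xi>(1) show ?thesis by (auto simp: hwv_def)
qed

lemma hwv_independent:
  assumes "(\<Oplus>\<^bsub>T\<^esub>j\<in>{0..m}. a j \<odot>\<^bsub>T\<^esub> hwv j) = \<zero>\<^bsub>T\<^esub>" "j \<le> m"
  shows "a j = 0"
proof -
  obtain \<xi> :: "_ \<Rightarrow> (unit \<Rightarrow>\<^sub>0 'k)" where \<xi>: "kmap T (free_space UNIV) \<xi>"
      "\<And>l. l \<le> m \<Longrightarrow> \<xi> (hwv l) = Poly_Mapping.single () (if l = j then 1 else 0)"
    using coordinate_exists[OF assms(2)] by blast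
  have "0 = \<xi> (\<Oplus>\<^bsub>T\<^esub>j\<in>{0..m}. a j \<odot>\<^bsub>T\<^esub> hwv j)"
    using kmap_zero[OF kspace_T kspace_free_space \<xi>(1)] assms(1) by simp
  also have "\<dots> = (\<Sum>l\<in>{0..m}. \<xi> (a l \<odot>\<^bsub>T\<^esub> hwv l))"
    by (subst kmap_finsum[OF kspace_T kspace_free_space \<xi>(1)]) (simp_all add: finsum_free_space)
  also have "\<dots> = (\<Sum>l\<in>{0..m}. if l = j then Poly_Mapping.single () (a j) else 0)"
    by (intro sum.cong) (auto simp: kmapD[OF \<xi>(1)] \<xi>(2))
  also have "\<dots> = Poly_Mapping.single () (a j)" using assms(2) by simp
  finally show ?thesis by (metis lookup_single_eq lookup_zero)
qed

end

section \<open>The decomposition\<close>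

text \<open>The dimension of the direct sum. Its partial sums have the closed form used in the induction.\<close>

lemma card_string_indices:
  assumes "m \<le> (n::nat)"
  shows "card (Sigma {0..m} (\<lambda>j. {..n + m - 2 * j})) = (n + 1) * (m + 1)"
proof -
  have "k \<le> m \<Longrightarrow> (\<Sum>j\<in>{0..k}. n + m - 2 * j + 1) = (k + 1) * (n + m + 1 - k)" for k
  proof (induction k)
    case (Suc k)
    obtain d where d: "n + m = 2 * Suc k + d" using Suc.prems assms by (metis add_mono le_Suc_ex le_trans mult_2)
    have "(\<Sum>j\<in>{0..Suc k}. n + m - 2 * j + 1) = (k + 1) * (n + m + 1 - k) + (n + m - 2 * Suc k + 1)"
      using Suc by simp
    then show ?case unfolding d by (simp add: algebra_simps)
  qed simp
  from this[of m] show ?thesis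
    by (simp add: mult.commute)
qed

text \<open>A choice of the homomorphisms from the summands to the tensor product, one for each highest
weight vector.\<close>

locale clebsch_gordan_maps = clebsch_gordan +
  fixes \<Phi> :: "nat \<Rightarrow> (nat \<Rightarrow>\<^sub>0 'a) \<Rightarrow> ((nat \<Rightarrow>\<^sub>0 'a) \<times> (nat \<Rightarrow>\<^sub>0 'a) \<Rightarrow>\<^sub>0 'a) set"
  assumes \<Phi>_kmap: "j \<le> m \<Longrightarrow> kmap (free_space {..n + m - 2 * j}) T (\<Phi> j)"
    and \<Phi>_0: "j \<le> m \<Longrightarrow> \<Phi> j (Poly_Mapping.single 0 1) = hwv j"
    and \<Phi>_op: "j \<le> m \<Longrightarrow> Poly_Mapping.keys f \<subseteq> {..n + m - 2 * j} \<Longrightarrow>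
      \<Phi> j (V_op q (\<epsilon> * \<epsilon>') (n + m - 2 * j) (\<alpha> * \<alpha>') (\<beta> * \<beta>') x f) = Delta_op x (\<Phi> j f)"
begin

abbreviation "N_top j \<equiv> n + m - 2 * j"
abbreviation "V_j j \<equiv> V q (\<epsilon> * \<epsilon>') (N_top j) (\<alpha> * \<alpha>') (\<beta> * \<beta>')"
abbreviation "V_sum \<equiv> direct_sum_module {0..m} V_j"
abbreviation "op_j j \<equiv> V_op q (\<epsilon> * \<epsilon>') (N_top j) (\<alpha> * \<alpha>') (\<beta> * \<beta>')"

definition \<phi> where "\<phi> f = (\<Oplus>\<^bsub>T\<^esub>j\<in>{0..m}. \<Phi> j (f j))"

lemma \<epsilon>\<epsilon>'_sq: "\<epsilon> * \<epsilon>' * (\<epsilon> * \<epsilon>') = 1"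
  using \<epsilon>_sq by (simp add: mult_ac mult.left_commute[of \<epsilon>' \<epsilon>] flip: mult.assoc)

lemma U_rep_j: "U_rep (free_space {..N_top j}) (op_j j) q"
  using U_rep_V[OF q_nz q_sq \<epsilon>\<epsilon>'_sq] nz by simp

lemma op_j_in: "Poly_Mapping.keys f \<subseteq> {..N_top j} \<Longrightarrow> Poly_Mapping.keys (op_j j x f) \<subseteq> {..N_top j}"
  using kops.op_closed[OF U_rep.axioms(1)[OF U_rep_j], of f j x] by simp

lemma V_sum_carrier: "carrier V_sum = (\<Pi>\<^sub>E j\<in>{0..m}. {f. Poly_Mapping.keys f \<subseteq> {..N_top j}})"
  by (simp add: direct_sum_module_simps)

lemma V_sumD: "f \<in> carrier V_sum \<Longrightarrow> j \<le> m \<Longrightarrow> Poly_Mapping.keys (f j) \<subseteq> {..N_top j}"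
  by (auto simp: V_sum_carrier dest!: PiE_mem)

lemma \<Phi>_in: "j \<le> m \<Longrightarrow> Poly_Mapping.keys f \<subseteq> {..N_top j} \<Longrightarrow> \<Phi> j f \<in> carrier T"
  and \<Phi>_add: "j \<le> m \<Longrightarrow> Poly_Mapping.keys f \<subseteq> {..N_top j} \<Longrightarrow> Poly_Mapping.keys f' \<subseteq> {..N_top j} \<Longrightarrow>
    \<Phi> j (f + f') = \<Phi> j f \<oplus>\<^bsub>T\<^esub> \<Phi> j f'"
  and \<Phi>_scl: "j \<le> m \<Longrightarrow> Poly_Mapping.keys f \<subseteq> {..N_top j} \<Longrightarrow> \<Phi> j (scl c f) = c \<odot>\<^bsub>T\<^esub> \<Phi> j f"
  using kmapD[OF \<Phi>_kmap, of j] by simp_all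

lemma \<phi>_in: "f \<in> carrier V_sum \<Longrightarrow> \<phi> f \<in> carrier T"
  unfolding \<phi>_def by (intro T.M.finsum_closed) (auto simp: \<Phi>_in V_sumD)

lemma \<phi>_add:
  assumes "f \<in> carrier V_sum" "f' \<in> carrier V_sum"
  shows "\<phi> (f \<oplus>\<^bsub>V_sum\<^esub> f') = \<phi> f \<oplus>\<^bsub>T\<^esub> \<phi> f'"
proof -
  have "\<phi> (f \<oplus>\<^bsub>V_sum\<^esub> f') = (\<Oplus>\<^bsub>T\<^esub>j\<in>{0..m}. \<Phi> j (f j) \<oplus>\<^bsub>T\<^esub> \<Phi> j (f' j))"
    unfolding \<phi>_def using assms
    by (intro T.M.finsum_cong') (auto simp: direct_sum_module_simps(3) \<Phi>_add V_sumD \<Phi>_in)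
  also have "\<dots> = \<phi> f \<oplus>\<^bsub>T\<^esub> \<phi> f'"
    unfolding \<phi>_def using assms by (intro T.M.finsum_addf) (auto simp: V_sumD \<Phi>_in)
  finally show ?thesis .
qed

lemma \<phi>_intertwines:
  assumes u: "u \<in> carrier (U q)" and f: "f \<in> carrier V_sum"
  shows "\<phi> (u \<odot>\<^bsub>V_sum\<^esub> f) = U_act T Delta_op u (\<phi> f)"
proof -
  obtain a where a: "u = U_class q a" using u by (rule U_carrierE)
  have eq: "\<Phi> j (U_act (free_space {..N_top j}) (op_j j) u (f j)) = U_act T Delta_op u (\<Phi> j (f j))"
    if "j \<le> m" for j
    using U_rep_j D.U_rep_axioms \<Phi>_kmap[OF that] by (rule U_act_intertwines) (use that u f in \<open>auto simp: \<Phi>_op V_sumD\<close>)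
  have in_T: "U_act T Delta_op u (\<Phi> j (f j)) \<in> carrier T" if "j \<le> m" for j
    using that f by (simp add: a \<Phi>_in V_sumD)
  have "\<phi> (u \<odot>\<^bsub>V_sum\<^esub> f) = (\<Oplus>\<^bsub>T\<^esub>j\<in>{0..m}. U_act T Delta_op u (\<Phi> j (f j)))"
    unfolding \<phi>_def
    by (intro T.M.finsum_cong') (auto simp: direct_sum_module_simps(4) eq in_T)
  also have "\<dots> = (\<Oplus>\<^bsub>T\<^esub>j\<in>{0..m}. D.act a (\<Phi> j (f j)))"
    using f by (intro T.M.finsum_cong') (auto simp: a \<Phi>_in V_sumD)
  also have "\<dots> = D.act a (\<phi> f)"
    unfolding \<phi>_def using f by (intro kmap_finsum[OF kspace_T kspace_T D.act_kmap, symmetric]) (auto simp: \<Phi>_in V_sumD)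
  also have "\<dots> = U_act T Delta_op u (\<phi> f)" using \<phi>_in[OF f] by (simp add: a)
  finally show ?thesis .
qed

text \<open>The operator \<open>E\<close> on the direct sum. It lowers the largest index occurring in a vector, which
drives the induction for injectivity.\<close>

definition "E_sum f = (\<lambda>j\<in>{0..m}. op_j j gE (f j))"

lemma E_sum_in: "f \<in> carrier V_sum \<Longrightarrow> E_sum f \<in> carrier V_sum"
  by (auto simp: E_sum_def V_sum_carrier op_j_in[THEN subsetD] intro!: op_j_in dest!: PiE_mem)

lemma \<phi>_E_sum:
  assumes "f \<in> carrier V_sum"
  shows "\<phi> (E_sum f) = Delta_op gE (\<phi> f)"
proof -
  have "\<phi> (E_sum f) = (\<Oplus>\<^bsub>T\<^esub>j\<in>{0..m}. Delta_op gE (\<Phi> j (f j)))"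
    unfolding \<phi>_def using assms by (intro T.M.finsum_cong') (auto simp: E_sum_def \<Phi>_op V_sumD \<Phi>_in)
  also have "\<dots> = Delta_op gE (\<phi> f)"
    unfolding \<phi>_def using assms by (intro kmap_finsum[OF kspace_T kspace_T D.op_kmap, symmetric]) (auto simp: \<Phi>_in V_sumD)
  finally show ?thesis .
qed

lemma lookup_op_E:
  "Poly_Mapping.lookup (op_j j gE f) p =
    \<epsilon> * \<epsilon>' * (\<alpha> * \<alpha>') * qint q (N_top j - Suc p + 1) * Poly_Mapping.lookup f (Suc p)"
  by (rule lookup_V_op_E)

text \<open>Induction on a bound \<open>r\<close> for the indices of the basis vectors that occur in \<open>f\<close>. The vector
\<open>E f\<close> lies in the kernel and has a smaller bound, so it is zero. But \<open>E v\<^sub>p\<^sub>+\<^sub>1\<close> is a nonzero multiple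
of \<open>v\<^sub>p\<close>, so only the vectors \<open>v\<^sub>0\<close> of the summands occur in \<open>f\<close>, and their images are
independent.\<close>

lemma \<phi>_kernel:
  assumes "f \<in> carrier V_sum" "\<phi> f = \<zero>\<^bsub>T\<^esub>"
  shows "f = \<zero>\<^bsub>V_sum\<^esub>"
proof -
  have base: "f j = 0" if f: "f \<in> carrier V_sum" "\<phi> f = \<zero>\<^bsub>T\<^esub>"
    "\<And>j p. j \<le> m \<Longrightarrow> Poly_Mapping.lookup (f j) (Suc p) = 0" and "j \<le> m" for f j
  proof -
    have fj: "f j = Poly_Mapping.single 0 (Poly_Mapping.lookup (f j) 0)" if "j \<le> m" for j
    proof (rule poly_mapping_eqI)
      fix p show "Poly_Mapping.lookup (f j) p = Poly_Mapping.lookup (Poly_Mapping.single 0 (Poly_Mapping.lookup (f j) 0)) p"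
        using f(3)[OF that] by (cases p) (simp_all add: lookup_single)
    qed
    have \<Phi>f: "\<Phi> j (f j) = Poly_Mapping.lookup (f j) 0 \<odot>\<^bsub>T\<^esub> hwv j" if "j \<le> m" for j
    proof -
      have "\<Phi> j (Poly_Mapping.single 0 c) = c \<odot>\<^bsub>T\<^esub> hwv j" for c
        using \<Phi>_scl[OF that, of "Poly_Mapping.single 0 1" c] \<Phi>_0[OF that] by (simp del: single_one)
      then show ?thesis using arg_cong[OF fj[OF that], of "\<Phi> j"] by (rule trans[rotated])
    qed
    have "(\<Oplus>\<^bsub>T\<^esub>j\<in>{0..m}. Poly_Mapping.lookup (f j) 0 \<odot>\<^bsub>T\<^esub> hwv j) = \<phi> f"
      unfolding \<phi>_def by (intro T.M.finsum_cong') (auto simp: \<Phi>f)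
    then have "Poly_Mapping.lookup (f j) 0 = 0" using hwv_independent[OF _ \<open>j \<le> m\<close>] f(2) by simp
    then show "f j = 0" using fj[OF \<open>j \<le> m\<close>] by simp
  qed
  have "\<forall>j\<le>m. f j = 0"
    if "f \<in> carrier V_sum" "\<phi> f = \<zero>\<^bsub>T\<^esub>" "\<And>j p. j \<le> m \<Longrightarrow> p > r \<Longrightarrow> Poly_Mapping.lookup (f j) p = 0" for r f
    using that
  proof (induction r arbitrary: f)
    case 0
    then show ?case using base by simp
  next
    case (Suc r)
    have "\<forall>j\<le>m. E_sum f j = 0"
    proof (rule Suc.IH)
      show "\<phi> (E_sum f) = \<zero>\<^bsub>T\<^esub>" using \<phi>_E_sum[OF Suc.prems(1)] Suc.prems(2) by simp
      show "Poly_Mapping.lookup (E_sum f j) p = 0" if "j \<le> m" "r < p" for j p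
        using Suc.prems(3)[OF that(1), of "Suc p"] that by (simp add: E_sum_def lookup_op_E)
    qed (rule E_sum_in[OF Suc.prems(1)])
    then have E0: "op_j j gE (f j) = 0" if "j \<le> m" for j using that by (simp add: E_sum_def)
    have "Poly_Mapping.lookup (f j) (Suc p) = 0" if "j \<le> m" for j p
      using lookup_op_E[of j "f j" p] E0[OF that] qint_nz[of "N_top j - Suc p + 1"] \<epsilon>_nz nz by simp
    then show ?case using base[OF Suc.prems(1,2)] by blast
  qed
  moreover obtain r where "\<And>j p. j \<le> m \<Longrightarrow> p > r \<Longrightarrow> Poly_Mapping.lookup (f j) p = 0"
  proof
    fix j p assume "j \<le> m" "p > n + m"
    then have "p \<notin> Poly_Mapping.keys (f j)" using V_sumD[OF assms(1), of j] by auto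
    then show "Poly_Mapping.lookup (f j) p = 0" by (simp add: in_keys_iff)
  qed
  ultimately have "\<forall>j\<le>m. f j = 0" using assms by blast
  then show ?thesis
    using assms(1) by (auto simp: direct_sum_module_simps fun_eq_iff PiE_iff extensional_def)
qed

abbreviation "pairs \<equiv> {..n} \<times> {..m}"

text \<open>The linear map onto the tensor product from a space of known dimension.\<close>

definition "\<theta> = lincomb T (\<lambda>(i, l). e_tensor i l)"

lemma \<theta>_kmap: "kmap (free_space pairs) T \<theta>"
  unfolding kmap_def \<theta>_def
  by (auto simp: case_prod_beta intro!: T.lincomb_add T.lincomb_scl T.lincomb_closed)

lemma \<theta>_surj:
  assumes "t \<in> carrier T"
  shows "\<exists>y. Poly_Mapping.keys y \<subseteq> pairs \<and> \<theta> y = t"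
  using assms
proof (induction rule: T_span_induct)
  case (basis i l)
  then show ?case
    by (intro exI[of _ "Poly_Mapping.single (i, l) 1"]) (simp add: \<theta>_def)
next
  case (add t t')
  then obtain y y' where "Poly_Mapping.keys y \<subseteq> pairs" "\<theta> y = t" "Poly_Mapping.keys y' \<subseteq> pairs" "\<theta> y' = t'" by blast
  then show ?case using kmapD(2)[OF \<theta>_kmap, of y y'] by (intro exI[of _ "y + y'"]) (simp add: keys_add_subset)
next
  case (sm c t)
  then obtain y where "Poly_Mapping.keys y \<subseteq> pairs" "\<theta> y = t" by blast
  then show ?case using kmapD(3)[OF \<theta>_kmap, of y c] by (intro exI[of _ "scl c y"]) (simp add: keys_scl_subset)
qed

text \<open>The images of the \<open>(n + 1)(m + 1)\<close> basis vectors of the direct sum are lifted along \<open>\<theta>\<close> to a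
space of this dimension. Since \<open>\<phi>\<close> is injective, the lifts \<open>b\<close> are independent, hence span.\<close>

lemma \<phi>_surj:
  assumes t: "t \<in> carrier T"
  shows "\<exists>f\<in>carrier V_sum. \<phi> f = t"
proof -
  let ?I = "Sigma {0..m} (\<lambda>j. {..N_top j})"
  have "\<forall>z\<in>?I. \<exists>y. Poly_Mapping.keys y \<subseteq> pairs \<and> \<theta> y = \<Phi> (fst z) (Poly_Mapping.single (snd z) 1)"
    using \<theta>_surj \<Phi>_in by auto
  then obtain b where b: "\<And>z. z \<in> ?I \<Longrightarrow> Poly_Mapping.keys (b z) \<subseteq> pairs \<and>
      \<theta> (b z) = \<Phi> (fst z) (Poly_Mapping.single (snd z) 1)" by metis
  have b_keys: "Poly_Mapping.keys (b (j, p)) \<subseteq> pairs" if "j \<le> m" "p \<le> N_top j" for j p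
    using b[of "(j, p)"] that by simp
  define vec where "vec c = (\<lambda>j\<in>{0..m}. \<Sum>p\<in>{..N_top j}. Poly_Mapping.single p (c (j, p)))" for c :: "nat \<times> nat \<Rightarrow> 'a"
  have vec_in: "vec c \<in> carrier V_sum" for c
  proof -
    have "Poly_Mapping.keys (\<Sum>p\<in>{..N_top j}. Poly_Mapping.single p (c (j, p))) \<subseteq> {..N_top j}" for j
      by (intro keys_sum_subset keys_single_subset)
    then show ?thesis by (simp add: vec_def V_sum_carrier PiE_iff)
  qed
  have \<theta>_zero: "\<theta> 0 = \<zero>\<^bsub>T\<^esub>" using kmap_zero[OF kspace_free_space kspace_T \<theta>_kmap] by simp
  have column: "\<theta> (\<Sum>p\<in>P. scl (c (j, p)) (b (j, p))) = \<Phi> j (\<Sum>p\<in>P. Poly_Mapping.single p (c (j, p)))"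
    if "j \<le> m" "finite P" "P \<subseteq> {..N_top j}" for c j P
    using that(2,3)
  proof (induction P rule: finite_induct)
    case empty
    show ?case using \<theta>_zero kmap_zero[OF kspace_free_space kspace_T \<Phi>_kmap[OF that(1)]] by simp
  next
    case (insert p P)
    have "\<theta> (\<Sum>p\<in>insert p P. scl (c (j, p)) (b (j, p))) =
        \<theta> (scl (c (j, p)) (b (j, p))) \<oplus>\<^bsub>T\<^esub> \<theta> (\<Sum>p\<in>P. scl (c (j, p)) (b (j, p)))"
    proof -
      have "Poly_Mapping.keys (\<Sum>p\<in>P. scl (c (j, p)) (b (j, p))) \<subseteq> pairs"
        using insert.prems that(1) by (intro keys_sum_subset keys_scl_subset b_keys) auto
      then show ?thesis
        using insert b[of "(j, p)"] that(1) kmapD(2)[OF \<theta>_kmap, of "scl (c (j, p)) (b (j, p))"]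
        by (simp add: keys_scl_subset)
    qed
    also have "\<theta> (scl (c (j, p)) (b (j, p))) = \<Phi> j (Poly_Mapping.single p (c (j, p)))"
      using b[of "(j, p)"] insert.prems that(1) kmapD(3)[OF \<theta>_kmap, of "b (j, p)" "c (j, p)"]
        \<Phi>_scl[of j "Poly_Mapping.single p 1" "c (j, p)"] by simp
    also have "\<theta> (\<Sum>p\<in>P. scl (c (j, p)) (b (j, p))) = \<Phi> j (\<Sum>p\<in>P. Poly_Mapping.single p (c (j, p)))"
      using insert by simp
    also have "\<Phi> j (Poly_Mapping.single p (c (j, p))) \<oplus>\<^bsub>T\<^esub> \<Phi> j (\<Sum>p\<in>P. Poly_Mapping.single p (c (j, p))) =
        \<Phi> j (\<Sum>p\<in>insert p P. Poly_Mapping.single p (c (j, p)))"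
    proof -
      have "Poly_Mapping.keys (\<Sum>p\<in>P. Poly_Mapping.single p (c (j, p))) \<subseteq> {..N_top j}"
        using insert.prems by (intro keys_sum_subset keys_single_subset) auto
      then show ?thesis
        using insert that(1) \<Phi>_add[of j "Poly_Mapping.single p (c (j, p))"]
        by (simp add: keys_single_subset del: keys_single)
    qed
    finally show ?case .
  qed
  have \<theta>_vec: "\<theta> (\<Sum>z\<in>?I. scl (c z) (b z)) = \<phi> (vec c)" for c
  proof -
    have keys: "Poly_Mapping.keys (\<Sum>p\<in>{..N_top j}. scl (c (j, p)) (b (j, p))) \<subseteq> pairs" if "j \<le> m" for j
      using that by (intro keys_sum_subset keys_scl_subset b_keys) auto
    have "(\<Sum>z\<in>?I. scl (c z) (b z)) = (\<Sum>j\<in>{0..m}. \<Sum>p\<in>{..N_top j}. scl (c (j, p)) (b (j, p)))"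
      by (subst sum.Sigma) (simp_all add: case_prod_beta)
    also have "\<dots> = finsum (free_space pairs) (\<lambda>j. \<Sum>p\<in>{..N_top j}. scl (c (j, p)) (b (j, p))) {0..m}"
      using keys by (intro finsum_free_space[symmetric]) auto
    finally have "\<theta> (\<Sum>z\<in>?I. scl (c z) (b z)) =
        \<theta> (finsum (free_space pairs) (\<lambda>j. \<Sum>p\<in>{..N_top j}. scl (c (j, p)) (b (j, p))) {0..m})"
      by (rule arg_cong)
    also have "\<dots> = (\<Oplus>\<^bsub>T\<^esub>j\<in>{0..m}. \<theta> (\<Sum>p\<in>{..N_top j}. scl (c (j, p)) (b (j, p))))"
      using keys by (intro kmap_finsum[OF kspace_free_space kspace_T \<theta>_kmap]) auto
    also have "\<dots> = \<phi> (vec c)"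
      unfolding \<phi>_def using \<Phi>_in V_sumD[OF vec_in]
      by (intro T.M.finsum_cong') (auto simp: column vec_def)
    finally show ?thesis .
  qed
  have "\<forall>z\<in>?I. c z = 0" if "(\<Sum>z\<in>?I. scl (c z) (b z)) = 0" for c
  proof -
    have "\<phi> (vec c) = \<zero>\<^bsub>T\<^esub>" using \<theta>_vec[of c] that \<theta>_zero by simp
    then have "vec c = \<zero>\<^bsub>V_sum\<^esub>" by (rule \<phi>_kernel[OF vec_in])
    then have zero: "vec c j = 0" if "j \<le> m" for j
      using that by (simp add: direct_sum_module_simps)
    show ?thesis
    proof
      fix z assume "z \<in> ?I"
      then obtain j p where z: "z = (j, p)" and jp: "j \<in> {0..m}" "p \<in> {..N_top j}" by auto
      have "0 = Poly_Mapping.lookup (vec c j) p" using zero jp by simp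
      also have "\<dots> = c (j, p)" using jp by (simp add: vec_def lookup_sum lookup_single when_def)
      finally show "c z = 0" using z by simp
    qed
  qed
  moreover obtain y where y: "Poly_Mapping.keys y \<subseteq> pairs" "\<theta> y = t" using \<theta>_surj[OF t] by blast
  ultimately obtain c where "y = (\<Sum>z\<in>?I. scl (c z) (b z))"
    using independent_family_spans[of ?I pairs b y] b card_string_indices[OF m_le_n] by auto
  then have "\<phi> (vec c) = t" using \<theta>_vec[of c] y(2) by simp
  then show ?thesis using vec_in by blast
qed

lemma V_sum_left_module: "left_module (U q) V_sum"
  using V_left_module[OF q_nz q_sq \<epsilon>\<epsilon>'_sq] nz
  by (intro left_module_direct_sum U_ring) (simp_all add: U_left_module_def)

lemma \<phi>_bij: "bij_betw \<phi> (carrier V_sum) (carrier T)"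
proof (rule bij_betw_imageI)
  interpret S: left_module "U q" V_sum by (rule V_sum_left_module)
  show "inj_on \<phi> (carrier V_sum)"
  proof (rule inj_onI)
    fix f f' assume f: "f \<in> carrier V_sum" "f' \<in> carrier V_sum" "\<phi> f = \<phi> f'"
    obtain g where g: "g \<in> carrier V_sum" "g \<oplus>\<^bsub>V_sum\<^esub> f' = \<zero>\<^bsub>V_sum\<^esub>"
      using abelian_groupE(6)[OF S.M.abelian_group_axioms f(2)] by blast
    have "\<phi> (g \<oplus>\<^bsub>V_sum\<^esub> f) = \<phi> (g \<oplus>\<^bsub>V_sum\<^esub> f')" by (simp only: \<phi>_add f g(1))
    also have "\<dots> = \<phi> (\<zero>\<^bsub>V_sum\<^esub> \<oplus>\<^bsub>V_sum\<^esub> \<zero>\<^bsub>V_sum\<^esub>)" using g(2) by simp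
    also have "\<dots> = \<phi> \<zero>\<^bsub>V_sum\<^esub> \<oplus>\<^bsub>T\<^esub> \<phi> \<zero>\<^bsub>V_sum\<^esub>" by (intro \<phi>_add) simp_all
    finally have *: "\<phi> (g \<oplus>\<^bsub>V_sum\<^esub> f) = \<phi> \<zero>\<^bsub>V_sum\<^esub> \<oplus>\<^bsub>T\<^esub> \<phi> \<zero>\<^bsub>V_sum\<^esub>" .
    have "\<phi> \<zero>\<^bsub>V_sum\<^esub> = \<phi> \<zero>\<^bsub>V_sum\<^esub> \<oplus>\<^bsub>T\<^esub> \<phi> \<zero>\<^bsub>V_sum\<^esub>"
      using \<phi>_add[of "\<zero>\<^bsub>V_sum\<^esub>" "\<zero>\<^bsub>V_sum\<^esub>"] by simp
    then have "\<phi> \<zero>\<^bsub>V_sum\<^esub> = \<zero>\<^bsub>T\<^esub>" using \<phi>_in[of "\<zero>\<^bsub>V_sum\<^esub>"] by simp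
    then have "\<phi> (g \<oplus>\<^bsub>V_sum\<^esub> f) = \<zero>\<^bsub>T\<^esub>" using * by simp
    then have "g \<oplus>\<^bsub>V_sum\<^esub> f = g \<oplus>\<^bsub>V_sum\<^esub> f'" using \<phi>_kernel[of "g \<oplus>\<^bsub>V_sum\<^esub> f"] f g by simp
    then show "f = f'" using f(1,2) g(1) by (metis S.M.add.l_cancel)
  qed
  show "\<phi> ` carrier V_sum = carrier T" using \<phi>_in \<phi>_surj by blast
qed

lemma \<phi>_iso: "\<phi> \<in> left_module_iso (U q) V_sum (tensor_module q (V q \<epsilon> n \<alpha> \<beta>) (V q \<epsilon>' m \<alpha>' \<beta>'))"
  unfolding left_module_iso_def
  using \<phi>_bij \<phi>_add \<phi>_intertwines \<phi>_in left_module_tensor_module[OF q_nz] by simp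

end

theorem corollary3p6:
  fixes q \<epsilon> \<epsilon>' \<alpha> \<beta> \<alpha>' \<beta>' :: "'k::{alg_closed_field, field_char_0}"
    and n m :: nat
  assumes "q \<noteq> 0" and "q ^ 2 \<noteq> 1"
    and "\<And>r::nat. r > 0 \<Longrightarrow> q ^ r \<noteq> 1"
    and "n \<ge> m"
    and "\<epsilon> \<in> {1, -1}" and "\<epsilon>' \<in> {1, -1}"
    and "\<alpha> \<noteq> 0" and "\<beta> \<noteq> 0" and "\<alpha>' \<noteq> 0" and "\<beta>' \<noteq> 0"
  shows "left_modules_isomorphic (U q)
    (tensor_module q (V q \<epsilon> n \<alpha> \<beta>) (V q \<epsilon>' m \<alpha>' \<beta>'))
    (direct_sum_module {0..m} (\<lambda>j. V q (\<epsilon> * \<epsilon>') (n + m - 2 * j) (\<alpha> * \<alpha>') (\<beta> * \<beta>')))"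
proof -
  interpret clebsch_gordan q \<epsilon> \<epsilon>' \<alpha> \<beta> \<alpha>' \<beta>' n m
    by unfold_locales (use assms in auto)
  have "\<forall>j\<in>{..m}. \<exists>\<Phi>. kmap (free_space {..n + m - 2 * j}) T \<Phi> \<and> \<Phi> (Poly_Mapping.single 0 1) = hwv j \<and>
    (\<forall>x. \<forall>f\<in>carrier (free_space {..n + m - 2 * j}).
      \<Phi> (V_op q (\<epsilon> * \<epsilon>') (n + m - 2 * j) (\<alpha> * \<alpha>') (\<beta> * \<beta>') x f) = Delta_op x (\<Phi> f))"
    using dominant_weight.V_map_exists[OF dominant_hwv] by blast
  then obtain \<Phi> where "\<And>j. j \<le> m \<Longrightarrow> kmap (free_space {..n + m - 2 * j}) T (\<Phi> j) \<and> \<Phi> j (Poly_Mapping.single 0 1) = hwv j \<and>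
    (\<forall>x. \<forall>f\<in>carrier (free_space {..n + m - 2 * j}).
      \<Phi> j (V_op q (\<epsilon> * \<epsilon>') (n + m - 2 * j) (\<alpha> * \<alpha>') (\<beta> * \<beta>') x f) = Delta_op x (\<Phi> j f))"
    by (metis atMost_iff)
  then interpret clebsch_gordan_maps q \<epsilon> \<epsilon>' \<alpha> \<beta> \<alpha>' \<beta>' n m \<Phi>
    by unfold_locales auto
  show ?thesis
    using left_module_tensor_module(1)[OF q_nz] V_sum_left_module \<phi>_iso by (rule left_module_iso_inverse)
qed

end
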